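(* Let $U_0$ be an admissible initial condition and let $(U(t,x),L_t)$ denote the classical solution of the free boundary problem (FBP) with initial condition $U_0$. Let $L_0=\inf\{x\in\mathbb R:U_0(x)<1\}\in\{-\infty\}\cup\mathbb R$. Then for any $r\in(-\infty,\sqrt2)\setminus\{0\}$, $$\int_{L_0}^\infty U_0(x)e^{rx}\,dx=-\frac1re^{rL_0}+\frac1r\int_0^\infty e^{rL_t-(1+\frac12r^2)t}\,dt,$$ where, in the cases $r\in(0,\sqrt2)$ or $L_0=-\infty$, this includes the possibility that both sides are $+\infty$.
   Context: Admissible initial condition: a càdlàg non-increasing function $U_0:\mathbb R\to[0,1]$ with $U_0(x)\to 1$ as $x\to-\infty$ and $U_0(x)\to 0$ as $x\to\infty$. (FBP): $\partial_t U=\frac12\Delta U+U$ for $t>0$, $x>L_t$; $U(t,x)=1$ for $t>0$, $x\le L_t$; $\partial_xU(t,L_t)=0$ for $t>0$; $U(t,\cdot)\to U_0(\cdot)$ in $L^1_{\mathrm{loc}}$ as $t\to0$. A classical solution is a pair $(U(t,x),L_t)$ such that: (i) $L_t\in\mathbb R$ for all $t>0$ and $t\mapsto L_t$ is continuous on $(0,\infty)$; (ii) $U:(0,\infty)\times\mathbb R\to[0,1]$ with $U\in C^{1,2}(\{(t,x):t>0,x>L_t\})\cap C((0,\infty)\times\mathbb R)$; (iii) $(U,L)$ satisfies (FBP). For every admissible $U_0$ a classical solution exists and is unique (known). Conventions when $L_0=-\infty$: $e^{rL_0}=0$ if $r>0$; if $r<0$ then $e^{rL_0}=+\infty$ and the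 right-hand side is read as $+\infty$. *)

theory Defs
  imports "HOL-Analysis.Analysis"
begin

definition cadlag :: "(real \<Rightarrow> real) \<Rightarrow> bool" where
  "cadlag f \<longleftrightarrow>
     (\<forall>x. continuous (at_right x) f) \<and> (\<forall>x. \<exists>l. (f \<longlongrightarrow> l) (at_left x))"

definition admissible :: "(real \<Rightarrow> real) \<Rightarrow> bool" where
  "admissible U0 \<longleftrightarrow>
     cadlag U0 \<and> antimono U0 \<and> range U0 \<subseteq> {0..1} \<and>
     (U0 \<longlongrightarrow> 1) at_bot \<and> (U0 \<longlongrightarrow> 0) at_top"

text \<open>
  Functions of time and space are curried, \<open>u t x\<close>. In \<open>C12_on\<close> the domain is meant to be open,
  so that \<open>deriv\<close> only depends on the values of \<open>u\<close> inside the domain.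
\<close>

definition C12_on :: "(real \<times> real) set \<Rightarrow> (real \<Rightarrow> real \<Rightarrow> real) \<Rightarrow> bool" where
  "C12_on D u \<longleftrightarrow>
     (\<forall>(t, x) \<in> D. (\<lambda>s. u s x) field_differentiable at t \<and>
        u t field_differentiable at x \<and>
        deriv (u t) field_differentiable at x) \<and>
     continuous_on D (\<lambda>(t, x). u t x) \<and>
     continuous_on D (\<lambda>(t, x). deriv (\<lambda>s. u s x) t) \<and>
     continuous_on D (\<lambda>(t, x). deriv (u t) x) \<and>
     continuous_on D (\<lambda>(t, x). deriv (deriv (u t)) x)"

definition L1_loc_tendsto ::
  "('a \<Rightarrow> real \<Rightarrow> real) \<Rightarrow> (real \<Rightarrow> real) \<Rightarrow> 'a filter \<Rightarrow> bool" where
  "L1_loc_tendsto f g F \<longleftrightarrow>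
     (\<forall>K. compact K \<longrightarrow>
        ((\<lambda>t. \<integral>\<^sup>+ x \<in> K. ennreal \<bar>f t x - g x\<bar> \<partial>lborel) \<longlongrightarrow> 0) F)"

text \<open>
  In the third condition the derivative at \<open>L t\<close> is the two-sided one; its left half is
  automatic because \<open>U t = 1\<close> to the left of \<open>L t\<close>.
\<close>

definition FBP :: "(real \<Rightarrow> real) \<Rightarrow> (real \<Rightarrow> real \<Rightarrow> real) \<Rightarrow> (real \<Rightarrow> real) \<Rightarrow> bool" where
  "FBP U0 U L \<longleftrightarrow>
     (\<forall>t>0. \<forall>x>L t. deriv (\<lambda>s. U s x) t = 1/2 * deriv (deriv (U t)) x + U t x) \<and>
     (\<forall>t>0. \<forall>x\<le>L t. U t x = 1) \<and>
     (\<forall>t>0. (U t has_real_derivative 0) (at (L t))) \<and>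
     L1_loc_tendsto U U0 (at_right 0)"

text \<open>Values of \<open>U\<close> and \<open>L\<close> at times \<open>t \<le> 0\<close> are irrelevant.\<close>

definition classical_solution ::
  "(real \<Rightarrow> real) \<Rightarrow> (real \<Rightarrow> real \<Rightarrow> real) \<Rightarrow> (real \<Rightarrow> real) \<Rightarrow> bool" where
  "classical_solution U0 U L \<longleftrightarrow>
     continuous_on {0<..} L \<and>
     (\<forall>t>0. \<forall>x. U t x \<in> {0..1}) \<and>
     C12_on {(t, x). t > 0 \<and> x > L t} U \<and>
     continuous_on ({0<..} \<times> UNIV) (\<lambda>(t, x). U t x) \<and>
     FBP U0 U L"

definition initial_boundary :: "(real \<Rightarrow> real) \<Rightarrow> ereal" where
  "initial_boundary U0 = Inf (ereal ` {x. U0 x < 1})"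

text \<open>
  The exponential on the extended reals. Together with \<open>ereal r * -\<infinity>\<close>, which is \<open>-\<infinity>\<close> for
  \<open>r > 0\<close> and \<open>\<infinity>\<close> for \<open>r < 0\<close>, it gives \<open>e\<^sup>r\<^sup>l\<close> at \<open>l = -\<infinity>\<close> the value \<open>0\<close> or \<open>\<infinity>\<close>, respectively.
  In type \<open>ereal\<close> one has \<open>\<infinity> + a = \<infinity>\<close> for every \<open>a\<close>, including \<open>a = -\<infinity>\<close>; hence for \<open>r < 0\<close>
  the sum \<open>- (1/r) e\<^sup>r\<^sup>l + (1/r) I\<close> is \<open>\<infinity>\<close> at \<open>l = -\<infinity>\<close>, whatever \<open>I\<close> is.
\<close>

definition exp_ereal :: "ereal \<Rightarrow> ereal" where
  "exp_ereal z = (case z of ereal x \<Rightarrow> ereal (exp x) | PInfty \<Rightarrow> \<infinity> | MInfty \<Rightarrow> 0)"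

lemma exp_ereal_simps [simp]:
  "exp_ereal (ereal x) = ereal (exp x)"
  "exp_ereal \<infinity> = \<infinity>"
  "exp_ereal (-\<infinity>) = 0"
  by (simp_all add: exp_ereal_def)

lemma rhs_at_minus_infinity:
  fixes a :: ereal
  assumes "r < 0"
  shows "- ereal (1 / r) * exp_ereal (ereal r * -\<infinity>) + a = \<infinity>"
  using assms by simp

end

theory Submission
  imports Defs
begin

text \<open>
  Put \<open>W = 1 - U\<close> and \<open>c = 1 + r\<^sup>2 / 2\<close>. The function \<open>p = exp (r x - c t)\<close> solves the backward
  equation \<open>p\<^sub>t + 1/2 p\<^sub>x\<^sub>x + p = 0\<close>. Testing the free boundary problem with it and integrating in time
  gives the formula, provided that the equation holds weakly across the free boundary and that the
  boundary terms at \<open>t = 0\<close>, \<open>t = \<infinity>\<close> and \<open>x = \<plusminus>\<infinity>\<close> can be controlled.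

  Weak form. As \<open>L\<close> is only continuous and \<open>\<partial>\<^sub>x U\<close> is only known to vanish pointwise on the boundary,
  a convex regularization of \<open>W\<close> yields the weak equation up to a nonnegative measure on the graph of
  \<open>L\<close>. This measure vanishes: the times \<open>t\<close> with \<open>W(t, L t + h) \<le> \<epsilon> h + n h\<^sup>2\<close> for all \<open>h \<ge> 0\<close> form a
  closed set \<open>T\<^sub>n\<close>, and the sets \<open>T\<^sub>n\<close> exhaust the time axis. For small \<open>\<rho>\<close> cover the graph over \<open>T\<^sub>n\<close>
  by the strips \<open>j \<rho> \<le> x + t / \<rho> \<le> (j + 1) \<rho>\<close>, of which there are \<open>O(1 / \<rho>\<^sup>2)\<close>. The supersolution
  \<open>exp (- x / \<rho> - t / \<rho>\<^sup>2)\<close>, started at the first time in \<open>T\<^sub>n\<close> at which the graph meets a strip, shows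
  that the strip carries mass \<open>O(\<epsilon> \<rho>\<^sup>2 + n \<rho>\<^sup>3)\<close>. Let \<open>\<rho> \<rightarrow> 0\<close>, then \<open>n \<rightarrow> \<infinity>\<close>, then \<open>\<epsilon> \<rightarrow> 0\<close>.

  Boundary terms. One inequality follows from the supersolutions
  \<open>exp (- c t) / (exp (- r x) + k exp (r x))\<close> as \<open>k \<rightarrow> 0\<close>. For the other one, if \<open>r < 0\<close>, the term at
  time \<open>t\<close> is at most \<open>exp (r L t - c t) / \<bar>r\<bar>\<close>, which is small along a sequence of times unless the
  integral over \<open>t\<close> diverges. If \<open>r > 0\<close>, use the subsolutions \<open>exp (r x - c t - A exp (\<delta> x - \<gamma> t))\<close>,
  with \<open>A\<close> chosen so that they are cut off near \<open>x = v T\<close> at the final time \<open>T\<close>. As \<open>T \<rightarrow> \<infinity>\<close>, the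
  term at time \<open>T\<close> vanishes if \<open>r v < c\<close>, and the cut-off disappears at time \<open>0\<close> if \<open>v > r\<close> and \<open>\<delta>\<close>
  is small. Such a \<open>v\<close> exists since \<open>r\<^sup>2 < 2\<close>.
\<close>

text \<open>\<open>defect\<close> below is, formally, half the flux \<open>Wx\<close> through the
  graph of \<open>L\<close>, tested against \<open>p\<close>. It is never computed: it is additive
  in time, linear, nonnegative for \<open>p \<ge> 0\<close>, and zero if \<open>p\<close> vanishes
  left of some \<open>y\<close> beyond the graph. So its vanishing for every \<open>p\<close>
  reduces to one function equal to 1 around the graph, and for that one it is a measure in time. The
  limit in the regularization needs \<open>W > 0\<close> almost everywhere right of
  \<open>L\<close>: at an interior zero the equation forces \<open>Wxx = 2\<close>, so the zeros in
  a time slice are isolated. The sign of \<open>r\<close> decides which unknown is tested. For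
  \<open>r < 0\<close> it is \<open>W\<close>, which vanishes on the side where
  \<open>exp (r x)\<close> explodes. For \<open>r > 0\<close> it is \<open>1 - W\<close>, equal to 1
  left of \<open>L\<close>, where \<open>exp (r x)\<close> is integrable, but with an unknown tail
  on the right. At time 0 only local convergence in L1 is given. Hence \<open>exp (r x)\<close> is
  approached from below by functions decaying on both sides; times tend to 0 for these, and monotone
  convergence then admits infinite values.\<close>

abbreviation strip :: "real \<Rightarrow> real \<Rightarrow> (real \<times> real) set" where
  "strip s t \<equiv> {s..t} \<times> UNIV"

section \<open>Rectangle identity, gluing at a level, regularization and cut-off\<close>

lemma box_identity:
  fixes F Ft H Hx :: "real \<Rightarrow> real \<Rightarrow> real"
  assumes st: "s \<le> t"
    and X: "X1 \<le> X2"
    and F: "\<And>\<tau> x. \<tau> \<in> {s..t} \<Longrightarrow> x \<in> {X1..X2} \<Longrightarrow> ((\<lambda>\<sigma>. F \<sigma> x) has_real_derivative Ft \<tau> x) (at \<tau>)"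
    and H: "\<And>\<tau> x. \<tau> \<in> {s..t} \<Longrightarrow> x \<in> {X1..X2} \<Longrightarrow> (H \<tau> has_real_derivative Hx \<tau> x) (at x)"
    and cF: "continuous_on ({s..t} \<times> {X1..X2}) (\<lambda>(\<tau>, x). Ft \<tau> x)"
    and cH: "continuous_on ({s..t} \<times> {X1..X2}) (\<lambda>(\<tau>, x). Hx \<tau> x)"
  shows "integral ({s..t} \<times> {X1..X2}) (\<lambda>(\<tau>, x). Ft \<tau> x - 1/2 * Hx \<tau> x) =
    integral {X1..X2} (\<lambda>x. F t x - F s x) - 1/2 * integral {s..t} (\<lambda>\<tau>. H \<tau> X2 - H \<tau> X1)"
proof -
  have box: "cbox (s, X1) (t, X2) = {s..t} \<times> {X1..X2}"
    by (simp add: cbox_Pair_eq)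
  have "integral ({s..t} \<times> {X1..X2}) (\<lambda>(\<tau>, x). Hx \<tau> x) =
      integral {s..t} (\<lambda>\<tau>. integral {X1..X2} (\<lambda>x. Hx \<tau> x))"
    using integral_prod_continuous[of s X1 t X2 "\<lambda>(\<tau>, x). Hx \<tau> x"] cH by (simp add: box)
  also have "\<dots> = integral {s..t} (\<lambda>\<tau>. H \<tau> X2 - H \<tau> X1)"
    by (intro integral_cong integral_unique fundamental_theorem_of_calculus)
      (use X H in \<open>auto simp: has_real_derivative_iff_has_vector_derivative[symmetric] intro: DERIV_subset\<close>)
  finally have 1: "integral ({s..t} \<times> {X1..X2}) (\<lambda>(\<tau>, x). Hx \<tau> x) =
      integral {s..t} (\<lambda>\<tau>. H \<tau> X2 - H \<tau> X1)" .
  \<comment> \<open>For \<open>Ft\<close> the order of integration is exchanged, so that the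
    fundamental theorem of calculus applies in time at fixed \<open>x\<close>; for \<open>Hx\<close>
    above it applied in space.\<close>
  have "integral ({s..t} \<times> {X1..X2}) (\<lambda>(\<tau>, x). Ft \<tau> x) =
      integral {s..t} (\<lambda>\<tau>. integral {X1..X2} (\<lambda>x. Ft \<tau> x))"
    using integral_prod_continuous[of s X1 t X2 "\<lambda>(\<tau>, x). Ft \<tau> x"] cF by (simp add: box)
  also have "\<dots> = integral {X1..X2} (\<lambda>x. integral {s..t} (\<lambda>\<tau>. Ft \<tau> x))"
    using integral_swap_continuous[of s X1 t X2 Ft] cF by (simp add: box)
  also have "\<dots> = integral {X1..X2} (\<lambda>x. F t x - F s x)"
    by (intro integral_cong integral_unique fundamental_theorem_of_calculus)
      (use st F in \<open>auto simp: has_real_derivative_iff_has_vector_derivative[symmetric] intro: DERIV_subset\<close>)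
  finally have 2: "integral ({s..t} \<times> {X1..X2}) (\<lambda>(\<tau>, x). Ft \<tau> x) =
      integral {X1..X2} (\<lambda>x. F t x - F s x)" .
  have iF: "(\<lambda>z. (\<lambda>(\<tau>, x). Ft \<tau> x) z) integrable_on {s..t} \<times> {X1..X2}"
    and iH: "(\<lambda>z. (\<lambda>(\<tau>, x). Hx \<tau> x) z) integrable_on {s..t} \<times> {X1..X2}"
    unfolding box[symmetric] by (intro integrable_continuous; use cF cH in \<open>simp add: box\<close>)+
  have "integral ({s..t} \<times> {X1..X2}) (\<lambda>z. (\<lambda>(\<tau>, x). Ft \<tau> x) z - 1/2 * (\<lambda>(\<tau>, x). Hx \<tau> x) z) =
     integral ({s..t} \<times> {X1..X2}) (\<lambda>z. (\<lambda>(\<tau>, x). Ft \<tau> x) z) -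
     integral ({s..t} \<times> {X1..X2}) (\<lambda>z. 1/2 * (\<lambda>(\<tau>, x). Hx \<tau> x) z)"
    by (intro Henstock_Kurzweil_Integration.integral_diff iF integrable_on_mult_right iH)
  then show ?thesis
    using 1 2 by (simp add: case_prod_unfold)
qed

lemma has_real_derivative_glue:
  fixes f f' :: "real \<Rightarrow> real"
  assumes f: "\<And>w. w \<ge> k \<Longrightarrow> (f has_real_derivative f' w) (at w)" and k: "f k = 0" "f' k = 0"
  shows "((\<lambda>w. if w \<le> k then 0 else f w) has_real_derivative (if w \<le> k then 0 else f' w)) (at w)"
proof -
  consider "w < k" | "w > k" | "w = k" by linarith
  then show ?thesis
  proof cases
    case 1
    have "((\<lambda>w. 0) has_real_derivative 0) (at w)" by simp
    then have "((\<lambda>w. if w \<le> k then 0 else f w) has_real_derivative 0) (at w)"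
      by (rule has_field_derivative_transform_within_open[of _ _ _ "{..<k}"]) (use 1 in auto)
    then show ?thesis using 1 by simp
  next
    case 2
    have "(f has_real_derivative f' w) (at w)" using f 2 by simp
    then have "((\<lambda>w. if w \<le> k then 0 else f w) has_real_derivative f' w) (at w)"
      by (rule has_field_derivative_transform_within_open[of _ _ _ "{k<..}"]) (use 2 in auto)
    then show ?thesis using 2 by simp
  next
    case 3
    \<comment> \<open>The difference quotient of the glued function is either 0 or that of
      \<open>f\<close>, and the latter tends to \<open>f' k = 0\<close>; domination is therefore
      enough.\<close>
    have "((\<lambda>y. (f y - f k) / (y - k)) \<longlongrightarrow> 0) (at k)"
      using f[of k] k by (simp add: has_field_derivative_iff)
    then have "((\<lambda>y. norm (f y / (y - k))) \<longlongrightarrow> 0) (at k)"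
      using k tendsto_norm_zero by force
    then have "((\<lambda>y. (if y \<le> k then 0 else f y) / (y - k)) \<longlongrightarrow> 0) (at k)"
      by (rule Lim_null_comparison[rotated]) (auto intro!: always_eventually)
    then show ?thesis
      using 3 k by (simp add: has_field_derivative_iff)
  qed
qed

lemma isCont_glue:
  fixes f :: "real \<Rightarrow> real"
  assumes f: "\<And>w. w \<ge> k \<Longrightarrow> isCont f w" and k: "f k = 0"
  shows "isCont (\<lambda>w. if w \<le> k then 0 else f w) w"
proof -
  have "continuous_on ({..k} \<union> {k..}) (\<lambda>w. if w \<le> k then 0 else f w)"
    by (rule continuous_on_If) (use f k in \<open>auto intro!: continuous_at_imp_continuous_on\<close>)
  moreover have "{..k} \<union> {k..} = (UNIV::real set)" by auto
  ultimately show ?thesis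
    by (simp add: continuous_on_eq_continuous_at)
qed

text \<open>A convex C2 function vanishing on \<open>(-\<infinity>, k]\<close> that tends to the identity on \<open>(0, \<infinity>)\<close> as \<open>k \<rightarrow> 0\<close>.\<close>

definition reg :: "real \<Rightarrow> real \<Rightarrow> real" where
  "reg k w = (if w \<le> k then 0 else (w - k) ^ 3 / w ^ 2)"
definition reg1 :: "real \<Rightarrow> real \<Rightarrow> real" where
  "reg1 k w = (if w \<le> k then 0 else (w - k) ^ 2 * (w + 2 * k) / w ^ 3)"
definition reg2 :: "real \<Rightarrow> real \<Rightarrow> real" where
  "reg2 k w = (if w \<le> k then 0 else 6 * k ^ 2 * (w - k) / w ^ 4)"

text \<open>The third power in \<open>reg\<close> makes value, first and second derivative vanish at
  \<open>k\<close>, so that gluing works twice and \<open>reg2\<close> is still continuous; the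
  division by \<open>w ^ 2\<close> brings the growth back to linear.\<close>

lemma reg_deriv:
  assumes "k > 0"
  shows "(reg k has_real_derivative reg1 k w) (at w)"
proof -
  have "((\<lambda>w. (w - k) ^ 3 / w ^ 2) has_real_derivative (w - k) ^ 2 * (w + 2 * k) / w ^ 3) (at w)" if "w \<ge> k" for w
  proof -
    have "w > 0" using that assms by simp
    then show ?thesis
      by (auto intro!: derivative_eq_intros simp: divide_simps power2_eq_square power3_eq_cube) (simp add: algebra_simps)
  qed
  then show ?thesis unfolding reg_def[abs_def] reg1_def
    by (rule has_real_derivative_glue) auto
qed

lemma reg1_deriv:
  assumes "k > 0"
  shows "(reg1 k has_real_derivative reg2 k w) (at w)"
proof -
  have "((\<lambda>w. (w - k) ^ 2 * (w + 2 * k) / w ^ 3) has_real_derivative 6 * k ^ 2 * (w - k) / w ^ 4) (at w)" if "w \<ge> k" for w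
  proof -
    have "w > 0" using that assms by simp
    then show ?thesis
      by (auto intro!: derivative_eq_intros simp: divide_simps power2_eq_square power3_eq_cube power4_eq_xxxx) (simp add: algebra_simps)
  qed
  then show ?thesis unfolding reg1_def[abs_def] reg2_def
    by (rule has_real_derivative_glue) auto
qed

lemma isCont_reg2:
  assumes "k > 0"
  shows "isCont (reg2 k) w"
proof -
  have "isCont (\<lambda>w. 6 * k ^ 2 * (w - k) / w ^ 4) w" if "w \<ge> k" for w
    using that assms by (auto intro!: continuous_intros)
  then show ?thesis unfolding reg2_def[abs_def]
    by (rule isCont_glue) auto
qed

lemma reg2_nonneg: "k > 0 \<Longrightarrow> reg2 k w \<ge> 0"
  by (auto simp: reg2_def intro!: divide_nonneg_nonneg mult_nonneg_nonneg)

lemma reg_bounds: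
  assumes "k > 0" "w \<ge> 0"
  shows "0 \<le> reg k w" "reg k w \<le> w" "0 \<le> reg1 k w" "reg1 k w \<le> 1"
proof -
  show "0 \<le> reg k w" "0 \<le> reg1 k w"
    using assms by (auto simp: reg_def reg1_def)
  have "(w - k) ^ 3 / w ^ 2 \<le> w" if "w > k"
  proof -
    have "(w - k) ^ 3 \<le> w ^ 3" using that assms by (intro power_mono) auto
    then show ?thesis using that assms by (simp add: divide_simps power2_eq_square power3_eq_cube)
  qed
  then show "reg k w \<le> w" using assms by (auto simp: reg_def)
  have "(w - k) ^ 2 * (w + 2 * k) / w ^ 3 \<le> 1" if "w > k"
  proof -
    have "w ^ 3 - (w - k) ^ 2 * (w + 2 * k) = k ^ 2 * (3 * w - 2 * k)"
      by (simp add: power2_eq_square power3_eq_cube algebra_simps)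
    moreover have "k ^ 2 * (3 * w - 2 * k) \<ge> 0" using that assms by auto
    ultimately have "(w - k) ^ 2 * (w + 2 * k) \<le> w ^ 3" by linarith
    then show ?thesis using that assms by (simp add: divide_simps)
  qed
  then show "reg1 k w \<le> 1" by (auto simp: reg1_def)
qed

text \<open>At \<open>w = 0\<close> the derivatives \<open>reg1\<close> stay 0 instead of tending to
  1. The limit of the tested equation therefore comes out right only off the zeros of
  \<open>W\<close>, which is why these must be negligible right of \<open>L\<close>.\<close>

lemma reg_tendsto:
  assumes k: "k \<longlonglongrightarrow> 0" "\<And>n. k n > 0" and w: "w \<ge> 0"
  shows "(\<lambda>n. reg (k n) w) \<longlonglongrightarrow> w" "(\<lambda>n. reg1 (k n) w) \<longlonglongrightarrow> (if w = 0 then 0 else 1)"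
proof -
  have *: "(\<lambda>n. reg (k n) w) \<longlonglongrightarrow> w \<and> (\<lambda>n. reg1 (k n) w) \<longlonglongrightarrow> (if w = 0 then 0 else 1)"
  proof (cases "w = 0")
    case True
    then have "reg (k n) w = 0" "reg1 (k n) w = 0" for n
      using k(2)[of n] by (auto simp: reg_def reg1_def)
    then show ?thesis using True by simp
  next
    case False
    then have "w > 0" using w by simp
    with k have ev: "\<forall>\<^sub>F n in sequentially. k n < w" by (auto intro: order_tendstoD)
    have 1: "(\<lambda>n. (w - k n) ^ 3 / w ^ 2) \<longlonglongrightarrow> (w - 0) ^ 3 / w ^ 2"
      and 2: "(\<lambda>n. (w - k n) ^ 2 * (w + 2 * k n) / w ^ 3) \<longlonglongrightarrow> (w - 0) ^ 2 * (w + 2 * 0) / w ^ 3"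
      using False by (intro tendsto_intros k(1); simp)+
    have 3: "(w - 0) ^ 3 / w ^ 2 = w" "(w - 0) ^ 2 * (w + 2 * 0) / w ^ 3 = 1"
      using False by (auto simp: power2_eq_square power3_eq_cube)
    have "(\<lambda>n. reg (k n) w) \<longlonglongrightarrow> w"
      using 1 unfolding 3 by (rule Lim_transform_eventually) (use ev in eventually_elim, auto simp: reg_def)
    moreover have "(\<lambda>n. reg1 (k n) w) \<longlonglongrightarrow> 1"
      using 2 unfolding 3 by (rule Lim_transform_eventually) (use ev in eventually_elim, auto simp: reg1_def)
    ultimately show ?thesis using False by simp
  qed
  show "(\<lambda>n. reg (k n) w) \<longlonglongrightarrow> w" "(\<lambda>n. reg1 (k n) w) \<longlonglongrightarrow> (if w = 0 then 0 else 1)"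
    using * by auto
qed

text \<open>Three is the smallest integer power of the positive part that is C2. Using it twice
  gives a cut-off in closed form, with derivatives from the chain rule.\<close>

definition cube_pos :: "real \<Rightarrow> real" where "cube_pos w = (if w \<le> 0 then 0 else w ^ 3)"
definition cube_pos1 :: "real \<Rightarrow> real" where "cube_pos1 w = (if w \<le> 0 then 0 else 3 * w ^ 2)"
definition cube_pos2 :: "real \<Rightarrow> real" where "cube_pos2 w = (if w \<le> 0 then 0 else 6 * w)"

lemma cube_pos_deriv: "(cube_pos has_real_derivative cube_pos1 w) (at w)"
  unfolding cube_pos_def[abs_def] cube_pos1_def
  by (rule has_real_derivative_glue) (auto intro!: derivative_eq_intros)

lemma cube_pos1_deriv: "(cube_pos1 has_real_derivative cube_pos2 w) (at w)"
  unfolding cube_pos1_def[abs_def] cube_pos2_def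
  by (rule has_real_derivative_glue) (auto intro!: derivative_eq_intros)

lemma isCont_cube_pos2: "isCont cube_pos2 w"
  unfolding cube_pos2_def[abs_def]
  by (rule isCont_glue) auto

text \<open>A C2 function equal to 1 on \<open>(-\<infinity>, 0]\<close> and to 0 on \<open>[1, \<infinity>)\<close>.\<close>

definition cutoff :: "real \<Rightarrow> real" where "cutoff x = cube_pos (1 - cube_pos x)"
definition cutoff1 :: "real \<Rightarrow> real" where "cutoff1 x = - cube_pos1 (1 - cube_pos x) * cube_pos1 x"
definition cutoff2 :: "real \<Rightarrow> real" where
  "cutoff2 x = cube_pos2 (1 - cube_pos x) * cube_pos1 x ^ 2 - cube_pos1 (1 - cube_pos x) * cube_pos2 x"

lemma cutoff_deriv: "(cutoff has_real_derivative cutoff1 x) (at x)"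
  unfolding cutoff_def[abs_def] cutoff1_def
  using DERIV_chain2[OF cube_pos_deriv DERIV_diff[OF DERIV_const cube_pos_deriv], of 1 x] by simp

lemma cutoff1_deriv: "(cutoff1 has_real_derivative cutoff2 x) (at x)"
  unfolding cutoff1_def[abs_def] cutoff2_def
  by (auto intro!: derivative_eq_intros DERIV_chain2[OF cube_pos1_deriv] cube_pos_deriv cube_pos1_deriv
      simp: power2_eq_square)

lemma isCont_cutoff2: "isCont cutoff2 x"
proof -
  have "isCont (\<lambda>x. cube_pos2 (1 - cube_pos x)) x" 
    by (rule isCont_o2[OF _ isCont_cube_pos2]) (intro continuous_intros DERIV_isCont[OF cube_pos_deriv])
  moreover have "isCont (\<lambda>x. cube_pos1 (1 - cube_pos x)) x" 
    by (rule isCont_o2[OF _ DERIV_isCont[OF cube_pos1_deriv]]) (intro continuous_intros DERIV_isCont[OF cube_pos_deriv])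
  ultimately show ?thesis unfolding cutoff2_def[abs_def]
    by (intro continuous_intros isCont_cube_pos2 DERIV_isCont[OF cube_pos1_deriv])
qed

lemma cutoff_bounds: "0 \<le> cutoff x" "cutoff x \<le> 1"
  by (auto simp: cutoff_def cube_pos_def power_le_one_iff)

lemma cutoff_left: "x \<le> 0 \<Longrightarrow> cutoff x = 1" "x \<le> 0 \<Longrightarrow> cutoff1 x = 0" "x \<le> 0 \<Longrightarrow> cutoff2 x = 0"
  by (auto simp: cutoff_def cutoff1_def cutoff2_def cube_pos_def cube_pos1_def cube_pos2_def)

lemma cutoff_right:
  assumes "x \<ge> 1" shows "cutoff x = 0" "cutoff1 x = 0" "cutoff2 x = 0"
proof -
  have "1 - cube_pos x \<le> 0" using assms by (simp add: cube_pos_def)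
  then show "cutoff x = 0" "cutoff1 x = 0" "cutoff2 x = 0"
    by (auto simp: cutoff_def cutoff1_def cutoff2_def cube_pos_def cube_pos1_def cube_pos2_def)
qed

text \<open>Both derivatives are continuous and vanish outside \<open>{0..1}\<close>. The bound
  supplies the majorant when a cut-off is shifted to infinity.\<close>

lemma cutoff_deriv_bounded: "\<exists>B. \<forall>x. \<bar>cutoff1 x\<bar> \<le> B \<and> \<bar>cutoff2 x\<bar> \<le> B"
proof -
  have b: "\<exists>B. \<forall>x\<in>{0..1}. \<bar>f x\<bar> \<le> B" if "\<And>x. isCont f x" for f :: "real \<Rightarrow> real"
  proof -
    have "compact (f ` {0..1})"
      by (intro compact_continuous_image continuous_at_imp_continuous_on) (use that in auto)
    then show ?thesis by (auto dest!: compact_imp_bounded simp: bounded_iff)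
  qed
  obtain B1 where 1: "\<And>x. x \<in> {0..1} \<Longrightarrow> \<bar>cutoff1 x\<bar> \<le> B1"
    using b[of cutoff1] DERIV_isCont[OF cutoff1_deriv] by blast
  obtain B2 where 2: "\<And>x. x \<in> {0..1} \<Longrightarrow> \<bar>cutoff2 x\<bar> \<le> B2"
    using b[of cutoff2] isCont_cutoff2 by blast
  have "\<bar>cutoff1 x\<bar> \<le> max \<bar>B1\<bar> \<bar>B2\<bar> \<and> \<bar>cutoff2 x\<bar> \<le> max \<bar>B1\<bar> \<bar>B2\<bar>" for x
    using 1[of x] 2[of x] cutoff_left[of x] cutoff_right[of x]
    by (cases "x \<in> {0..1}") (auto simp: le_max_iff_disj)
  then show ?thesis by blast
qed

lemma exp_halfline:
  assumes "l > (0::real)"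
  shows "integrable lborel (\<lambda>x. indicator {m..} x * exp (- l * x))"
    and "(LINT x|lborel. indicator {m..} x * exp (- l * x)) = exp (- l * m) / l"
proof -
  have *: "(\<integral>\<^sup>+x. ennreal (indicator {m..} x * exp (- l * x)) \<partial>lborel) = ennreal (exp (- l * m) / l)"
    by (rule nn_integral_has_integral_lebesgue[OF _ has_integral_exp_minus_to_infinity[OF assms]]) auto
  show 1: "integrable lborel (\<lambda>x. indicator {m..} x * exp (- l * x))"
    by (rule integrableI_nonneg) (use * in \<open>auto simp del: mult_minus_left\<close>)
  show "(LINT x|lborel. indicator {m..} x * exp (- l * x)) = exp (- l * m) / l"
    by (subst integral_eq_nn_integral) (use assms * in \<open>auto simp del: mult_minus_left\<close>)
qed

lemma exp_strip:
  assumes "l > (0::real)" "s \<le> t"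
  shows "integrable lborel (\<lambda>(\<tau>, x). indicator {s..t} \<tau> * (indicator {m..} x * exp (- l * x)))"
    and "(LINT z|lborel. (\<lambda>(\<tau>, x). indicator {s..t} \<tau> * (indicator {m..} x * exp (- l * x))) z) =
      (t - s) * (exp (- l * m) / l)"
proof -
  have 0: "(LINT \<tau>|lborel. indicator {s..t} \<tau>) = t - s" "integrable lborel (\<lambda>\<tau>. indicator {s..t} \<tau> :: real)"
    using assms by auto
  show 1: "integrable lborel (\<lambda>(\<tau>, x). indicator {s..t} \<tau> * (indicator {m..} x * exp (- l * x)))"
    unfolding lborel_prod[symmetric]
    by (rule lborel_pair.Fubini_integrable)
      (use 0 exp_halfline[OF assms(1)] in \<open>auto simp: abs_mult\<close>)
  show "(LINT z|lborel. (\<lambda>(\<tau>, x). indicator {s..t} \<tau> * (indicator {m..} x * exp (- l * x))) z) =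
      (t - s) * (exp (- l * m) / l)"
    using lborel_pair.integral_fst'[OF 1[unfolded lborel_prod[symmetric]]] 0 exp_halfline[OF assms(1)]
    by (simp add: lborel_prod)
qed

section \<open>Weak form of the free boundary problem\<close>

text \<open>\<open>q\<close> is the backward heat operator applied to \<open>p\<close>. Besides
  \<open>p\<close> and \<open>q\<close> only \<open>px\<close> is exposed: it enters the cross term
  when \<open>p\<close> is multiplied by a cut-off, and the flux through vertical lines.\<close>

definition test_fun :: "(real \<Rightarrow> real \<Rightarrow> real) \<Rightarrow> (real \<Rightarrow> real \<Rightarrow> real) \<Rightarrow> (real \<Rightarrow> real \<Rightarrow> real) \<Rightarrow> bool" where
  "test_fun p px q \<longleftrightarrow> (\<exists>pt pxx.
     (\<forall>t x. ((\<lambda>s. p s x) has_real_derivative pt t x) (at t)) \<and>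
     (\<forall>t x. (p t has_real_derivative px t x) (at x)) \<and>
     (\<forall>t x. (px t has_real_derivative pxx t x) (at x)) \<and>
     continuous_on UNIV (\<lambda>z. p (fst z) (snd z)) \<and>
     continuous_on UNIV (\<lambda>z. px (fst z) (snd z)) \<and>
     continuous_on UNIV (\<lambda>z. pt (fst z) (snd z)) \<and>
     continuous_on UNIV (\<lambda>z. pxx (fst z) (snd z)) \<and>
     (\<forall>t x. q t x = pt t x + 1/2 * pxx t x))"

lemma test_funE:
  assumes "test_fun p px q"
  obtains pt pxx where
    "\<And>t x. ((\<lambda>s. p s x) has_real_derivative pt t x) (at t)"
    "\<And>t x. (p t has_real_derivative px t x) (at x)"
    "\<And>t x. (px t has_real_derivative pxx t x) (at x)"
    "continuous_on UNIV (\<lambda>z. p (fst z) (snd z))"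
    "continuous_on UNIV (\<lambda>z. px (fst z) (snd z))"
    "continuous_on UNIV (\<lambda>z. pt (fst z) (snd z))"
    "continuous_on UNIV (\<lambda>z. pxx (fst z) (snd z))"
    "\<And>t x. q t x = pt t x + 1/2 * pxx t x"
  using assms unfolding test_fun_def by blast

lemma test_fun_cont:
  assumes "test_fun p px q"
  shows "continuous_on A (\<lambda>z. p (fst z) (snd z))" "continuous_on A (\<lambda>z. px (fst z) (snd z))"
    "continuous_on A (\<lambda>z. q (fst z) (snd z))"
proof -
  from assms show "continuous_on A (\<lambda>z. p (fst z) (snd z))" "continuous_on A (\<lambda>z. px (fst z) (snd z))"
    by (auto elim!: test_funE intro: continuous_on_subset)
  from assms obtain pt pxx where 1: "continuous_on UNIV (\<lambda>z. pt (fst z) (snd z))"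
    "continuous_on UNIV (\<lambda>z. pxx (fst z) (snd z))" and 2: "\<And>t x. q t x = pt t x + 1/2 * pxx t x"
    by (rule test_funE) (rule that; assumption)
  have "continuous_on UNIV (\<lambda>z. pt (fst z) (snd z) + 1/2 * pxx (fst z) (snd z))"
    by (intro continuous_intros 1)
  then have "continuous_on UNIV (\<lambda>z. q (fst z) (snd z))" using 2 by simp
  then show "continuous_on A (\<lambda>z. q (fst z) (snd z))"
    by (rule continuous_on_subset) simp
qed

text \<open>The complement of \<open>U\<close> is the unknown because it vanishes left of the
  boundary: the problem becomes contact with the obstacle 0, with source \<open>-1\<close> off the
  contact region. The derivatives are parameters, to be instantiated with the negated derivatives of
  \<open>U\<close>.\<close>

locale contact_problem =
  fixes W Wt Wx Wxx :: "real \<Rightarrow> real \<Rightarrow> real" and L :: "real \<Rightarrow> real"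
  assumes cont_L: "continuous_on {0<..} L"
    and W_bounds: "t > 0 \<Longrightarrow> 0 \<le> W t x" "t > 0 \<Longrightarrow> W t x \<le> 1"
    and cont_W: "continuous_on ({0<..} \<times> UNIV) (\<lambda>z. W (fst z) (snd z))"
    and W_left: "t > 0 \<Longrightarrow> x \<le> L t \<Longrightarrow> W t x = 0"
    and DW_t: "t > 0 \<Longrightarrow> x > L t \<Longrightarrow> ((\<lambda>s. W s x) has_real_derivative Wt t x) (at t)"
    and DW_x: "t > 0 \<Longrightarrow> x > L t \<Longrightarrow> (W t has_real_derivative Wx t x) (at x)"
    and DW_xx: "t > 0 \<Longrightarrow> x > L t \<Longrightarrow> (Wx t has_real_derivative Wxx t x) (at x)"
    and cont_Wt: "continuous_on {z. fst z > 0 \<and> snd z > L (fst z)} (\<lambda>z. Wt (fst z) (snd z))"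
    and cont_Wx: "continuous_on {z. fst z > 0 \<and> snd z > L (fst z)} (\<lambda>z. Wx (fst z) (snd z))"
    and cont_Wxx: "continuous_on {z. fst z > 0 \<and> snd z > L (fst z)} (\<lambda>z. Wxx (fst z) (snd z))"
    and eqn: "t > 0 \<Longrightarrow> x > L t \<Longrightarrow> Wt t x = 1/2 * Wxx t x + W t x - 1"
    and flat: "t > 0 \<Longrightarrow> (W t has_real_derivative 0) (at (L t))"
begin

definition D :: "(real \<times> real) set" where "D = {z. fst z > 0 \<and> snd z > L (fst z)}"

lemma cont_gap: "continuous_on ({0<..} \<times> UNIV) (\<lambda>z. snd z - L (fst z))"
  by (intro continuous_intros continuous_on_compose2[OF cont_L]) auto

lemma open_D: "open D"
proof -
  have "D = ({0<..} \<times> UNIV) \<inter> (\<lambda>z. snd z - L (fst z)) -` {0<..}" by (auto simp: D_def)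
  then show ?thesis
    by (simp only:) (rule continuous_open_preimage[OF cont_gap], auto intro: open_Times)
qed

lemma L_range:
  assumes "0 < s"
  obtains m M where "\<And>\<tau>. \<tau> \<in> {s..t} \<Longrightarrow> m \<le> L \<tau> \<and> L \<tau> \<le> M"
proof -
  have "compact (L ` {s..t})"
    by (intro compact_continuous_image continuous_on_subset[OF cont_L]) (use assms in auto)
  then obtain B where "\<forall>y\<in>L ` {s..t}. \<bar>y\<bar> \<le> B" by (auto dest!: compact_imp_bounded simp: bounded_iff)
  then show ?thesis by (intro that[of "- B" B]) (force simp: abs_le_iff)
qed

lemma cont_W_slice:
  assumes "t > 0" shows "continuous_on A (W t)"
proof -
  have "continuous_on A (\<lambda>x. (t, x))" by (intro continuous_on_Pair continuous_on_const continuous_on_id)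
  then show ?thesis
    using continuous_on_compose2[OF cont_W, of A "\<lambda>x. (t, x)"] assms by auto
qed

text \<open>The open set \<open>V\<close> is where \<open>h (W)\<close> times the test function
  dies. As \<open>D\<close> and \<open>V\<close> cover the strip, the extension by zero is
  differentiable everywhere and no boundary term at \<open>L\<close> arises. Two uses are intended:
  \<open>h = reg k\<close> with \<open>V\<close> the set where \<open>W < k\<close>, and
  \<open>h\<close> the identity with a test function that vanishes left of some \<open>y\<close>
  beyond the graph.\<close>

lemma reg_identity:
  assumes s: "0 < s" "s \<le> t" and p: "test_fun p px q"
    and h: "\<And>w. (h has_real_derivative h1 w) (at w)" "\<And>w. (h1 has_real_derivative h2 w) (at w)"
      "\<And>w. isCont h2 w" "h 0 = 0"
    and V: "open V" "strip s t \<subseteq> D \<union> V"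
      "\<And>\<tau> x. (\<tau>, x) \<in> V \<Longrightarrow> h (W \<tau> x) * p \<tau> x = 0 \<and> h (W \<tau> x) * px \<tau> x = 0"
    and X: "\<And>\<tau> x. x \<ge> X \<Longrightarrow> p \<tau> x = 0 \<and> px \<tau> x = 0 \<and> q \<tau> x = 0"
  defines "R \<equiv> \<lambda>(\<tau>, x). if x > L \<tau> then h1 (W \<tau> x) * (W \<tau> x - 1) * p \<tau> x
       - 1/2 * (h2 (W \<tau> x) * Wx \<tau> x ^ 2 * p \<tau> x) + h (W \<tau> x) * q \<tau> x else 0"
  shows "set_integrable lborel (strip s t) R"
    and "(LINT z:(strip s t)|lborel. R z) =
      (LINT x|lborel. h (W t x) * p t x) - (LINT x|lborel. h (W s x) * p s x)"
proof -
  obtain pt pxx where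
    pt: "\<And>t x. ((\<lambda>s. p s x) has_real_derivative pt t x) (at t)" and
    px: "\<And>t x. (p t has_real_derivative px t x) (at x)" and
    pxx: "\<And>t x. (px t has_real_derivative pxx t x) (at x)" and
    c: "continuous_on UNIV (\<lambda>z. p (fst z) (snd z))"
    "continuous_on UNIV (\<lambda>z. px (fst z) (snd z))"
    "continuous_on UNIV (\<lambda>z. pt (fst z) (snd z))"
    "continuous_on UNIV (\<lambda>z. pxx (fst z) (snd z))" and
    q: "\<And>t x. q t x = pt t x + 1/2 * pxx t x"
    by (rule test_funE[OF p]) (rule that; assumption)
  note cD = c[THEN continuous_on_subset[OF _ subset_UNIV[of D]]]
  have cW: "continuous_on D (\<lambda>z. W (fst z) (snd z))"
    by (rule continuous_on_subset[OF cont_W]) (auto simp: D_def)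
  have "continuous_on D (\<lambda>z. g (W (fst z) (snd z)))" if "\<And>w. isCont g w" for g :: "real \<Rightarrow> real"
    by (rule continuous_on_compose2[OF _ cW, of UNIV]) (use that in \<open>auto intro: continuous_at_imp_continuous_on\<close>)
  from this[of h] this[of h1] this[of h2]
  have ch: "continuous_on D (\<lambda>z. h (W (fst z) (snd z)))" "continuous_on D (\<lambda>z. h1 (W (fst z) (snd z)))"
    "continuous_on D (\<lambda>z. h2 (W (fst z) (snd z)))"
    using h(1)[THEN DERIV_isCont] h(2)[THEN DERIV_isCont] h(3) by auto
  note cont = ch cD cW cont_Wt[folded D_def] cont_Wx[folded D_def] cont_Wxx[folded D_def]
  define F where "F = (\<lambda>\<tau> x. h (W \<tau> x) * p \<tau> x)"
  define Ft where "Ft = (\<lambda>\<tau> x. if (\<tau>, x) \<in> D then h1 (W \<tau> x) * Wt \<tau> x * p \<tau> x + h (W \<tau> x) * pt \<tau> x else 0)"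
  define H where "H = (\<lambda>\<tau> x. if (\<tau>, x) \<in> D then h1 (W \<tau> x) * Wx \<tau> x * p \<tau> x - h (W \<tau> x) * px \<tau> x else 0)"
  define Hx where "Hx = (\<lambda>\<tau> x. if (\<tau>, x) \<in> D then
     h2 (W \<tau> x) * Wx \<tau> x ^ 2 * p \<tau> x + h1 (W \<tau> x) * Wxx \<tau> x * p \<tau> x - h (W \<tau> x) * pxx \<tau> x else 0)"
  have slice_t: "open {\<sigma>. (\<sigma>, x) \<in> A}" and slice_x: "open {y. (\<tau>, y) \<in> A}" if "open A" for \<tau> x :: real and A
  proof -
    have "open ((\<lambda>\<sigma>. (\<sigma>, x)) -` A)" "open ((\<lambda>y. (\<tau>, y)) -` A)"
      by (intro open_vimage that continuous_intros)+
    then show "open {\<sigma>. (\<sigma>, x) \<in> A}" "open {y. (\<tau>, y) \<in> A}" by (simp_all add: vimage_def)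
  qed
  have F_t: "((\<lambda>\<sigma>. F \<sigma> x) has_real_derivative Ft \<tau> x) (at \<tau>)" if "(\<tau>, x) \<in> D" for \<tau> x
    using that DW_t[of \<tau> x] unfolding F_def Ft_def
    by (auto simp: D_def intro!: derivative_eq_intros DERIV_chain2[OF h(1)] pt)
  have F_x: "(F \<tau> has_real_derivative h1 (W \<tau> x) * Wx \<tau> x * p \<tau> x + h (W \<tau> x) * px \<tau> x) (at x)" if "(\<tau>, x) \<in> D" for \<tau> x
    using that DW_x[of \<tau> x] unfolding F_def
    by (auto simp: D_def intro!: derivative_eq_intros DERIV_chain2[OF h(1)] px)
  have H_x: "(H \<tau> has_real_derivative Hx \<tau> x) (at x)" if "(\<tau>, x) \<in> D" for \<tau> x
  proof -
    have "((\<lambda>x. h1 (W \<tau> x) * Wx \<tau> x * p \<tau> x - h (W \<tau> x) * px \<tau> x) has_real_derivative Hx \<tau> x) (at x)"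
      using that DW_x[of \<tau> x] DW_xx[of \<tau> x] unfolding Hx_def
      by (auto simp: D_def power2_eq_square algebra_simps intro!: derivative_eq_intros DERIV_chain2[OF h(1)] DERIV_chain2[OF h(2)] px pxx)
    then show ?thesis
      by (rule has_field_derivative_transform_within_open[OF _ slice_x[OF open_D, of \<tau>]]) (use that in \<open>auto simp: H_def\<close>)
  qed
  have zero_x: "(G has_real_derivative 0) (at x)" if "(\<tau>, x) \<in> V" "\<And>y. (\<tau>, y) \<in> V \<Longrightarrow> G y = 0" for \<tau> x and G :: "real \<Rightarrow> real"
    by (rule has_field_derivative_transform_within_open[OF DERIV_const slice_x[OF V(1), of \<tau>]]) (use that in auto)
  have zero_t: "(G has_real_derivative 0) (at \<tau>)" if "(\<tau>, x) \<in> V" "\<And>\<sigma>. (\<sigma>, x) \<in> V \<Longrightarrow> G \<sigma> = 0" for \<tau> x and G :: "real \<Rightarrow> real"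
    by (rule has_field_derivative_transform_within_open[OF DERIV_const slice_t[OF V(1), of x]]) (use that in auto)
  have FV: "F \<tau> x = 0" if "(\<tau>, x) \<in> V" for \<tau> x using V(3)[OF that] by (simp add: F_def)
  \<comment> \<open>On the overlap of \<open>D\<close> and \<open>V\<close> the term
    \<open>h1 (W) * Wx * p\<close> is not assumed to vanish. It does, because \<open>F\<close> is
    zero on the open set \<open>V\<close> and so is its derivative in \<open>x\<close>. Uniqueness
    of derivatives also yields \<open>FtV\<close> and \<open>HxV\<close>.\<close>
  have HV: "H \<tau> x = 0" if "(\<tau>, x) \<in> V" for \<tau> x
  proof (cases "(\<tau>, x) \<in> D")
    case True
    have "h1 (W \<tau> x) * Wx \<tau> x * p \<tau> x + h (W \<tau> x) * px \<tau> x = 0"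
      by (rule DERIV_unique[OF F_x[OF True] zero_x[OF that]]) (rule FV)
    then show ?thesis using V(3)[OF that] by (auto simp: H_def)
  qed (simp add: H_def)
  have FtV: "Ft \<tau> x = 0" if "(\<tau>, x) \<in> V" for \<tau> x
  proof (cases "(\<tau>, x) \<in> D")
    case True
    show ?thesis by (rule DERIV_unique[OF F_t[OF True] zero_t[OF that]]) (rule FV)
  qed (simp add: Ft_def)
  have HxV: "Hx \<tau> x = 0" if "(\<tau>, x) \<in> V" for \<tau> x
  proof (cases "(\<tau>, x) \<in> D")
    case True
    show ?thesis by (rule DERIV_unique[OF H_x[OF True] zero_x[OF that]]) (rule HV)
  qed (simp add: Hx_def)
  have DV: "(\<tau>, x) \<in> D \<or> (\<tau>, x) \<in> V" if "\<tau> \<in> {s..t}" for \<tau> x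
    using subsetD[OF V(2), of "(\<tau>, x)"] that by auto
  have dF: "((\<lambda>\<sigma>. F \<sigma> x) has_real_derivative Ft \<tau> x) (at \<tau>)" if "\<tau> \<in> {s..t}" for \<tau> x
    using DV[OF that, of x] F_t[of \<tau> x] zero_t[of \<tau> x "\<lambda>\<sigma>. F \<sigma> x"] FV FtV[of \<tau> x] by auto
  have dH: "(H \<tau> has_real_derivative Hx \<tau> x) (at x)" if "\<tau> \<in> {s..t}" for \<tau> x
    using DV[OF that, of x] H_x[of \<tau> x] zero_x[of \<tau> x "H \<tau>"] HV HxV[of \<tau> x] by auto
  have cFt: "continuous_on (D \<union> V) (\<lambda>(\<tau>, x). Ft \<tau> x)"
  proof (rule continuous_on_open_Un[OF open_D V(1)])
    have "continuous_on D (\<lambda>z. h1 (W (fst z) (snd z)) * Wt (fst z) (snd z) * p (fst z) (snd z) + h (W (fst z) (snd z)) * pt (fst z) (snd z))"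
      by (intro continuous_intros cont)
    then show "continuous_on D (\<lambda>(\<tau>, x). Ft \<tau> x)"
      by (rule continuous_on_eq) (auto simp: Ft_def)
    have "continuous_on V (\<lambda>_. 0 :: real)" by simp
    then show "continuous_on V (\<lambda>(\<tau>, x). Ft \<tau> x)"
      by (rule continuous_on_eq) (auto simp: FtV)
  qed
  have cHx: "continuous_on (D \<union> V) (\<lambda>(\<tau>, x). Hx \<tau> x)"
  proof (rule continuous_on_open_Un[OF open_D V(1)])
    have "continuous_on D (\<lambda>z. h2 (W (fst z) (snd z)) * Wx (fst z) (snd z) ^ 2 * p (fst z) (snd z) + h1 (W (fst z) (snd z)) * Wxx (fst z) (snd z) * p (fst z) (snd z) - h (W (fst z) (snd z)) * pxx (fst z) (snd z))"
      by (intro continuous_intros cont)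
    then show "continuous_on D (\<lambda>(\<tau>, x). Hx \<tau> x)"
      by (rule continuous_on_eq) (auto simp: Hx_def)
    have "continuous_on V (\<lambda>_. 0 :: real)" by simp
    then show "continuous_on V (\<lambda>(\<tau>, x). Hx \<tau> x)"
      by (rule continuous_on_eq) (auto simp: HxV)
  qed
  obtain m M where mM: "\<And>\<tau>. \<tau> \<in> {s..t} \<Longrightarrow> m \<le> L \<tau> \<and> L \<tau> \<le> M" using L_range[OF s(1)] by blast
  \<comment> \<open>The maximum keeps \<open>{m..Y}\<close> nonempty even if the support ends left
    of the boundary.\<close>
  define Y where "Y = max X m"
  have "m \<le> Y" by (simp add: Y_def)
  let ?B = "{s..t} \<times> {m..Y}"
  \<comment> \<open>\<open>eqn\<close> replaces \<open>Wt - Wxx / 2\<close> by \<open>W - 1\<close>;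
    the chain rule for \<open>h\<close> leaves the term with \<open>h2 (W) * Wx ^ 2\<close>, and the
    terms containing \<open>h1 (W) * Wx * px\<close> have cancelled in \<open>Hx\<close>.\<close>
  have R_eq: "R z = (\<lambda>(\<tau>, x). Ft \<tau> x - 1/2 * Hx \<tau> x) z" if "z \<in> strip s t" for z
  proof -
    obtain \<tau> x where z: "z = (\<tau>, x)" by fastforce
    with that s have \<tau>: "\<tau> > 0" by auto
    show ?thesis
    proof (cases "x > L \<tau>")
      case True
      then show ?thesis unfolding z R_def Ft_def Hx_def using \<tau>
        by (simp add: D_def q eqn[OF \<tau> True] field_simps)
    next
      case False
      then show ?thesis unfolding z R_def Ft_def Hx_def by (simp add: D_def)
    qed
  qed
  have cR: "continuous_on (strip s t) R"
  proof (rule continuous_on_eq[OF _ R_eq[symmetric]])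
    have "continuous_on (D \<union> V) (\<lambda>z. (\<lambda>(\<tau>, x). Ft \<tau> x) z - 1/2 * (\<lambda>(\<tau>, x). Hx \<tau> x) z)"
      by (intro continuous_intros cFt cHx)
    then show "continuous_on (strip s t) (\<lambda>(\<tau>, x). Ft \<tau> x - 1/2 * Hx \<tau> x)"
      by (rule continuous_on_subset[OF _ V(2), rotated, THEN continuous_on_eq]) auto
  qed
  have R0: "R z = 0" if "z \<in> strip s t" "z \<notin> ?B" for z
  proof -
    obtain \<tau> x where z: "z = (\<tau>, x)" by fastforce
    then have \<tau>: "m \<le> L \<tau>" and "x < m \<or> x > Y" using that mM by auto
    then show ?thesis
    proof (elim disjE)
      assume "x < m"
      then show ?thesis using \<tau> by (simp add: R_def z)
    next
      assume "x > Y"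
      then have "p \<tau> x = 0" "q \<tau> x = 0" using X[of x \<tau>] by (auto simp: Y_def)
      then show ?thesis by (simp add: R_def z)
    qed
  qed
  have iB: "set_integrable lborel ?B R"
    unfolding set_integrable_def
    by (rule borel_integrable_compact) (auto intro: compact_Times continuous_on_subset[OF cR])
  have eqB: "indicator (strip s t) z *\<^sub>R R z = indicator ?B z *\<^sub>R R z" for z
    using R0[of z] by (auto simp: indicator_def)
  show "set_integrable lborel (strip s t) R"
    using iB unfolding set_integrable_def eqB .
  have slice: "(LINT x|lborel. F \<tau> x) = integral {m..Y} (F \<tau>)" "(F \<tau>) integrable_on {m..Y}" if "\<tau> \<in> {s..t}" for \<tau>
  proof -
    have F0: "F \<tau> x = 0" if "x \<notin> {m..Y}" for x
    proof (cases "x < m")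
      case True
      then have "W \<tau> x = 0" using mM[OF \<open>\<tau> \<in> {s..t}\<close>] s \<open>\<tau> \<in> {s..t}\<close> by (intro W_left) auto
      then show ?thesis using h(4) by (simp add: F_def)
    next
      case False
      then have "x \<ge> X" using that by (auto simp: Y_def)
      then show ?thesis using X[of x \<tau>] by (simp add: F_def)
    qed
    have "continuous_on {m..Y} (\<lambda>x. W \<tau> x)"
      using s that by (intro cont_W_slice) auto
    moreover have "continuous_on UNIV h"
      using h(1) by (meson DERIV_isCont continuous_at_imp_continuous_on)
    ultimately have 1: "continuous_on {m..Y} (\<lambda>x. h (W \<tau> x))"
      using continuous_on_compose2[of UNIV h "{m..Y}" "W \<tau>"] by simp
    have 2: "continuous_on {m..Y} (p \<tau>)"
      using px by (meson DERIV_isCont continuous_at_imp_continuous_on)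
    have "continuous_on {m..Y} (F \<tau>)"
      unfolding F_def by (rule continuous_on_mult[OF 1 2])
    then have i: "set_integrable lborel {m..Y} (F \<tau>)" by (rule borel_integrable_atLeastAtMost')
    have "(LINT x|lborel. F \<tau> x) = (LINT x:{m..Y}|lborel. F \<tau> x)"
      unfolding set_lebesgue_integral_def by (intro Bochner_Integration.integral_cong) (use F0 in \<open>auto simp: indicator_def\<close>)
    then show "(LINT x|lborel. F \<tau> x) = integral {m..Y} (F \<tau>)" "(F \<tau>) integrable_on {m..Y}"
      using set_borel_integral_eq_integral[OF i] by auto
  qed
  \<comment> \<open>The lateral fluxes disappear for different reasons: at \<open>Y\<close> the test
    function and its derivative are zero, at \<open>m\<close> the point lies outside
    \<open>D\<close>.\<close>
  have H0: "H \<tau> Y = 0" "H \<tau> m = 0" if "\<tau> \<in> {s..t}" for \<tau>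
  proof -
    show "H \<tau> Y = 0" using X[of Y \<tau>] mM[OF that] by (cases "X \<le> Y") (auto simp: H_def D_def Y_def)
    show "H \<tau> m = 0" using mM[OF that] by (auto simp: H_def D_def)
  qed
  have "(LINT z:(strip s t)|lborel. R z) = (LINT z:?B|lborel. R z)"
    unfolding set_lebesgue_integral_def eqB ..
  also have "\<dots> = integral ?B R" by (rule set_borel_integral_eq_integral[OF iB])
  also have "\<dots> = integral ?B (\<lambda>(\<tau>, x). Ft \<tau> x - 1/2 * Hx \<tau> x)"
    by (rule integral_cong) (use R_eq in auto)
  also have "\<dots> = integral {m..Y} (\<lambda>x. F t x - F s x) - 1/2 * integral {s..t} (\<lambda>\<tau>. H \<tau> Y - H \<tau> m)"
    by (rule box_identity[OF s(2) \<open>m \<le> Y\<close>])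
      (use dF dH in \<open>auto intro!: continuous_on_subset[OF cFt subset_trans[OF _ V(2)]]
        continuous_on_subset[OF cHx subset_trans[OF _ V(2)]]\<close>)
  also have "integral {s..t} (\<lambda>\<tau>. H \<tau> Y - H \<tau> m) = integral {s..t} (\<lambda>\<tau>. 0)"
    by (rule integral_cong) (simp add: H0)
  also have "integral {m..Y} (\<lambda>x. F t x - F s x) = integral {m..Y} (F t) - integral {m..Y} (F s)"
    using slice(2)[of t] slice(2)[of s] s by (intro Henstock_Kurzweil_Integration.integral_diff) auto
  finally show "(LINT z:(strip s t)|lborel. R z) =
      (LINT x|lborel. h (W t x) * p t x) - (LINT x|lborel. h (W s x) * p s x)"
    using slice(1)[of t] slice(1)[of s] s by (simp add: F_def)
qed

end

text \<open>A point at distance at least \<open>1 / n\<close> from all others is alone in its cell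
  of the grid with mesh \<open>1 / n\<close>; so \<open>n\<close> and the cell number identify
  it.\<close>

lemma countable_isolated:
  fixes S :: "real set"
  assumes "\<And>x. x \<in> S \<Longrightarrow> \<exists>d>0. \<forall>y\<in>S. y \<noteq> x \<longrightarrow> d \<le> \<bar>y - x\<bar>"
  shows "countable S"
proof -
  have "\<exists>n::nat. n > 0 \<and> (\<forall>y\<in>S. y \<noteq> x \<longrightarrow> 1 / real n \<le> \<bar>y - x\<bar>)" if xS: "x \<in> S" for x
  proof -
    obtain d where d: "d > 0" "\<forall>y\<in>S. y \<noteq> x \<longrightarrow> d \<le> \<bar>y - x\<bar>" using assms[OF xS] by blast
    obtain n :: nat where n: "n > 0" "inverse (real n) < d" using ex_inverse_of_nat_less[OF d(1)] by blast
    then show ?thesis using d(2) by (intro exI[of _ n]) (force simp: inverse_eq_divide)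
  qed
  then obtain n :: "real \<Rightarrow> nat" where
    n: "\<And>x. x \<in> S \<Longrightarrow> n x > 0" "\<And>x y. x \<in> S \<Longrightarrow> y \<in> S \<Longrightarrow> y \<noteq> x \<Longrightarrow> 1 / real (n x) \<le> \<bar>y - x\<bar>"
    by metis
  have "inj_on (\<lambda>x. (n x, \<lfloor>x * real (n x)\<rfloor>)) S"
  proof (rule inj_onI, rule ccontr)
    fix x y assume xy: "x \<in> S" "y \<in> S" "(n x, \<lfloor>x * real (n x)\<rfloor>) = (n y, \<lfloor>y * real (n y)\<rfloor>)" "x \<noteq> y"
    then have "\<lfloor>x * real (n x)\<rfloor> = \<lfloor>y * real (n x)\<rfloor>" by (metis Pair_inject)
    then have "\<bar>y * real (n x) - x * real (n x)\<bar> < 1" by linarith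
    then have "\<bar>y - x\<bar> * real (n x) < 1" by (simp add: abs_mult left_diff_distrib[symmetric])
    moreover have "1 \<le> \<bar>y - x\<bar> * real (n x)"
      using n(2)[of x y] n(1)[of x] xy by (simp add: field_simps)
    ultimately show False by simp
  qed
  then show ?thesis by (rule countableI') 
qed

section \<open>Algebra and decay of test functions\<close>

lemma test_fun_mult:
  assumes p: "test_fun p px q"
    and c: "\<And>x. (c has_real_derivative c1 x) (at x)" "\<And>x. (c1 has_real_derivative c2 x) (at x)" "\<And>x. isCont c2 x"
  shows "test_fun (\<lambda>t x. p t x * c x) (\<lambda>t x. px t x * c x + p t x * c1 x)
    (\<lambda>t x. q t x * c x + px t x * c1 x + 1/2 * (p t x * c2 x))"
proof -
  obtain pt pxx where
    pt: "\<And>t x. ((\<lambda>s. p s x) has_real_derivative pt t x) (at t)" and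
    px: "\<And>t x. (p t has_real_derivative px t x) (at x)" and
    pxx: "\<And>t x. (px t has_real_derivative pxx t x) (at x)" and
    k: "continuous_on UNIV (\<lambda>z. p (fst z) (snd z))"
    "continuous_on UNIV (\<lambda>z. px (fst z) (snd z))"
    "continuous_on UNIV (\<lambda>z. pt (fst z) (snd z))"
    "continuous_on UNIV (\<lambda>z. pxx (fst z) (snd z))" and
    q: "\<And>t x. q t x = pt t x + 1/2 * pxx t x"
    by (rule test_funE[OF p]) (rule that; assumption)
  have "continuous_on UNIV (\<lambda>z. g (snd z))" if "\<And>x. isCont g x" for g :: "real \<Rightarrow> real"
    by (rule continuous_on_compose2[of UNIV]) (use that in \<open>auto intro: continuous_at_imp_continuous_on continuous_intros\<close>)
  from this[of c] this[of c1] this[of c2]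
  have cc: "continuous_on UNIV (\<lambda>z. c (snd z))" "continuous_on UNIV (\<lambda>z. c1 (snd z))" "continuous_on UNIV (\<lambda>z. c2 (snd z))"
    using c(1)[THEN DERIV_isCont] c(2)[THEN DERIV_isCont] c(3) by auto
  show ?thesis unfolding test_fun_def
    by (rule exI[of _ "\<lambda>t x. pt t x * c x"], rule exI[of _ "\<lambda>t x. pxx t x * c x + 2 * (px t x * c1 x) + p t x * c2 x"])
      (intro conjI allI; auto intro!: derivative_eq_intros pt px pxx c(1,2) continuous_intros k cc simp: q algebra_simps)
qed

lemma test_fun_add:
  assumes p: "test_fun p px q" and p': "test_fun p' px' q'"
  shows "test_fun (\<lambda>t x. p t x + p' t x) (\<lambda>t x. px t x + px' t x) (\<lambda>t x. q t x + q' t x)"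
proof -
  obtain pt pxx where
    pt: "\<And>t x. ((\<lambda>s. p s x) has_real_derivative pt t x) (at t)" and
    px: "\<And>t x. (p t has_real_derivative px t x) (at x)" and
    pxx: "\<And>t x. (px t has_real_derivative pxx t x) (at x)" and
    k: "continuous_on UNIV (\<lambda>z. p (fst z) (snd z))"
    "continuous_on UNIV (\<lambda>z. px (fst z) (snd z))"
    "continuous_on UNIV (\<lambda>z. pt (fst z) (snd z))"
    "continuous_on UNIV (\<lambda>z. pxx (fst z) (snd z))" and
    q: "\<And>t x. q t x = pt t x + 1/2 * pxx t x"
    by (rule test_funE[OF p]) (rule that; assumption)
  obtain pt' pxx' where
    pt': "\<And>t x. ((\<lambda>s. p' s x) has_real_derivative pt' t x) (at t)" and
    px': "\<And>t x. (p' t has_real_derivative px' t x) (at x)" and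
    pxx': "\<And>t x. (px' t has_real_derivative pxx' t x) (at x)" and
    k': "continuous_on UNIV (\<lambda>z. p' (fst z) (snd z))"
    "continuous_on UNIV (\<lambda>z. px' (fst z) (snd z))"
    "continuous_on UNIV (\<lambda>z. pt' (fst z) (snd z))"
    "continuous_on UNIV (\<lambda>z. pxx' (fst z) (snd z))" and
    q': "\<And>t x. q' t x = pt' t x + 1/2 * pxx' t x"
    by (rule test_funE[OF p']) (rule that; assumption)
  show ?thesis unfolding test_fun_def
    by (rule exI[of _ "\<lambda>t x. pt t x + pt' t x"], rule exI[of _ "\<lambda>t x. pxx t x + pxx' t x"])
      (intro conjI allI; auto intro!: derivative_eq_intros pt px pxx pt' px' pxx' continuous_intros k k' simp: q q' algebra_simps)
qed

lemma test_fun_scale: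
  assumes "test_fun p px q"
  shows "test_fun (\<lambda>t x. a * p t x) (\<lambda>t x. a * px t x) (\<lambda>t x. a * q t x)"
  using test_fun_mult[OF assms, of "\<lambda>_. a" "\<lambda>_. 0" "\<lambda>_. 0"] by (simp add: mult.commute)

text \<open>Decay is asked only towards plus infinity, since \<open>W\<close> vanishes left of
  \<open>L\<close> and \<open>L\<close> is bounded below on compact intervals of positive
  times.\<close>

definition decaying :: "real \<Rightarrow> real \<Rightarrow> (real \<Rightarrow> real \<Rightarrow> real) \<Rightarrow> (real \<Rightarrow> real \<Rightarrow> real) \<Rightarrow> (real \<Rightarrow> real \<Rightarrow> real) \<Rightarrow> bool" where
  "decaying s t p px q \<longleftrightarrow> (\<exists>C l. l > 0 \<and> (\<forall>\<tau>\<in>{s..t}. \<forall>x\<ge>0.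
     \<bar>p \<tau> x\<bar> \<le> C * exp (- l * x) \<and> \<bar>px \<tau> x\<bar> \<le> C * exp (- l * x) \<and> \<bar>q \<tau> x\<bar> \<le> C * exp (- l * x)))"

lemma bounded_on_box:
  fixes f :: "real \<times> real \<Rightarrow> real"
  assumes "continuous_on UNIV f"
  shows "\<exists>B. \<forall>\<tau>\<in>{s..t}. \<forall>x\<in>{m..M}. \<bar>f (\<tau>, x)\<bar> \<le> B"
proof -
  have "compact (f ` ({s..t} \<times> {m..M}))"
    by (intro compact_continuous_image continuous_on_subset[OF assms] compact_Times) auto
  then obtain B where "\<forall>y\<in>f ` ({s..t} \<times> {m..M}). \<bar>y\<bar> \<le> B"
    by (auto dest!: compact_imp_bounded simp: bounded_iff)
  then show ?thesis by (intro exI[of _ B] ballI) auto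
qed

text \<open>The estimate is moved from 0 to an arbitrary left end \<open>m\<close>: on
  \<open>{m..0}\<close> continuity gives a bound, and \<open>exp (- l * x)\<close> is at least 1
  there.\<close>

lemma decayingE:
  assumes p: "test_fun p px q" and d: "decaying s t p px q"
  obtains K l where "K \<ge> 0" "l > 0" "\<And>\<tau> x. \<tau> \<in> {s..t} \<Longrightarrow> x \<ge> m \<Longrightarrow> \<bar>p \<tau> x\<bar> \<le> K * exp (- l * x)"
    "\<And>\<tau> x. \<tau> \<in> {s..t} \<Longrightarrow> x \<ge> m \<Longrightarrow> \<bar>px \<tau> x\<bar> \<le> K * exp (- l * x)"
    "\<And>\<tau> x. \<tau> \<in> {s..t} \<Longrightarrow> x \<ge> m \<Longrightarrow> \<bar>q \<tau> x\<bar> \<le> K * exp (- l * x)"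
proof -
  obtain C l where l: "l > 0" and C: "\<And>\<tau> x. \<tau> \<in> {s..t} \<Longrightarrow> x \<ge> 0 \<Longrightarrow>
     \<bar>p \<tau> x\<bar> \<le> C * exp (- l * x) \<and> \<bar>px \<tau> x\<bar> \<le> C * exp (- l * x) \<and> \<bar>q \<tau> x\<bar> \<le> C * exp (- l * x)"
    using d unfolding decaying_def by blast
  obtain B1 where "\<forall>\<tau>\<in>{s..t}. \<forall>x\<in>{m..0}. \<bar>p \<tau> x\<bar> \<le> B1"
    using bounded_on_box[OF test_fun_cont(1)[OF p], of s t m 0] by auto
  note B1 = this[rule_format]
  obtain B2 where "\<forall>\<tau>\<in>{s..t}. \<forall>x\<in>{m..0}. \<bar>px \<tau> x\<bar> \<le> B2"
    using bounded_on_box[OF test_fun_cont(2)[OF p], of s t m 0] by auto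
  note B2 = this[rule_format]
  obtain B3 where "\<forall>\<tau>\<in>{s..t}. \<forall>x\<in>{m..0}. \<bar>q \<tau> x\<bar> \<le> B3"
    using bounded_on_box[OF test_fun_cont(3)[OF p], of s t m 0] by auto
  note B3 = this[rule_format]
  define K where "K = \<bar>C\<bar> + \<bar>B1\<bar> + \<bar>B2\<bar> + \<bar>B3\<bar>"
  have K: "C \<le> K" "B1 \<le> K" "B2 \<le> K" "B3 \<le> K" "K \<ge> 0" unfolding K_def by linarith+
  have *: "\<bar>y\<bar> \<le> K * exp (- l * x)" if "x \<ge> 0 \<Longrightarrow> \<bar>y\<bar> \<le> C * exp (- l * x)" "x < 0 \<Longrightarrow> \<bar>y\<bar> \<le> K" for x y :: real
  proof (cases "x \<ge> 0")
    case True
    then show ?thesis using order_trans[OF that(1) mult_right_mono[OF K(1), of "exp (- l * x)"]] by simp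
  next
    case False
    then have "1 \<le> exp (- l * x)" using l by (simp add: mult_nonneg_nonpos)
    then have "K * 1 \<le> K * exp (- l * x)" using K(5) by (rule mult_left_mono)
    then show ?thesis using that(2) False by simp
  qed
  show ?thesis
  proof (rule that[OF K(5) l])
    fix \<tau> x assume a: "\<tau> \<in> {s..t}" "x \<ge> m"
    show "\<bar>p \<tau> x\<bar> \<le> K * exp (- l * x)" using C[of \<tau> x] B1[of \<tau> x] K a by (intro *) auto
    show "\<bar>px \<tau> x\<bar> \<le> K * exp (- l * x)" using C[of \<tau> x] B2[of \<tau> x] K a by (intro *) auto
    show "\<bar>q \<tau> x\<bar> \<le> K * exp (- l * x)" using C[of \<tau> x] B3[of \<tau> x] K a by (intro *) auto
  qed
qed

lemma decaying_support:
  assumes p: "test_fun p px q" and X: "\<And>\<tau> x. x \<ge> X \<Longrightarrow> p \<tau> x = 0 \<and> px \<tau> x = 0 \<and> q \<tau> x = 0"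
  shows "decaying s t p px q"
proof -
  obtain B1 where "\<forall>\<tau>\<in>{s..t}. \<forall>x\<in>{0..X}. \<bar>p \<tau> x\<bar> \<le> B1"
    using bounded_on_box[OF test_fun_cont(1)[OF p], of s t 0 X] by auto
  note B1 = this[rule_format]
  obtain B2 where "\<forall>\<tau>\<in>{s..t}. \<forall>x\<in>{0..X}. \<bar>px \<tau> x\<bar> \<le> B2"
    using bounded_on_box[OF test_fun_cont(2)[OF p], of s t 0 X] by auto
  note B2 = this[rule_format]
  obtain B3 where "\<forall>\<tau>\<in>{s..t}. \<forall>x\<in>{0..X}. \<bar>q \<tau> x\<bar> \<le> B3"
    using bounded_on_box[OF test_fun_cont(3)[OF p], of s t 0 X] by auto
  note B3 = this[rule_format]
  define K where "K = \<bar>B1\<bar> + \<bar>B2\<bar> + \<bar>B3\<bar>"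
  have K: "B1 \<le> K" "B2 \<le> K" "B3 \<le> K" "K \<ge> 0" unfolding K_def by linarith+
  have *: "\<bar>y\<bar> \<le> (K * exp X) * exp (- 1 * x)" if "x < X \<Longrightarrow> \<bar>y\<bar> \<le> K" "x \<ge> X \<Longrightarrow> y = 0" for x y :: real
  proof (cases "x < X")
    case True
    then have "K * 1 \<le> K * exp (X - x)" using K(4) by (intro mult_left_mono) auto
    then have "\<bar>y\<bar> \<le> K * exp (X - x)" using that(1) True by simp
    also have "\<dots> = (K * exp X) * exp (- 1 * x)" by (simp add: exp_diff exp_minus divide_inverse)
    finally show ?thesis .
  next
    case False
    then show ?thesis using that(2) K(4) by simp
  qed
  show ?thesis unfolding decaying_def
  proof (rule exI[of _ "K * exp X"], rule exI[of _ 1], intro conjI ballI allI impI)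
    fix \<tau> x :: real assume a: "\<tau> \<in> {s..t}" "x \<ge> 0"
    show "\<bar>p \<tau> x\<bar> \<le> (K * exp X) * exp (- 1 * x)" using X[of x \<tau>] B1[of \<tau> x] K a by (intro *) auto
    show "\<bar>px \<tau> x\<bar> \<le> (K * exp X) * exp (- 1 * x)" using X[of x \<tau>] B2[of \<tau> x] K a by (intro *) auto
    show "\<bar>q \<tau> x\<bar> \<le> (K * exp X) * exp (- 1 * x)" using X[of x \<tau>] B3[of \<tau> x] K a by (intro *) auto
  qed simp
qed

lemma decaying_subinterval:
  assumes "decaying s t p px q" "s \<le> u" "v \<le> t"
  shows "decaying u v p px q"
proof -
  have "{u..v} \<subseteq> {s..t}" using assms by auto
  then show ?thesis using assms(1) unfolding decaying_def by (elim exE conjE, intro exI conjI) (assumption, blast)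
qed

lemma decaying_scale:
  assumes "decaying s t p px q"
  shows "decaying s t (\<lambda>t x. a * p t x) (\<lambda>t x. a * px t x) (\<lambda>t x. a * q t x)"
proof -
  obtain C l where l: "l > 0" and C: "\<And>\<tau> x. \<tau> \<in> {s..t} \<Longrightarrow> x \<ge> 0 \<Longrightarrow>
     \<bar>p \<tau> x\<bar> \<le> C * exp (- l * x) \<and> \<bar>px \<tau> x\<bar> \<le> C * exp (- l * x) \<and> \<bar>q \<tau> x\<bar> \<le> C * exp (- l * x)"
    using assms unfolding decaying_def by blast
  have *: "\<bar>a * y\<bar> \<le> (\<bar>a\<bar> * C) * exp (- l * x)" if "\<bar>y\<bar> \<le> C * exp (- l * x)" for x y
    using mult_left_mono[OF that, of "\<bar>a\<bar>"] by (simp add: abs_mult mult.assoc)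
  show ?thesis unfolding decaying_def
  proof (rule exI[of _ "\<bar>a\<bar> * C"], rule exI[of _ l], intro conjI ballI allI impI l)
    fix \<tau> x :: real assume "\<tau> \<in> {s..t}" "x \<ge> 0"
    from C[OF this] show "\<bar>a * p \<tau> x\<bar> \<le> (\<bar>a\<bar> * C) * exp (- l * x)" "\<bar>a * px \<tau> x\<bar> \<le> (\<bar>a\<bar> * C) * exp (- l * x)"
      "\<bar>a * q \<tau> x\<bar> \<le> (\<bar>a\<bar> * C) * exp (- l * x)" using * by blast+
  qed
qed

lemma decaying_add:
  assumes "decaying s t p px q" "decaying s t p' px' q'"
  shows "decaying s t (\<lambda>t x. p t x + p' t x) (\<lambda>t x. px t x + px' t x) (\<lambda>t x. q t x + q' t x)"
proof -
  obtain C l where l: "l > 0" and C: "\<And>\<tau> x. \<tau> \<in> {s..t} \<Longrightarrow> x \<ge> 0 \<Longrightarrow>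
     \<bar>p \<tau> x\<bar> \<le> C * exp (- l * x) \<and> \<bar>px \<tau> x\<bar> \<le> C * exp (- l * x) \<and> \<bar>q \<tau> x\<bar> \<le> C * exp (- l * x)"
    using assms(1) unfolding decaying_def by blast
  obtain C' l' where l': "l' > 0" and C': "\<And>\<tau> x. \<tau> \<in> {s..t} \<Longrightarrow> x \<ge> 0 \<Longrightarrow>
     \<bar>p' \<tau> x\<bar> \<le> C' * exp (- l' * x) \<and> \<bar>px' \<tau> x\<bar> \<le> C' * exp (- l' * x) \<and> \<bar>q' \<tau> x\<bar> \<le> C' * exp (- l' * x)"
    using assms(2) unfolding decaying_def by blast
  define m where "m = min l l'"
  have *: "\<bar>a + b\<bar> \<le> (\<bar>C\<bar> + \<bar>C'\<bar>) * exp (- m * x)" if "\<bar>a\<bar> \<le> C * exp (- l * x)" "\<bar>b\<bar> \<le> C' * exp (- l' * x)" "x \<ge> 0" for a b x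
  proof -
    have e: "exp (- l * x) \<le> exp (- m * x)" "exp (- l' * x) \<le> exp (- m * x)"
      using that(3) by (auto simp: m_def mult_right_mono)
    have "\<bar>a + b\<bar> \<le> C * exp (- l * x) + C' * exp (- l' * x)" using that by linarith
    also have "\<dots> \<le> \<bar>C\<bar> * exp (- m * x) + \<bar>C'\<bar> * exp (- m * x)"
      by (intro add_mono mult_mono e) auto
    finally show ?thesis by (simp add: distrib_right)
  qed
  show ?thesis unfolding decaying_def
  proof (rule exI[of _ "\<bar>C\<bar> + \<bar>C'\<bar>"], rule exI[of _ m], intro conjI ballI allI impI)
    show "m > 0" using l l' by (simp add: m_def)
    fix \<tau> x :: real assume x: "\<tau> \<in> {s..t}" "x \<ge> 0"
    from C[OF x] C'[OF x] x(2) show "\<bar>p \<tau> x + p' \<tau> x\<bar> \<le> (\<bar>C\<bar> + \<bar>C'\<bar>) * exp (- m * x)"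
      "\<bar>px \<tau> x + px' \<tau> x\<bar> \<le> (\<bar>C\<bar> + \<bar>C'\<bar>) * exp (- m * x)"
      "\<bar>q \<tau> x + q' \<tau> x\<bar> \<le> (\<bar>C\<bar> + \<bar>C'\<bar>) * exp (- m * x)" using * by blast+
  qed
qed

section \<open>The defect of the weak equation: integrability and additivity\<close>

context contact_problem
begin

definition integrand :: "(real \<Rightarrow> real \<Rightarrow> real) \<Rightarrow> (real \<Rightarrow> real \<Rightarrow> real) \<Rightarrow> real \<times> real \<Rightarrow> real" where
  "integrand p q z = (if snd z > L (fst z) then W (fst z) (snd z) * q (fst z) (snd z) +
     (W (fst z) (snd z) - 1) * p (fst z) (snd z) else 0)"

text \<open>If \<open>Wx\<close> had a limit at the boundary, integration by parts would give half
  the time integral of \<open>Wx * p\<close> along the graph. The sign is chosen so that this is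
  nonnegative for \<open>p \<ge> 0\<close>.\<close>

definition defect :: "(real \<Rightarrow> real \<Rightarrow> real) \<Rightarrow> (real \<Rightarrow> real \<Rightarrow> real) \<Rightarrow> real \<Rightarrow> real \<Rightarrow> real" where
  "defect p q s t = (LINT x|lborel. W s x * p s x) - (LINT x|lborel. W t x * p t x) +
     (LINT z:(strip s t)|lborel. integrand p q z)"

lemma borel_strip [measurable]: "{s..t::real} \<times> (UNIV :: real set) \<in> sets borel"
  by (intro borel_closed closed_Times) auto

text \<open>At an interior zero \<open>W\<close> is minimal in time and in space, so
  \<open>Wt = Wx = 0\<close>, and the equation gives \<open>Wxx = 2\<close>. Then \<open>Wx\<close>
  changes sign strictly at the point, and the mean value theorem excludes other zeros
  nearby.\<close>

lemma zero_set_countable: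
  assumes t: "t > 0"
  shows "countable {x. x > L t \<and> W t x = 0}"
proof (rule countable_isolated)
  fix x assume "x \<in> {x. x > L t \<and> W t x = 0}"
  then have x: "x > L t" "W t x = 0" by auto
  \<comment> \<open>The radius \<open>t\<close> keeps the neighbourhood within positive times, where
    \<open>W \<ge> 0\<close> is known.\<close>
  have "Wt t x = 0"
    by (rule DERIV_local_min[OF DW_t[OF t x(1)], of t]) (use t x W_bounds in auto)
  moreover have Wx0: "Wx t x = 0"
    by (rule DERIV_local_min[OF DW_x[OF t x(1)], of 1]) (use t x W_bounds in auto)
  ultimately have "Wxx t x = 2" using eqn[OF t x(1)] x(2) by simp
  then have d2: "(Wx t has_real_derivative 2) (at x)" using DW_xx[OF t x(1)] by simp
  obtain d1 where d1: "d1 > 0" "\<And>h. 0 < h \<Longrightarrow> h < d1 \<Longrightarrow> Wx t x < Wx t (x + h)"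
    using DERIV_pos_inc_right[OF d2] by auto
  obtain d2 where d2: "d2 > 0" "\<And>h. 0 < h \<Longrightarrow> h < d2 \<Longrightarrow> Wx t (x - h) < Wx t x"
    using DERIV_pos_inc_left[OF d2] by auto
  show "\<exists>d>0. \<forall>y\<in>{x. x > L t \<and> W t x = 0}. y \<noteq> x \<longrightarrow> d \<le> \<bar>y - x\<bar>"
  proof (intro exI[of _ "min d1 d2"] conjI ballI impI)
    show "min d1 d2 > 0" using d1 d2 by simp
    fix y assume y: "y \<in> {x. x > L t \<and> W t x = 0}" "y \<noteq> x"
    show "min d1 d2 \<le> \<bar>y - x\<bar>"
    proof (rule ccontr)
      assume "\<not> min d1 d2 \<le> \<bar>y - x\<bar>"
      then have n: "\<bar>y - x\<bar> < d1" "\<bar>y - x\<bar> < d2" by auto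
      show False
      proof (cases "x < y")
        case True
        obtain z where z: "x < z" "z < y" "W t y - W t x = (y - x) * Wx t z"
          using MVT2[OF True, of "W t" "Wx t"] DW_x[OF t] x y by force
        then show False using d1(2)[of "z - x"] n True x y Wx0 by auto
      next
        case False
        then have "y < x" using y(2) by simp
        obtain z where z: "y < z" "z < x" "W t x - W t y = (x - y) * Wx t z"
          using MVT2[OF \<open>y < x\<close>, of "W t" "Wx t"] DW_x[OF t] x y by force
        then show False using d2(2)[of "x - z"] n \<open>y < x\<close> x y Wx0 by auto
      qed
    qed
  qed
qed

text \<open>Fubini over the countable slices. It makes \<open>reg1 (k n) (W)\<close> tend to 1
  almost everywhere on \<open>D\<close>.\<close>

lemma AE_W_pos: "AE z in lborel. z \<in> D \<longrightarrow> W (fst z) (snd z) \<noteq> 0"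
proof -
  let ?P = "\<lambda>z. z \<in> D \<longrightarrow> W (fst z) (snd z) \<noteq> 0"
  have cW: "continuous_on D (\<lambda>z. W (fst z) (snd z))"
    by (rule continuous_on_subset[OF cont_W]) (auto simp: D_def)
  have "open (D \<inter> (\<lambda>z. W (fst z) (snd z)) -` (- {0}))"
    by (rule continuous_open_preimage[OF cW open_D]) auto
  moreover have "{z. ?P z} = (- D) \<union> (D \<inter> (\<lambda>z. W (fst z) (snd z)) -` (- {0}))" by auto
  ultimately have meas: "{z. ?P z} \<in> sets borel"
    using sets.Un[OF borel_closed[OF closed_Compl[OF open_D]] borel_open] by simp
  have "AE y in lborel. ?P (\<tau>, y)" for \<tau>
  proof (cases "\<tau> > 0")
    case True
    have "{x. x > L \<tau> \<and> W \<tau> x = 0} \<in> null_sets lborel"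
      using zero_set_countable[OF True] by (rule countable_imp_null_set_lborel)
    then show ?thesis by (rule AE_I') (auto simp: D_def)
  qed (simp add: D_def)
  then have "AE x in lborel. AE y in lborel. ?P (x, y)" by simp
  moreover have "{z \<in> space (lborel \<Otimes>\<^sub>M lborel). ?P z} \<in> sets (lborel \<Otimes>\<^sub>M lborel)"
    unfolding lborel_prod sets_lborel space_lborel using meas by simp
  ultimately have "AE z in (lborel \<Otimes>\<^sub>M lborel). ?P z"
    by (intro lborel_pair.AE_pair_measure)
  then show ?thesis by (simp only: lborel_prod)
qed

lemma slice_integrable:
  assumes "0 < s" "\<tau> \<in> {s..t}" "test_fun p px q" "decaying s t p px q"
  shows "integrable lborel (\<lambda>x. W \<tau> x * p \<tau> x)"
proof -
  obtain K l where K: "K \<ge> 0" "l > 0" "\<And>\<tau>' x. \<tau>' \<in> {s..t} \<Longrightarrow> x \<ge> L \<tau> \<Longrightarrow> \<bar>p \<tau>' x\<bar> \<le> K * exp (- l * x)"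
    by (rule decayingE[OF assms(3,4), of "L \<tau>"]) blast
  have \<tau>: "\<tau> > 0" using assms by auto
  obtain pt pxx where px: "\<And>t x. (p t has_real_derivative px t x) (at x)"
    using assms(3) unfolding test_fun_def by blast
  have c: "continuous_on UNIV (\<lambda>x. W \<tau> x * p \<tau> x)"
    using px by (intro continuous_on_mult cont_W_slice[OF \<tau>]) (meson DERIV_isCont continuous_at_imp_continuous_on)
  show ?thesis
  proof (rule Bochner_Integration.integrable_bound)
    show "integrable lborel (\<lambda>x. K * (indicator {L \<tau>..} x * exp (- l * x)))"
      by (intro integrable_mult_right exp_halfline K)
    show "(\<lambda>x. W \<tau> x * p \<tau> x) \<in> borel_measurable lborel"
      using borel_measurable_continuous_onI[OF c] by simp
    show "AE x in lborel. norm (W \<tau> x * p \<tau> x) \<le> norm (K * (indicator {L \<tau>..} x * exp (- l * x)))"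
    proof (intro AE_I2)
      fix x
      show "norm (W \<tau> x * p \<tau> x) \<le> norm (K * (indicator {L \<tau>..} x * exp (- l * x)))"
        using W_left[OF \<tau>, of x] W_bounds[OF \<tau>, of x] K(3)[OF assms(2), of x] K(1)
          mult_mono[of "W \<tau> x" 1 "\<bar>p \<tau> x\<bar>" "K * exp (- l * x)"]
        by (auto simp: indicator_def abs_mult)
    qed
  qed
qed

lemma integrand_meas:
  assumes s: "0 < s" and c: "continuous_on UNIV (\<lambda>z. p (fst z) (snd z))" "continuous_on UNIV (\<lambda>z. q (fst z) (snd z))"
  shows "(\<lambda>z. indicator (strip s t) z *\<^sub>R integrand p q z) \<in> borel_measurable borel"
proof -
  let ?A = "(strip s t) \<inter> D"
  have A: "?A \<in> sets borel" by (intro sets.Int borel_strip borel_open open_D)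
  have w: "continuous_on ?A (\<lambda>z. W (fst z) (snd z))"
    by (rule continuous_on_subset[OF cont_W]) (auto simp: D_def)
  note pq = continuous_on_subset[OF c(1) subset_UNIV[of ?A]] continuous_on_subset[OF c(2) subset_UNIV[of ?A]]
  have "continuous_on ?A (\<lambda>z. W (fst z) (snd z) * q (fst z) (snd z) + (W (fst z) (snd z) - 1) * p (fst z) (snd z))"
    by (intro continuous_on_add continuous_on_mult continuous_on_diff continuous_on_const w pq)
  from borel_measurable_continuous_on_indicator[OF A this]
  have "(\<lambda>z. indicator ?A z *\<^sub>R (W (fst z) (snd z) * q (fst z) (snd z) +
     (W (fst z) (snd z) - 1) * p (fst z) (snd z))) \<in> borel_measurable borel" .
  also have "(\<lambda>z. indicator ((strip s t) \<inter> D) z *\<^sub>R (W (fst z) (snd z) * q (fst z) (snd z) +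
     (W (fst z) (snd z) - 1) * p (fst z) (snd z))) = (\<lambda>z. indicator (strip s t) z *\<^sub>R integrand p q z)"
    using s by (auto simp: fun_eq_iff indicator_def integrand_def D_def)
  finally show ?thesis .
qed

lemma integrand_bound:
  assumes s: "0 < s" "\<tau> \<in> {s..t}" and m: "\<And>\<tau>. \<tau> \<in> {s..t} \<Longrightarrow> m \<le> L \<tau>" and K: "K \<ge> 0"
    "\<And>\<tau> x. \<tau> \<in> {s..t} \<Longrightarrow> x \<ge> m \<Longrightarrow> \<bar>p \<tau> x\<bar> \<le> K * exp (- l * x)"
    "\<And>\<tau> x. \<tau> \<in> {s..t} \<Longrightarrow> x \<ge> m \<Longrightarrow> \<bar>q \<tau> x\<bar> \<le> K * exp (- l * x)"
  shows "\<bar>integrand p q (\<tau>, x)\<bar> \<le> 2 * K * (indicator {m..} x * exp (- l * x))"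
proof (cases "x > L \<tau>")
  case True
  then have x: "x \<ge> m" using m[OF s(2)] by simp
  have \<tau>: "\<tau> > 0" using s by auto
  have "\<bar>W \<tau> x * q \<tau> x + (W \<tau> x - 1) * p \<tau> x\<bar> \<le> W \<tau> x * \<bar>q \<tau> x\<bar> + (1 - W \<tau> x) * \<bar>p \<tau> x\<bar>"
    using W_bounds[OF \<tau>, of x]
    by (intro order_trans[OF abs_triangle_ineq] add_mono) (auto simp: abs_mult)
  also have "\<dots> \<le> 1 * (K * exp (- l * x)) + 1 * (K * exp (- l * x))"
    using W_bounds[OF \<tau>, of x] K s(2) x by (intro add_mono mult_mono) auto
  finally show ?thesis using True x by (simp add: integrand_def)
qed (use K(1) in \<open>auto simp: integrand_def\<close>)

text \<open>The bound proportional to \<open>v - u\<close> is recorded for the continuity of the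
  defect in its final time. The exponential majorant starts at a lower bound \<open>m\<close> of
  \<open>L\<close>.\<close>

lemma integrand_integrable:
  assumes s: "0 < s" "s \<le> t" and p: "test_fun p px q" and d: "decaying s t p px q"
  shows "set_integrable lborel (strip s t) (integrand p q)"
    and "\<exists>C. \<forall>u v. s \<le> u \<longrightarrow> u \<le> v \<longrightarrow> v \<le> t \<longrightarrow> \<bar>LINT z:(strip u v)|lborel. integrand p q z\<bar> \<le> C * (v - u)"
proof -
  obtain m M where mM: "\<And>\<tau>. \<tau> \<in> {s..t} \<Longrightarrow> m \<le> L \<tau> \<and> L \<tau> \<le> M" using L_range[OF s(1)] by blast
  obtain K l where K: "K \<ge> 0" "l > 0" "\<And>\<tau> x. \<tau> \<in> {s..t} \<Longrightarrow> x \<ge> m \<Longrightarrow> \<bar>p \<tau> x\<bar> \<le> K * exp (- l * x)"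
     "\<And>\<tau> x. \<tau> \<in> {s..t} \<Longrightarrow> x \<ge> m \<Longrightarrow> \<bar>q \<tau> x\<bar> \<le> K * exp (- l * x)"
    by (rule decayingE[OF p d, of m]) blast
  let ?G = "\<lambda>(u :: real) v. (\<lambda>(\<tau> :: real, x :: real). indicator {u..v} \<tau> * (indicator {m..} x * exp (- l * x)))"
  have b: "norm (indicator (strip u v) z *\<^sub>R integrand p q z) \<le> 2 * K * ?G u v z"
    if "s \<le> u" "v \<le> t" for u v z
  proof (cases "fst z \<in> {u..v}")
    case True
    then have "fst z \<in> {s..t}" using that by auto
    from integrand_bound[where p=p and q=q and m=m and x="snd z", OF s(1) this _ K(1) K(3,4)] mM True
    show ?thesis by (cases z) auto
  next
    case False
    then show ?thesis by (cases z) auto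
  qed
  have i: "integrable lborel (\<lambda>z. 2 * K * ?G u v z)" if "u \<le> v" for u v
    by (rule integrable_mult_right[OF exp_strip(1)[OF K(2) that]])
  have si: "set_integrable lborel (strip u v) (integrand p q)" if "s \<le> u" "u \<le> v" "v \<le> t" for u v
    unfolding set_integrable_def
  proof (rule Bochner_Integration.integrable_bound[OF i[OF that(2)]])
    show "(\<lambda>z. indicator (strip u v) z *\<^sub>R integrand p q z) \<in> borel_measurable lborel"
      using integrand_meas[of u p q v] test_fun_cont[OF p] s that by auto
    have "norm (indicator (strip u v) z *\<^sub>R integrand p q z) \<le> norm (2 * K * ?G u v z)" for z
      using b[OF that(1,3), of z] by (rule order_trans) simp
    then show "AE z in lborel. norm (indicator (strip u v) z *\<^sub>R integrand p q z) \<le> norm (2 * K * ?G u v z)"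
      by blast
  qed
  show "set_integrable lborel (strip s t) (integrand p q)" using si s by auto
  have "\<bar>LINT z:(strip u v)|lborel. integrand p q z\<bar> \<le> (2 * K * (exp (- l * m) / l)) * (v - u)"
    if "s \<le> u" "u \<le> v" "v \<le> t" for u v
  proof -
    have "\<bar>LINT z:(strip u v)|lborel. integrand p q z\<bar> \<le>
       (LINT z|lborel. norm (indicator (strip u v) z *\<^sub>R integrand p q z))"
      unfolding set_lebesgue_integral_def real_norm_def[symmetric] by (rule integral_norm_bound)
    also have "\<dots> \<le> (LINT z|lborel. 2 * K * ?G u v z)"
      using si[OF that] unfolding set_integrable_def
      by (intro integral_mono integrable_norm i that b)
    also have "\<dots> = 2 * K * ((v - u) * (exp (- l * m) / l))"
      using exp_strip(2)[OF K(2) that(2), of m] by simp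
    finally show ?thesis by (simp add: mult_ac)
  qed
  then show "\<exists>C. \<forall>u v. s \<le> u \<longrightarrow> u \<le> v \<longrightarrow> v \<le> t \<longrightarrow> \<bar>LINT z:(strip u v)|lborel. integrand p q z\<bar> \<le> C * (v - u)"
    by blast
qed

lemma defect_scale:
  "defect (\<lambda>t x. a * p t x) (\<lambda>t x. a * q t x) s t = a * defect p q s t"
proof -
  have "integrand (\<lambda>t x. a * p t x) (\<lambda>t x. a * q t x) = (\<lambda>z. a * integrand p q z)"
    by (auto simp: integrand_def fun_eq_iff algebra_simps)
  moreover have "(LINT x|lborel. W u x * (a * p u x)) = a * (LINT x|lborel. W u x * p u x)" for u
    by (subst integral_mult_right_zero[symmetric]) (simp add: mult_ac)
  ultimately show ?thesis by (simp add: defect_def algebra_simps)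
qed

lemma defect_add:
  assumes s: "0 < s" "s \<le> t" and p: "test_fun p px q" "decaying s t p px q" "test_fun p' px' q'" "decaying s t p' px' q'"
  shows "defect (\<lambda>t x. p t x + p' t x) (\<lambda>t x. q t x + q' t x) s t = defect p q s t + defect p' q' s t"
proof -
  have "integrand (\<lambda>t x. p t x + p' t x) (\<lambda>t x. q t x + q' t x) = (\<lambda>z. integrand p q z + integrand p' q' z)"
    by (auto simp: integrand_def fun_eq_iff algebra_simps)
  moreover have "(LINT x|lborel. W u x * (p u x + p' u x)) = (LINT x|lborel. W u x * p u x) + (LINT x|lborel. W u x * p' u x)"
    if "u \<in> {s..t}" for u
    unfolding distrib_left
    by (intro Bochner_Integration.integral_add slice_integrable[OF s(1) that p(1,2)] slice_integrable[OF s(1) that p(3,4)])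
  moreover have "(LINT z:(strip s t)|lborel. integrand p q z + integrand p' q' z) =
     (LINT z:(strip s t)|lborel. integrand p q z) + (LINT z:(strip s t)|lborel. integrand p' q' z)"
    by (intro set_integral_add integrand_integrable[OF s p(1,2)] integrand_integrable[OF s p(3,4)])
  ultimately show ?thesis using s by (simp add: defect_def)
qed

lemma defect_split:
  assumes s: "0 < s" "s \<le> u" "u \<le> t" and p: "test_fun p px q" "decaying s t p px q"
  shows "defect p q s t = defect p q s u + defect p q u t"
proof -
  \<comment> \<open>The two closed strips overlap in the line at time \<open>u\<close>, which is a
    null set.\<close>
  have "emeasure (lborel \<Otimes>\<^sub>M lborel) ({u} \<times> (UNIV :: real set)) = emeasure lborel {u} * emeasure lborel (UNIV :: real set)"
    by (rule lborel.emeasure_pair_measure_Times) auto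
  then have "({u} \<times> (UNIV :: real set)) \<in> null_sets lborel"
    by (auto simp: lborel_prod null_sets_def intro!: borel_closed closed_Times)
  then have "AE z in lborel. \<not> (z \<in> strip s u \<and> z \<in> strip u t)"
    by (rule AE_I') auto
  then have "(LINT z:((strip s u) \<union> (strip u t))|lborel. integrand p q z) =
    (LINT z:(strip s u)|lborel. integrand p q z) + (LINT z:(strip u t)|lborel. integrand p q z)"
    by (rule set_integral_Un_AE)
      (use s in \<open>auto intro!: integrand_integrable[OF _ _ p(1)] decaying_subinterval[OF p(2)]\<close>)
  moreover have "(strip s u) \<union> (strip u t) = strip s t" using s by auto
  ultimately show ?thesis by (simp add: defect_def)
qed

end

lemma shifted_cutoff:
  "((\<lambda>x. cutoff (x - a)) has_real_derivative cutoff1 (x - a)) (at x)"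
  "((\<lambda>x. cutoff1 (x - a)) has_real_derivative cutoff2 (x - a)) (at x)"
  "isCont (\<lambda>x. cutoff2 (x - a)) x"
proof -
  show "((\<lambda>x. cutoff (x - a)) has_real_derivative cutoff1 (x - a)) (at x)"
    using cutoff_deriv[of "x - a"] DERIV_shift[of cutoff _ x "- a"] by simp
  show "((\<lambda>x. cutoff1 (x - a)) has_real_derivative cutoff2 (x - a)) (at x)"
    using cutoff1_deriv[of "x - a"] DERIV_shift[of cutoff1 _ x "- a"] by simp
  show "isCont (\<lambda>x. cutoff2 (x - a)) x"
    by (rule isCont_o2[OF _ isCont_cutoff2]) (intro continuous_intros)
qed

section \<open>Positivity and locality of the defect\<close>

context contact_problem
begin

lemma dominator:
  assumes s: "0 < s" "s \<le> t" and p: "test_fun p px q" and d: "decaying s t p px q"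
  obtains G :: "real \<times> real \<Rightarrow> real" where "integrable lborel G" "\<And>z. G z \<ge> 0"
    "\<And>\<tau> x. \<tau> \<in> {s..t} \<Longrightarrow> x > L \<tau> \<Longrightarrow> \<bar>p \<tau> x\<bar> \<le> G (\<tau>, x)"
    "\<And>\<tau> x. \<tau> \<in> {s..t} \<Longrightarrow> x > L \<tau> \<Longrightarrow> \<bar>px \<tau> x\<bar> \<le> G (\<tau>, x)"
    "\<And>\<tau> x. \<tau> \<in> {s..t} \<Longrightarrow> x > L \<tau> \<Longrightarrow> \<bar>q \<tau> x\<bar> \<le> G (\<tau>, x)"
proof -
  obtain m M where mM: "\<And>\<tau>. \<tau> \<in> {s..t} \<Longrightarrow> m \<le> L \<tau> \<and> L \<tau> \<le> M" using L_range[OF s(1)] by blast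
  obtain K l where K: "K \<ge> 0" "l > 0" "\<And>\<tau> x. \<tau> \<in> {s..t} \<Longrightarrow> x \<ge> m \<Longrightarrow> \<bar>p \<tau> x\<bar> \<le> K * exp (- l * x)"
     "\<And>\<tau> x. \<tau> \<in> {s..t} \<Longrightarrow> x \<ge> m \<Longrightarrow> \<bar>px \<tau> x\<bar> \<le> K * exp (- l * x)"
     "\<And>\<tau> x. \<tau> \<in> {s..t} \<Longrightarrow> x \<ge> m \<Longrightarrow> \<bar>q \<tau> x\<bar> \<le> K * exp (- l * x)"
    by (rule decayingE[OF p d, of m]) blast
  define G where "G z = K * (\<lambda>(\<tau> :: real, x :: real). indicator {s..t} \<tau> * (indicator {m..} x * exp (- l * x))) z" for z
  have G: "G (\<tau>, x) = K * exp (- l * x)" if "\<tau> \<in> {s..t}" "x \<ge> m" for \<tau> x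
    using that by (simp add: G_def)
  have m: "x \<ge> m" if "\<tau> \<in> {s..t}" "x > L \<tau>" for \<tau> x using mM[OF that(1)] that(2) by simp
  show ?thesis
  proof (rule that[of G])
    show "integrable lborel G" unfolding G_def
      by (intro integrable_mult_right exp_strip(1)[OF K(2) s(2)])
    show "G z \<ge> 0" for z using K(1) by (cases z) (simp add: G_def)
  qed (use K G m in auto)
qed

lemma strip_meas:
  assumes s: "0 < s" and f: "continuous_on D f"
  shows "(\<lambda>z. indicator (strip s t) z *\<^sub>R (if snd z > L (fst z) then f z else 0 :: real)) \<in> borel_measurable borel"
proof -
  let ?A = "(strip s t) \<inter> D"
  have A: "?A \<in> sets borel" by (intro sets.Int borel_strip borel_open open_D)
  have "(\<lambda>z. indicator ?A z *\<^sub>R f z) \<in> borel_measurable borel"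
    by (rule borel_measurable_continuous_on_indicator[OF A continuous_on_subset[OF f]]) simp
  also have "(\<lambda>z. indicator ?A z *\<^sub>R f z) = (\<lambda>z. indicator (strip s t) z *\<^sub>R (if snd z > L (fst z) then f z else 0))"
    using s by (auto simp: fun_eq_iff indicator_def D_def)
  finally show ?thesis .
qed

lemma cont_W_D: "continuous_on D (\<lambda>z. W (fst z) (snd z))"
  by (rule continuous_on_subset[OF cont_W]) (auto simp: D_def)

lemma slice_meas:
  assumes "test_fun p px q" "t > 0" "continuous_on UNIV h"
  shows "(\<lambda>x. h (W t x) * p t x) \<in> borel_measurable lborel"
proof -
  obtain pt pxx where px: "\<And>t x. (p t has_real_derivative px t x) (at x)"
    using assms(1) unfolding test_fun_def by blast
  have "continuous_on UNIV (p t)" using px by (meson DERIV_isCont continuous_at_imp_continuous_on)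
  moreover have "continuous_on UNIV (\<lambda>x. h (W t x))"
    using continuous_on_compose2[OF assms(3) cont_W_slice[OF assms(2)], of UNIV] by simp
  ultimately have "continuous_on UNIV (\<lambda>x. h (W t x) * p t x)" by (intro continuous_on_mult)
  then show ?thesis using borel_measurable_continuous_onI by auto
qed

text \<open>Testing the equation of \<open>reg k (W)\<close>, which is C12 across the free boundary, produces
  the term \<open>- 1/2 reg2 k (W) Wx\<^sup>2\<close>, which has a sign.\<close>

lemma defect_nonneg_compact:
  assumes s: "0 < s" "s \<le> t" and p: "test_fun p px q"
    and X: "\<And>\<tau> x. x \<ge> X \<Longrightarrow> p \<tau> x = 0 \<and> px \<tau> x = 0 \<and> q \<tau> x = 0"
    and nn: "\<And>\<tau> x. \<tau> \<in> {s..t} \<Longrightarrow> x > L \<tau> \<Longrightarrow> p \<tau> x \<ge> 0"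
  shows "defect p q s t \<ge> 0"
proof -
  define k where "k n = 1 / real (Suc n)" for n
  have k: "k \<longlonglongrightarrow> 0" "\<And>n. k n > 0"
    unfolding k_def using LIMSEQ_inverse_real_of_nat by (auto simp: inverse_eq_divide)
  have d: "decaying s t p px q" by (rule decaying_support[OF p X])
  let ?S = "strip s t"
  define R where "R n = (\<lambda>(\<tau>, x). if x > L \<tau> then reg1 (k n) (W \<tau> x) * (W \<tau> x - 1) * p \<tau> x
       - 1/2 * (reg2 (k n) (W \<tau> x) * Wx \<tau> x ^ 2 * p \<tau> x) + reg (k n) (W \<tau> x) * q \<tau> x else 0)" for n
  \<comment> \<open>\<open>e n\<close> is \<open>R n\<close> without the term in
    \<open>Wx ^ 2\<close>. No integrable majorant for that term is available, so it is discarded by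
    its sign and only \<open>e n\<close> is passed to the limit.\<close>
  define e where "e n = (\<lambda>z. if snd z > L (fst z) then reg1 (k n) (W (fst z) (snd z)) * (W (fst z) (snd z) - 1) * p (fst z) (snd z)
       + reg (k n) (W (fst z) (snd z)) * q (fst z) (snd z) else 0)" for n
  have id: "set_integrable lborel ?S (R n)"
      "(LINT z:?S|lborel. R n z) = (LINT x|lborel. reg (k n) (W t x) * p t x) - (LINT x|lborel. reg (k n) (W s x) * p s x)" for n
  proof -
    \<comment> \<open>Where \<open>W < k n\<close> the regularization is zero. The set is open and
      contains everything left of or on the graph, because \<open>k n > 0\<close>.\<close>
    let ?V = "({0<..} \<times> UNIV) \<inter> (\<lambda>z. W (fst z) (snd z)) -` {..<k n}"
    have V1: "open ?V" by (rule continuous_open_preimage[OF cont_W]) (auto intro: open_Times)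
    have V2: "?S \<subseteq> D \<union> ?V"
    proof
      fix z assume "z \<in> ?S"
      then have "fst z > 0" using s by auto
      then show "z \<in> D \<union> ?V"
        using W_left[of "fst z" "snd z"] k(2)[of n]
        by (cases "snd z > L (fst z)") (auto simp: D_def mem_Times_iff)
    qed
    have V3: "reg (k n) (W \<tau> x) * p \<tau> x = 0 \<and> reg (k n) (W \<tau> x) * px \<tau> x = 0" if "(\<tau>, x) \<in> ?V" for \<tau> x
      using that by (simp add: reg_def)
    have r0: "reg (k n) 0 = 0" using k(2)[of n] by (simp add: reg_def)
    note * = reg_identity[OF s p reg_deriv[OF k(2)] reg1_deriv[OF k(2)] isCont_reg2[OF k(2)] r0 V1 V2 V3 X]
    show "set_integrable lborel ?S (R n)"
      "(LINT z:?S|lborel. R n z) = (LINT x|lborel. reg (k n) (W t x) * p t x) - (LINT x|lborel. reg (k n) (W s x) * p s x)"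
      unfolding R_def using * by auto
  qed
  obtain G where G: "integrable lborel G" "\<And>z. G z \<ge> 0"
    "\<And>\<tau> x. \<tau> \<in> {s..t} \<Longrightarrow> x > L \<tau> \<Longrightarrow> \<bar>p \<tau> x\<bar> \<le> G (\<tau>, x)"
    "\<And>\<tau> x. \<tau> \<in> {s..t} \<Longrightarrow> x > L \<tau> \<Longrightarrow> \<bar>q \<tau> x\<bar> \<le> G (\<tau>, x)"
    by (rule dominator[OF s p d]) blast
  have bnd: "norm (indicator ?S z *\<^sub>R e n z) \<le> 2 * G z" for n z
  proof (cases "z \<in> ?S \<and> snd z > L (fst z)")
    case True
    obtain \<tau> x where z: "z = (\<tau>, x)" by fastforce
    with True s have \<tau>: "\<tau> \<in> {s..t}" "x > L \<tau>" "\<tau> > 0" by auto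
    have "\<bar>reg1 (k n) (W \<tau> x) * (W \<tau> x - 1) * p \<tau> x\<bar> \<le> 1 * G z"
      unfolding abs_mult z using reg_bounds[OF k(2)[of n], of "W \<tau> x"] W_bounds[OF \<tau>(3), of x] G(2,3) \<tau>
      by (intro mult_mono mult_le_one) auto
    moreover have "\<bar>reg (k n) (W \<tau> x) * q \<tau> x\<bar> \<le> 1 * G z"
      unfolding abs_mult z using reg_bounds[OF k(2)[of n], of "W \<tau> x"] W_bounds[OF \<tau>(3), of x] G(2,4) \<tau>
      by (intro mult_mono) auto
    ultimately show ?thesis using \<tau> by (simp add: z e_def)
  qed (use G(2)[of z] in \<open>auto simp: e_def\<close>)
  have cp: "continuous_on D (\<lambda>z. p (fst z) (snd z))" "continuous_on D (\<lambda>z. q (fst z) (snd z))"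
    using test_fun_cont[OF p] by auto
  have cr: "continuous_on UNIV (reg (k n))" "continuous_on UNIV (reg1 (k n))" for n
    using reg_deriv[OF k(2)] reg1_deriv[OF k(2)] by (meson DERIV_isCont continuous_at_imp_continuous_on)+
  have me: "(\<lambda>z. indicator ?S z *\<^sub>R e n z) \<in> borel_measurable lborel" for n
  proof -
    have "continuous_on D (\<lambda>z. reg1 (k n) (W (fst z) (snd z)))" "continuous_on D (\<lambda>z. reg (k n) (W (fst z) (snd z)))"
      using continuous_on_compose2[OF cr(2) cont_W_D] continuous_on_compose2[OF cr(1) cont_W_D] by auto
    then have "continuous_on D (\<lambda>z. reg1 (k n) (W (fst z) (snd z)) * (W (fst z) (snd z) - 1) * p (fst z) (snd z)
       + reg (k n) (W (fst z) (snd z)) * q (fst z) (snd z))"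
      by (intro continuous_on_add continuous_on_mult continuous_on_diff continuous_on_const cont_W_D cp)
    from strip_meas[OF s(1) this] show ?thesis by (simp add: e_def)
  qed
  have i2G: "integrable lborel (\<lambda>z. 2 * G z)" using G(1) by simp
  have mI: "(\<lambda>z. indicator ?S z *\<^sub>R integrand p q z) \<in> borel_measurable lborel"
    using integrand_meas[OF s(1)] test_fun_cont[OF p] by auto
  \<comment> \<open>Where \<open>W = 0\<close> inside \<open>D\<close> the limit would lack the
    source term \<open>- p\<close>; these points are a null set by \<open>AE_W_pos\<close>.\<close>
  have lim_pt: "AE z in lborel. (\<lambda>n. indicator ?S z *\<^sub>R e n z) \<longlonglongrightarrow> indicator ?S z *\<^sub>R integrand p q z"
    using AE_W_pos
  proof eventually_elim
    case (elim z)
    show ?case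
    proof (cases "z \<in> ?S \<and> snd z > L (fst z)")
      case True
      then have z: "z \<in> D" "fst z > 0" using s by (auto simp: D_def)
      then have W: "W (fst z) (snd z) \<noteq> 0" "W (fst z) (snd z) \<ge> 0" using elim W_bounds by auto
      note r = reg_tendsto[OF k W(2)]
      have "(\<lambda>n. reg1 (k n) (W (fst z) (snd z)) * (W (fst z) (snd z) - 1) * p (fst z) (snd z)
          + reg (k n) (W (fst z) (snd z)) * q (fst z) (snd z)) \<longlonglongrightarrow> 1 * (W (fst z) (snd z) - 1) * p (fst z) (snd z)
          + W (fst z) (snd z) * q (fst z) (snd z)"
        using r W(1) by (intro tendsto_intros) auto
      then show ?thesis using True by (simp add: e_def integrand_def add.commute)
    next
      case False
      then have "indicator ?S z *\<^sub>R e n z = 0" "indicator ?S z *\<^sub>R integrand p q z = 0" for n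
        by (auto simp: e_def integrand_def indicator_def)
      then show ?thesis by (simp only: tendsto_const)
    qed
  qed
  have lim_e: "(\<lambda>n. LINT z:?S|lborel. e n z) \<longlonglongrightarrow> (LINT z:?S|lborel. integrand p q z)"
    unfolding set_lebesgue_integral_def
    by (rule integral_dominated_convergence[OF mI me i2G lim_pt]) (use bnd in auto)
  have lim_slice: "(\<lambda>n. LINT x|lborel. reg (k n) (W \<tau> x) * p \<tau> x) \<longlonglongrightarrow> (LINT x|lborel. W \<tau> x * p \<tau> x)"
    if \<tau>: "\<tau> \<in> {s..t}" for \<tau>
  proof (rule integral_dominated_convergence)
    have \<tau>0: "\<tau> > 0" using s \<tau> by auto
    have i: "integrable lborel (\<lambda>x. W \<tau> x * p \<tau> x)" by (rule slice_integrable[OF s(1) \<tau> p d])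
    then show "(\<lambda>x. W \<tau> x * p \<tau> x) \<in> borel_measurable lborel" "integrable lborel (\<lambda>x. \<bar>W \<tau> x * p \<tau> x\<bar>)" by auto
    show "(\<lambda>x. reg (k n) (W \<tau> x) * p \<tau> x) \<in> borel_measurable lborel" for n
      by (rule slice_meas[OF p \<tau>0 cr(1)])
    show "AE x in lborel. (\<lambda>n. reg (k n) (W \<tau> x) * p \<tau> x) \<longlonglongrightarrow> W \<tau> x * p \<tau> x"
      using reg_tendsto(1)[OF k] W_bounds[OF \<tau>0] by (intro AE_I2 tendsto_intros) auto
    show "AE x in lborel. norm (reg (k n) (W \<tau> x) * p \<tau> x) \<le> \<bar>W \<tau> x * p \<tau> x\<bar>" for n
      using reg_bounds[OF k(2)[of n]] W_bounds[OF \<tau>0] by (intro AE_I2) (auto simp: abs_mult intro!: mult_right_mono)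
  qed
  have "(LINT x|lborel. reg (k n) (W t x) * p t x) - (LINT x|lborel. reg (k n) (W s x) * p s x) \<le> (LINT z:?S|lborel. e n z)" for n
  proof -
    have "integrable lborel (\<lambda>z. indicator ?S z *\<^sub>R e n z)"
      by (rule Bochner_Integration.integrable_bound[OF i2G me]) (use bnd[of _ n] G(2) in auto)
    then have ie: "set_integrable lborel ?S (e n)" by (simp add: set_integrable_def)
    have "R n z \<le> e n z" if "z \<in> ?S" for z
    proof -
      have "0 \<le> 1/2 * (reg2 (k n) (W (fst z) (snd z)) * Wx (fst z) (snd z) ^ 2 * p (fst z) (snd z))" if "snd z > L (fst z)"
        using reg2_nonneg[OF k(2)] nn \<open>z \<in> ?S\<close> that by auto
      then show ?thesis by (cases z) (auto simp: R_def e_def)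
    qed
    then have "(LINT z:?S|lborel. R n z) \<le> (LINT z:?S|lborel. e n z)"
      by (intro set_integral_mono id ie)
    then show ?thesis using id(2)[of n] by simp
  qed
  then have "(LINT x|lborel. W t x * p t x) - (LINT x|lborel. W s x * p s x) \<le> (LINT z:?S|lborel. integrand p q z)"
    using s by (intro LIMSEQ_le[OF tendsto_diff[OF lim_slice lim_slice] lim_e]) auto
  then show ?thesis by (simp add: defect_def)
qed

text \<open>Such a test function never meets the graph, so the equation is classical on its support
  and \<open>reg_identity\<close> applies with the identity in place of a regularization.\<close>

lemma defect_local_compact:
  assumes s: "0 < s" "s \<le> t" and p: "test_fun p px q"
    and X: "\<And>\<tau> x. x \<ge> X \<Longrightarrow> p \<tau> x = 0 \<and> px \<tau> x = 0 \<and> q \<tau> x = 0"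
    and y: "\<And>\<tau> x. x < y \<Longrightarrow> p \<tau> x = 0" "\<And>\<tau>. \<tau> \<in> {s..t} \<Longrightarrow> L \<tau> < y"
  shows "defect p q s t = 0"
proof -
  let ?S = "strip s t"
  have px0: "px \<tau> x = 0" if "x < y" for \<tau> x
  proof -
    obtain pt pxx where px: "\<And>t x. (p t has_real_derivative px t x) (at x)"
      using p unfolding test_fun_def by blast
    have "(p \<tau> has_real_derivative 0) (at x)"
      by (rule has_field_derivative_transform_within_open[OF DERIV_const, of "{..<y}" _ 0]) (use y that in auto)
    then show ?thesis using px DERIV_unique by blast
  qed
  let ?V = "UNIV \<times> {..<y}"
  have V1: "open ?V" by (intro open_Times) auto
  have V2: "?S \<subseteq> D \<union> ?V" using y(2) s by (force simp: D_def not_less)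
  have V3: "W \<tau> x * p \<tau> x = 0 \<and> W \<tau> x * px \<tau> x = 0" if "(\<tau>, x) \<in> ?V" for \<tau> x
    using that y(1) px0 by simp
  have id1: "\<And>w. ((\<lambda>w. w) has_real_derivative 1) (at w)" "\<And>w. ((\<lambda>w. 1) has_real_derivative 0) (at w)" 
    "isCont (\<lambda>w. 0 :: real) w" "(\<lambda>w. w) 0 = (0 :: real)" for w :: real by auto
  note * = reg_identity(2)[where h = "\<lambda>w. w" and ?h1.0 = "\<lambda>_. 1" and ?h2.0 = "\<lambda>_. 0" and V = ?V, OF s p id1 V1 V2 V3 X]
  have "(LINT z:?S|lborel. integrand p q z) = (LINT x|lborel. W t x * p t x) - (LINT x|lborel. W s x * p s x)"
    by (rule trans[OF _ *], intro set_lebesgue_integral_cong) (auto simp: integrand_def)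
  then show ?thesis by (simp add: defect_def)
qed

text \<open>The cut-off has fixed width and moves to the right, so at each \<open>x\<close> it is
  eventually 1 with zero derivatives. The terms from its derivatives are bounded by the majorant of
  \<open>p\<close> and \<open>px\<close>, which is why \<open>decaying\<close> includes
  \<open>px\<close>.\<close>

lemma defect_cutoff_limit:
  assumes s: "0 < s" "s \<le> t" and p: "test_fun p px q" and d: "decaying s t p px q"
  shows "(\<lambda>n. defect (\<lambda>t x. p t x * cutoff (x - real n))
     (\<lambda>t x. q t x * cutoff (x - real n) + px t x * cutoff1 (x - real n) + 1/2 * (p t x * cutoff2 (x - real n))) s t)
     \<longlonglongrightarrow> defect p q s t"
proof -
  let ?S = "strip s t"
  let ?p = "\<lambda>n t x. p t x * cutoff (x - real n)"
  let ?q = "\<lambda>n t x. q t x * cutoff (x - real n) + px t x * cutoff1 (x - real n) + 1/2 * (p t x * cutoff2 (x - real n))"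
  have t: "test_fun (?p n) (\<lambda>t x. px t x * cutoff (x - real n) + p t x * cutoff1 (x - real n)) (?q n)" for n
    by (rule test_fun_mult[OF p shifted_cutoff])
  obtain G where G: "integrable lborel G" "\<And>z. G z \<ge> 0"
    "\<And>\<tau> x. \<tau> \<in> {s..t} \<Longrightarrow> x > L \<tau> \<Longrightarrow> \<bar>p \<tau> x\<bar> \<le> G (\<tau>, x)"
    "\<And>\<tau> x. \<tau> \<in> {s..t} \<Longrightarrow> x > L \<tau> \<Longrightarrow> \<bar>px \<tau> x\<bar> \<le> G (\<tau>, x)"
    "\<And>\<tau> x. \<tau> \<in> {s..t} \<Longrightarrow> x > L \<tau> \<Longrightarrow> \<bar>q \<tau> x\<bar> \<le> G (\<tau>, x)"
    by (rule dominator[OF s p d]) blast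
  obtain B where B: "\<And>x. \<bar>cutoff1 x\<bar> \<le> B" "\<And>x. \<bar>cutoff2 x\<bar> \<le> B" using cutoff_deriv_bounded by blast
  have B0: "B \<ge> 0" using B(1)[of 0] by simp
  have ev: "\<forall>\<^sub>F n in sequentially. cutoff (x - real n) = 1 \<and> cutoff1 (x - real n) = 0 \<and> cutoff2 (x - real n) = 0" for x
  proof -
    have "\<forall>\<^sub>F n in sequentially. real n \<ge> x"
      using filterlim_real_sequentially by (auto simp: filterlim_at_top)
    then show ?thesis by eventually_elim (simp add: cutoff_left)
  qed
  have bnd: "norm (indicator ?S z *\<^sub>R integrand (?p n) (?q n) z) \<le> (2 + 2 * B) * G z" for n z
  proof (cases "z \<in> ?S \<and> snd z > L (fst z)")
    case True
    obtain \<tau> x where z: "z = (\<tau>, x)" by fastforce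
    with True s have \<tau>: "\<tau> \<in> {s..t}" "x > L \<tau>" "\<tau> > 0" by auto
    note g = G(3-5)[OF \<tau>(1,2)] G(2)[of z] and w = W_bounds[OF \<tau>(3), of x]
    have c: "\<bar>cutoff (x - real n)\<bar> \<le> 1" using cutoff_bounds[of "x - real n"] by simp
    have q1: "\<bar>q \<tau> x * cutoff (x - real n)\<bar> \<le> G z * 1" unfolding abs_mult z
      using g c by (intro mult_mono) (auto simp: z)
    have q2: "\<bar>px \<tau> x * cutoff1 (x - real n)\<bar> \<le> G z * B" unfolding abs_mult z
      using g B by (intro mult_mono) (auto simp: z)
    have q3: "\<bar>p \<tau> x * cutoff2 (x - real n)\<bar> \<le> G z * B" unfolding abs_mult z
      using g B by (intro mult_mono) (auto simp: z)
    have q4: "\<bar>p \<tau> x * cutoff (x - real n)\<bar> \<le> G z * 1" unfolding abs_mult z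
      using g c by (intro mult_mono) (auto simp: z)
    have q5: "\<bar>?q n \<tau> x\<bar> \<le> G z * 1 + G z * B + G z * B" using q1 q2 q3 by linarith
    have "\<bar>W \<tau> x * ?q n \<tau> x\<bar> \<le> 1 * (G z * 1 + G z * B + G z * B)"
      unfolding abs_mult[of "W \<tau> x"] by (intro mult_mono q5) (use w in auto)
    moreover have "\<bar>(W \<tau> x - 1) * ?p n \<tau> x\<bar> \<le> 1 * (G z * 1)"
      unfolding abs_mult[of "W \<tau> x - 1"] using w q4 by (intro mult_mono) auto
    ultimately have "\<bar>W \<tau> x * ?q n \<tau> x + (W \<tau> x - 1) * ?p n \<tau> x\<bar> \<le> (2 + 2 * B) * G z"
      using abs_triangle_ineq[of "W \<tau> x * ?q n \<tau> x" "(W \<tau> x - 1) * ?p n \<tau> x"] by (simp add: algebra_simps)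
    then show ?thesis using \<tau> by (simp add: z integrand_def)
  qed (use G(2)[of z] B0 in \<open>auto simp: integrand_def\<close>)
  have "(\<lambda>n. LINT z:?S|lborel. integrand (?p n) (?q n) z) \<longlonglongrightarrow> (LINT z:?S|lborel. integrand p q z)"
    unfolding set_lebesgue_integral_def
  proof (rule integral_dominated_convergence)
    show "(\<lambda>z. indicator ?S z *\<^sub>R integrand p q z) \<in> borel_measurable lborel"
      using integrand_meas[OF s(1) test_fun_cont(1,3)[OF p]] by simp
    show "(\<lambda>z. indicator ?S z *\<^sub>R integrand (?p n) (?q n) z) \<in> borel_measurable lborel" for n
      using integrand_meas[OF s(1) test_fun_cont(1,3)[OF t]] by simp
    show "integrable lborel (\<lambda>z. (2 + 2 * B) * G z)" using G(1) by simp
    show "AE z in lborel. norm (indicator ?S z *\<^sub>R integrand (?p n) (?q n) z) \<le> (2 + 2 * B) * G z" for n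
      using bnd by (intro AE_I2)
    show "AE z in lborel. (\<lambda>n. indicator ?S z *\<^sub>R integrand (?p n) (?q n) z) \<longlonglongrightarrow> indicator ?S z *\<^sub>R integrand p q z"
    proof (intro AE_I2)
      fix z
      have "\<forall>\<^sub>F n in sequentially. indicator ?S z *\<^sub>R integrand (?p n) (?q n) z = indicator ?S z *\<^sub>R integrand p q z"
        using ev[of "snd z"] by eventually_elim (simp add: integrand_def)
      then show "(\<lambda>n. indicator ?S z *\<^sub>R integrand (?p n) (?q n) z) \<longlonglongrightarrow> indicator ?S z *\<^sub>R integrand p q z"
        by (rule tendsto_eventually)
    qed
  qed
  moreover have "(\<lambda>n. LINT x|lborel. W \<tau> x * ?p n \<tau> x) \<longlonglongrightarrow> (LINT x|lborel. W \<tau> x * p \<tau> x)" if \<tau>: "\<tau> \<in> {s..t}" for \<tau>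
  proof (rule integral_dominated_convergence)
    have \<tau>0: "\<tau> > 0" using s \<tau> by auto
    have i: "integrable lborel (\<lambda>x. W \<tau> x * p \<tau> x)" by (rule slice_integrable[OF s(1) \<tau> p d])
    then show "(\<lambda>x. W \<tau> x * p \<tau> x) \<in> borel_measurable lborel" "integrable lborel (\<lambda>x. \<bar>W \<tau> x * p \<tau> x\<bar>)" by auto
    show "(\<lambda>x. W \<tau> x * ?p n \<tau> x) \<in> borel_measurable lborel" for n
      using slice_meas[OF t \<tau>0 continuous_on_id] by simp
    show "AE x in lborel. (\<lambda>n. W \<tau> x * ?p n \<tau> x) \<longlonglongrightarrow> W \<tau> x * p \<tau> x"
    proof (intro AE_I2)
      fix x
      have "\<forall>\<^sub>F n in sequentially. W \<tau> x * ?p n \<tau> x = W \<tau> x * p \<tau> x"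
        using ev[of x] by eventually_elim simp
      then show "(\<lambda>n. W \<tau> x * ?p n \<tau> x) \<longlonglongrightarrow> W \<tau> x * p \<tau> x" by (rule tendsto_eventually)
    qed
    have "\<bar>W \<tau> x * p \<tau> x\<bar> * \<bar>cutoff (x - real n)\<bar> \<le> \<bar>W \<tau> x * p \<tau> x\<bar> * 1" for x n
      using cutoff_bounds[of "x - real n"] by (intro mult_left_mono) auto
    then show "AE x in lborel. norm (W \<tau> x * ?p n \<tau> x) \<le> \<bar>W \<tau> x * p \<tau> x\<bar>" for n
      by (intro AE_I2) (simp add: abs_mult mult.assoc)
  qed
  ultimately show ?thesis unfolding defect_def using s
    by (intro tendsto_add tendsto_diff) auto
qed

lemma cutoff_support:
  assumes "x \<ge> real n + 1"
  shows "p t x * cutoff (x - real n) = 0 \<and> px t x * cutoff (x - real n) + p t x * cutoff1 (x - real n) = 0 \<and>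
    q t x * cutoff (x - real n) + px t x * cutoff1 (x - real n) + 1/2 * (p t x * cutoff2 (x - real n)) = 0"
  using assms by (simp add: cutoff_right)

lemma defect_nonneg:
  assumes s: "0 < s" "s \<le> t" and p: "test_fun p px q" and d: "decaying s t p px q"
    and nn: "\<And>\<tau> x. \<tau> \<in> {s..t} \<Longrightarrow> x > L \<tau> \<Longrightarrow> p \<tau> x \<ge> 0"
  shows "defect p q s t \<ge> 0"
proof (rule LIMSEQ_le_const[OF defect_cutoff_limit[OF s p d]], intro exI allI impI)
  fix n
  show "0 \<le> defect (\<lambda>t x. p t x * cutoff (x - real n))
     (\<lambda>t x. q t x * cutoff (x - real n) + px t x * cutoff1 (x - real n) + 1/2 * (p t x * cutoff2 (x - real n))) s t"
    by (rule defect_nonneg_compact[OF s test_fun_mult[OF p shifted_cutoff[where a="real n"]] cutoff_support[where n=n and p=p and px=px and q=q]])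
      (use nn cutoff_bounds in auto)
qed

lemma defect_local:
  assumes s: "0 < s" "s \<le> t" and p: "test_fun p px q" and d: "decaying s t p px q"
    and y: "\<And>\<tau> x. x < y \<Longrightarrow> p \<tau> x = 0" "\<And>\<tau>. \<tau> \<in> {s..t} \<Longrightarrow> L \<tau> < y"
  shows "defect p q s t = 0"
proof -
  have "defect (\<lambda>t x. p t x * cutoff (x - real n))
     (\<lambda>t x. q t x * cutoff (x - real n) + px t x * cutoff1 (x - real n) + 1/2 * (p t x * cutoff2 (x - real n))) s t = 0" for n
    by (rule defect_local_compact[OF s test_fun_mult[OF p shifted_cutoff[where a="real n"]] cutoff_support[where n=n and p=p and px=px and q=q], of _ y])
      (use y in auto)
  then have "(\<lambda>n. 0) \<longlonglongrightarrow> defect p q s t" using defect_cutoff_limit[OF s p d] by simp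
  then show ?thesis by (simp add: LIMSEQ_const_iff)
qed

end

section \<open>No mass is lost at the free boundary\<close>

lemma test_fun_const: "test_fun (\<lambda>_ _. a) (\<lambda>_ _. 0) (\<lambda>_ _. 0)"
  unfolding test_fun_def by (intro exI[of _ "\<lambda>_ _. 0"]) auto

text \<open>By locality the defect depends only on the test function near the graph and left of it.
  If \<open>L < c\<close> on the interval, \<open>step c w\<close> represents the constant 1,
  whatever \<open>c\<close> and \<open>w\<close>.\<close>

definition step where "step c w = (\<lambda>(t :: real) x. cutoff ((x - c) / w))"
definition step_x where "step_x c w = (\<lambda>(t :: real) x. cutoff1 ((x - c) / w) / w)"
definition step_q where "step_q c w = (\<lambda>(t :: real) x. 1/2 * (cutoff2 ((x - c) / w) / w ^ 2))"

lemma scaled_cutoff: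
  assumes "w > 0"
  shows "((\<lambda>x. cutoff ((x - c) / w)) has_real_derivative cutoff1 ((x - c) / w) / w) (at x)"
    "((\<lambda>x. cutoff1 ((x - c) / w) / w) has_real_derivative cutoff2 ((x - c) / w) / w ^ 2) (at x)"
    "isCont (\<lambda>x. cutoff2 ((x - c) / w) / w ^ 2) x"
proof -
  have d: "((\<lambda>x. (x - c) / w) has_real_derivative 1 / w) (at x)"
    using assms by (auto intro!: derivative_eq_intros)
  show "((\<lambda>x. cutoff ((x - c) / w)) has_real_derivative cutoff1 ((x - c) / w) / w) (at x)"
    using DERIV_chain2[OF cutoff_deriv d] by simp
  show "((\<lambda>x. cutoff1 ((x - c) / w) / w) has_real_derivative cutoff2 ((x - c) / w) / w ^ 2) (at x)"
    using DERIV_cdivide[OF DERIV_chain2[OF cutoff1_deriv d], of w] by (simp add: power2_eq_square)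
  have "isCont (\<lambda>x. cutoff2 ((x - c) / w)) x"
    by (rule isCont_o2[OF DERIV_isCont[OF d] isCont_cutoff2])
  then show "isCont (\<lambda>x. cutoff2 ((x - c) / w) / w ^ 2) x"
    using assms by (intro continuous_intros) auto
qed

lemma step_test:
  assumes "w > 0" shows "test_fun (step c w) (step_x c w) (step_q c w)"
  using test_fun_mult[OF test_fun_const[of 1] scaled_cutoff[OF assms]]
  by (simp add: step_def step_x_def step_q_def)

lemma step_decaying:
  assumes "w > 0" shows "decaying s t (step c w) (step_x c w) (step_q c w)"
proof (rule decaying_support[OF step_test[OF assms]])
  fix \<tau> x :: real assume "x \<ge> c + w"
  then have "(x - c) / w \<ge> 1" using assms by (simp add: field_simps)
  then show "step c w \<tau> x = 0 \<and> step_x c w \<tau> x = 0 \<and> step_q c w \<tau> x = 0"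
    by (simp add: step_def step_x_def step_q_def cutoff_right)
qed

lemma step_left: "w > 0 \<Longrightarrow> x \<le> c \<Longrightarrow> step c w \<tau> x = 1"
  by (simp add: step_def cutoff_left divide_nonpos_pos)

lemma step_right: "w > 0 \<Longrightarrow> x \<ge> c + w \<Longrightarrow> step c w \<tau> x = 0"
  by (simp add: step_def cutoff_right)

lemma step_bounds: "0 \<le> step c w \<tau> x" "step c w \<tau> x \<le> 1"
  by (auto simp: step_def cutoff_bounds)

text \<open>A supersolution of the backward heat equation travelling to the left at speed \<open>1/\<rho>\<close>.\<close>

definition wave where "wave \<rho> t0 y0 = (\<lambda>\<tau> x. 2 * exp (1 - (x - y0) / \<rho> - (\<tau> - t0) / \<rho> ^ 2) :: real)"

lemma DERIV_exp_comp:
  assumes "(g has_real_derivative g') (at x)"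
  shows "((\<lambda>s. c * exp (g s)) has_real_derivative g' * (c * exp (g x))) (at x)"
  using DERIV_cmult[OF DERIV_fun_exp[OF assms], of c] by (simp add: mult_ac)

text \<open>The time derivative contributes \<open>- 1 / \<rho> ^ 2\<close> and half the second
  space derivative \<open>1 / (2 * \<rho> ^ 2)\<close>, so the operator is negative. The summand 1
  in the exponent together with the factor 2 keeps the wave at least 2 until its front has advanced
  by \<open>\<rho>\<close>.\<close>

lemma wave_test:
  assumes "\<rho> > 0"
  shows "test_fun (wave \<rho> t0 y0) (\<lambda>\<tau> x. - (1 / \<rho>) * wave \<rho> t0 y0 \<tau> x) (\<lambda>\<tau> x. - (1 / (2 * \<rho> ^ 2)) * wave \<rho> t0 y0 \<tau> x)"
proof -
  let ?p = "wave \<rho> t0 y0"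
  have g: "((\<lambda>s. 1 - (x - y0) / \<rho> - (s - t0) / \<rho> ^ 2) has_real_derivative - (1 / \<rho> ^ 2)) (at \<tau>)"
    "((\<lambda>x. 1 - (x - y0) / \<rho> - (\<tau> - t0) / \<rho> ^ 2) has_real_derivative - (1 / \<rho>)) (at x)" for \<tau> x
    unfolding divide_inverse by (auto intro!: derivative_eq_intros)
  have t: "((\<lambda>s. ?p s x) has_real_derivative - (1 / \<rho> ^ 2) * ?p \<tau> x) (at \<tau>)"
    and x: "(?p \<tau> has_real_derivative - (1 / \<rho>) * ?p \<tau> x) (at x)" for \<tau> x
    unfolding wave_def by (rule DERIV_exp_comp[OF g(1)], rule DERIV_exp_comp[OF g(2)])
  have xx: "((\<lambda>x. - (1 / \<rho>) * ?p \<tau> x) has_real_derivative (1 / \<rho> ^ 2) * ?p \<tau> x) (at x)" for \<tau> x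
    using DERIV_cmult[OF x[of \<tau> x], of "- (1 / \<rho>)"] by (simp add: power2_eq_square)
  have c: "continuous_on UNIV (\<lambda>z. ?p (fst z) (snd z))"
    unfolding wave_def divide_inverse
    by (intro continuous_on_mult continuous_on_exp continuous_on_diff continuous_on_const continuous_on_fst continuous_on_snd continuous_on_id)
  show ?thesis unfolding test_fun_def
    by (rule exI[of _ "\<lambda>\<tau> x. - (1 / \<rho> ^ 2) * ?p \<tau> x"], rule exI[of _ "\<lambda>\<tau> x. (1 / \<rho> ^ 2) * ?p \<tau> x"],
        intro conjI allI t x xx c continuous_on_mult continuous_on_const)
      (simp add: algebra_simps)
qed

lemma wave_decaying:
  assumes "\<rho> > 0"
  shows "decaying s t (wave \<rho> t0 y0) (\<lambda>\<tau> x. - (1 / \<rho>) * wave \<rho> t0 y0 \<tau> x) (\<lambda>\<tau> x. - (1 / (2 * \<rho> ^ 2)) * wave \<rho> t0 y0 \<tau> x)"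
proof -
  define B where "B = 2 * exp (1 + y0 / \<rho> - (s - t0) / \<rho> ^ 2)"
  define A where "A = 1 + 1 / \<rho> + 1 / (2 * \<rho> ^ 2)"
  have A: "1 \<le> A" "1 / \<rho> \<le> A" "1 / (2 * \<rho> ^ 2) \<le> A" using assms by (auto simp: A_def)
  have b: "\<bar>wave \<rho> t0 y0 \<tau> x\<bar> \<le> B * exp (- (1 / \<rho>) * x)" if "\<tau> \<in> {s..t}" for \<tau> x
  proof -
    have "exp (1 - (x - y0) / \<rho> - (\<tau> - t0) / \<rho> ^ 2) \<le> exp (1 - (x - y0) / \<rho> - (s - t0) / \<rho> ^ 2)"
      using that assms by (auto intro!: divide_right_mono)
    also have "\<dots> = exp (1 + y0 / \<rho> - (s - t0) / \<rho> ^ 2) * exp (- (1 / \<rho>) * x)"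
      by (subst exp_add[symmetric]) (simp add: diff_divide_distrib)
    finally show ?thesis by (simp add: wave_def B_def)
  qed
  have c: "\<bar>a * wave \<rho> t0 y0 \<tau> x\<bar> \<le> A * B * exp (- (1 / \<rho>) * x)" if "\<tau> \<in> {s..t}" "\<bar>a\<bar> \<le> A" for a \<tau> x
    using mult_mono[OF that(2) b[OF that(1), of x]] A(1) by (simp add: abs_mult mult.assoc)
  show ?thesis unfolding decaying_def
  proof (rule exI[of _ "A * B"], rule exI[of _ "1 / \<rho>"], intro conjI ballI allI impI)
    fix \<tau> x :: real assume t: "\<tau> \<in> {s..t}"
    show "\<bar>wave \<rho> t0 y0 \<tau> x\<bar> \<le> A * B * exp (- (1 / \<rho>) * x)" using c[OF t, of 1 x] A by simp
    show "\<bar>- (1 / \<rho>) * wave \<rho> t0 y0 \<tau> x\<bar> \<le> A * B * exp (- (1 / \<rho>) * x)" using A assms by (intro c t) simp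
    show "\<bar>- (1 / (2 * \<rho> ^ 2)) * wave \<rho> t0 y0 \<tau> x\<bar> \<le> A * B * exp (- (1 / \<rho>) * x)" using A assms by (intro c t) simp
  qed (use assms in simp)
qed

lemma wave_antimono: "\<rho> > 0 \<Longrightarrow> x \<le> y \<Longrightarrow> wave \<rho> t0 y0 \<tau> y \<le> wave \<rho> t0 y0 \<tau> x"
  by (simp add: wave_def divide_right_mono)

lemma wave_pos: "wave \<rho> t0 y0 \<tau> x > 0"
  by (simp add: wave_def)

section \<open>Continuity in time and comparison with waves\<close>

context contact_problem
begin

lemma slice_continuous:
  assumes s: "0 < s" and p: "test_fun p px q" and d: "decaying s t p px q"
  shows "continuous_on {s..t} (\<lambda>\<tau>. LINT x|lborel. W \<tau> x * p \<tau> x)"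
proof (unfold continuous_on_sequentially, intro allI ballI impI, elim conjE)
  fix u \<tau> assume \<tau>: "\<tau> \<in> {s..t}" and u: "\<forall>n. u n \<in> {s..t}" "u \<longlonglongrightarrow> \<tau>"
  obtain m M where mM: "\<And>\<tau>. \<tau> \<in> {s..t} \<Longrightarrow> m \<le> L \<tau> \<and> L \<tau> \<le> M" using L_range[OF s] by blast
  obtain K l where K: "K \<ge> 0" "l > 0" "\<And>\<tau> x. \<tau> \<in> {s..t} \<Longrightarrow> x \<ge> m \<Longrightarrow> \<bar>p \<tau> x\<bar> \<le> K * exp (- l * x)"
    by (rule decayingE[OF p d, of m]) blast
  have m: "(\<lambda>x. W \<sigma> x * p \<sigma> x) \<in> borel_measurable lborel" if "\<sigma> \<in> {s..t}" for \<sigma>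
    using slice_integrable[OF s that p d] by auto
  have "(\<lambda>n. LINT x|lborel. W (u n) x * p (u n) x) \<longlonglongrightarrow> (LINT x|lborel. W \<tau> x * p \<tau> x)"
  proof (rule integral_dominated_convergence)
    show "(\<lambda>x. W \<tau> x * p \<tau> x) \<in> borel_measurable lborel" "(\<lambda>x. W (u n) x * p (u n) x) \<in> borel_measurable lborel" for n
      using m \<tau> u by auto
    show "integrable lborel (\<lambda>x. K * (indicator {m..} x * exp (- l * x)))"
      by (intro integrable_mult_right exp_halfline K)
    show "AE x in lborel. (\<lambda>n. W (u n) x * p (u n) x) \<longlonglongrightarrow> W \<tau> x * p \<tau> x"
    proof (intro AE_I2 tendsto_mult)
      fix x :: real
      have "continuous_on {s..t} (\<lambda>\<tau>. (\<tau>, x))"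
        by (intro continuous_on_Pair continuous_on_id continuous_on_const)
      then have cW: "continuous_on {s..t} (\<lambda>\<tau>. W \<tau> x)"
        using continuous_on_compose2[OF cont_W, of "{s..t}" "\<lambda>\<tau>. (\<tau>, x)"] s by (simp add: image_subset_iff)
      then show "(\<lambda>n. W (u n) x) \<longlonglongrightarrow> W \<tau> x"
        using u \<tau> unfolding continuous_on_sequentially by (auto simp: o_def)
      have "isCont (\<lambda>\<tau>. p \<tau> x) \<tau>"
        using p by (auto elim!: test_funE intro: DERIV_isCont)
      then show "(\<lambda>n. p (u n) x) \<longlonglongrightarrow> p \<tau> x" using u(2) by (rule isCont_tendsto_compose)
    qed
    fix n
    show "AE x in lborel. norm (W (u n) x * p (u n) x) \<le> K * (indicator {m..} x * exp (- l * x))"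
    proof (intro AE_I2)
      fix x
      have un: "u n \<in> {s..t}" "u n > 0" using u(1) s by (auto intro: less_le_trans)
      show "norm (W (u n) x * p (u n) x) \<le> K * (indicator {m..} x * exp (- l * x))"
      proof (cases "x \<ge> m")
        case True
        have "\<bar>W (u n) x\<bar> * \<bar>p (u n) x\<bar> \<le> 1 * (K * exp (- l * x))"
          using W_bounds[OF un(2), of x] K(3)[OF un(1) True] by (intro mult_mono) auto
        then show ?thesis using True by (simp add: abs_mult)
      next
        case False
        then have "W (u n) x = 0" using mM[OF un(1)] un by (intro W_left) auto
        then show ?thesis using False by simp
      qed
    qed
  qed
  then show "((\<lambda>\<tau>. LINT x|lborel. W \<tau> x * p \<tau> x) \<circ> u) \<longlonglongrightarrow> (LINT x|lborel. W \<tau> x * p \<tau> x)"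
    by (simp add: o_def)
qed

text \<open>Needed to turn the defect into a measure on the time axis without atoms. The integral
  part is Lipschitz by the linear bound on strips.\<close>

lemma defect_continuous:
  assumes s: "0 < s" "s \<le> t" and p: "test_fun p px q" and d: "decaying s t p px q"
  shows "continuous_on {s..t} (\<lambda>\<tau>. defect p q s \<tau>)"
proof -
  let ?I = "\<lambda>\<tau>. LINT z:({s..\<tau>} \<times> UNIV)|lborel. integrand p q z"
  obtain C where C: "\<And>u v. s \<le> u \<Longrightarrow> u \<le> v \<Longrightarrow> v \<le> t \<Longrightarrow> \<bar>LINT z:(strip u v)|lborel. integrand p q z\<bar> \<le> C * (v - u)"
    using integrand_integrable(2)[OF s p d] by blast
  have C0: "C * (v - u) \<le> \<bar>C\<bar> * \<bar>v - u\<bar>" for u v by (metis abs_ge_self abs_mult)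
  have *: "\<bar>?I v - ?I u\<bar> \<le> \<bar>C\<bar> * \<bar>v - u\<bar>" if "s \<le> u" "u \<le> v" "v \<le> t" for u v
  proof -
    have "defect p q s v = defect p q s u + defect p q u v"
      by (rule defect_split[OF s(1) that(1,2) p decaying_subinterval[OF d]]) (use that in auto)
    then have "?I v = ?I u + (LINT z:(strip u v)|lborel. integrand p q z)"
      by (simp add: defect_def)
    then show ?thesis using C[OF that] C0[of v u] by linarith
  qed
  have "\<bar>C\<bar>-lipschitz_on {s..t} ?I"
  proof (rule lipschitz_onI)
    fix u v assume "u \<in> {s..t}" "v \<in> {s..t}"
    then show "dist (?I u) (?I v) \<le> \<bar>C\<bar> * dist u v"
      using *[of u v] *[of v u] by (cases "u \<le> v") (auto simp: dist_real_def abs_minus_commute)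
  qed simp
  then have "continuous_on {s..t} ?I" by (rule lipschitz_on_continuous_on)
  then show ?thesis unfolding defect_def
    by (intro continuous_intros slice_continuous[OF s(1) p d])
qed

text \<open>Since \<open>q \<le> 0 \<le> p\<close> and \<open>W \<le> 1\<close>, the integral over
  the strip is at most 0 and the terminal term may be dropped; the initial mass remains. It is small
  because the wave has width \<open>\<rho>\<close> and \<open>W\<close> is of order
  \<open>\<epsilon> * \<rho> + n * \<rho> ^ 2\<close> at this distance from the boundary.\<close>

lemma wave_defect:
  assumes t: "0 < t0" "t0 \<le> v" and \<rho>: "\<rho> > 0" and n: "\<epsilon> \<ge> 0" "n \<ge> 0"
    and W: "\<And>h. h \<ge> 0 \<Longrightarrow> W t0 (L t0 + h) \<le> \<epsilon> * h + n * h ^ 2"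
  shows "defect (wave \<rho> t0 (L t0)) (\<lambda>\<tau> x. - (1 / (2 * \<rho> ^ 2)) * wave \<rho> t0 (L t0) \<tau> x) t0 v
    \<le> 2 * exp 1 * (4 * \<epsilon> * \<rho> ^ 2 + 16 * n * \<rho> ^ 3)"
proof -
  let ?p = "wave \<rho> t0 (L t0)"
  let ?q = "\<lambda>\<tau> x. - (1 / (2 * \<rho> ^ 2)) * ?p \<tau> x"
  note tf = wave_test[OF \<rho>] and de = wave_decaying[OF \<rho>]
  have "(LINT z:({t0..v} \<times> UNIV)|lborel. integrand ?p ?q z) \<le> 0"
  proof -
    have "indicator ({t0..v} \<times> UNIV) z *\<^sub>R integrand ?p ?q z \<le> 0" for z
    proof (cases "z \<in> {t0..v} \<times> UNIV")
      case True
      then have f: "fst z > 0" using t by auto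
      have "W (fst z) (snd z) * ?q (fst z) (snd z) \<le> 0" "(W (fst z) (snd z) - 1) * ?p (fst z) (snd z) \<le> 0"
        using W_bounds[OF f, of "snd z"] wave_pos[of \<rho> t0 "L t0" "fst z" "snd z"] \<rho>
        by (auto simp: mult_le_0_iff zero_le_mult_iff zero_le_divide_iff)
      then show ?thesis using True by (simp add: integrand_def)
    qed simp
    then have "0 \<le> (LINT z|lborel. - (indicator ({t0..v} \<times> UNIV) z *\<^sub>R integrand ?p ?q z))"
      by (intro integral_nonneg_AE AE_I2) simp
    then show ?thesis by (simp add: set_lebesgue_integral_def)
  qed
  moreover have "0 \<le> (LINT x|lborel. W v x * ?p v x)"
    using t by (intro integral_nonneg_AE AE_I2 mult_nonneg_nonneg W_bounds(1) less_imp_le[OF wave_pos]) auto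
  moreover have "(LINT x|lborel. W t0 x * ?p t0 x) \<le> 2 * exp 1 * (4 * \<epsilon> * \<rho> ^ 2 + 16 * n * \<rho> ^ 3)"
  proof -
    let ?l = "1 / (2 * \<rho>)"
    define A where "A = 2 * exp 1 * (2 * \<epsilon> * \<rho> + 8 * n * \<rho> ^ 2) * exp (?l * L t0)"
    have l: "?l > 0" using \<rho> by simp
    have "W t0 x * ?p t0 x \<le> A * (indicator {L t0..} x * exp (- ?l * x))" for x
    proof (cases "x \<ge> L t0")
      case True
      define h where "h = x - L t0"
      \<comment> \<open>In this variable the wave decays like \<open>exp (- (2 * u))\<close>. One
        factor \<open>exp u\<close> absorbs both \<open>u\<close> and \<open>u ^ 2 / 2\<close>; what
        is left decays at rate \<open>1 / (2 * \<rho>)\<close>, and its integral supplies the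
        further factor \<open>2 * \<rho>\<close>.\<close>
      define u where "u = h / (2 * \<rho>)"
      have h: "h \<ge> 0" "x = L t0 + h" "h = 2 * \<rho> * u" "u \<ge> 0" using True \<rho> by (auto simp: h_def u_def)
      have e: "u \<le> exp u" "u ^ 2 / 2 \<le> exp u"
        using exp_lower_Taylor_quadratic[OF h(4)] h(4) zero_le_power2[of u] by linarith+
      have "\<epsilon> * h + n * h ^ 2 = 2 * \<epsilon> * \<rho> * u + 8 * n * \<rho> ^ 2 * (u ^ 2 / 2)"
        by (simp add: h(3) power2_eq_square)
      also have "\<dots> \<le> 2 * \<epsilon> * \<rho> * exp u + 8 * n * \<rho> ^ 2 * exp u"
        using n \<rho> by (intro add_mono mult_left_mono e) auto
      finally have w: "W t0 x \<le> (2 * \<epsilon> * \<rho> + 8 * n * \<rho> ^ 2) * exp u"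
        using W[OF h(1)] by (simp add: h(2) distrib_right)
      have p: "?p t0 x = 2 * exp 1 * exp (- (2 * u))"
        using \<rho> by (simp add: wave_def h(2,3) exp_add[symmetric])
      have "W t0 x * ?p t0 x \<le> (2 * \<epsilon> * \<rho> + 8 * n * \<rho> ^ 2) * exp u * (2 * exp 1 * exp (- (2 * u)))"
        unfolding p using w by (intro mult_right_mono) auto
      also have "\<dots> = 2 * exp 1 * (2 * \<epsilon> * \<rho> + 8 * n * \<rho> ^ 2) * (exp u * exp (- (2 * u)))"
        by (simp add: mult_ac)
      also have "exp u * exp (- (2 * u)) = exp (?l * L t0) * exp (- ?l * x)"
        unfolding exp_add[symmetric] using \<rho> by (simp add: u_def h_def diff_divide_distrib)
      finally show ?thesis using True by (simp add: A_def mult_ac)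
    next
      case False
      then show ?thesis using W_left[OF t(1), of x] by simp
    qed
    then have "(LINT x|lborel. W t0 x * ?p t0 x) \<le> (LINT x|lborel. A * (indicator {L t0..} x * exp (- ?l * x)))"
      using t by (intro integral_mono slice_integrable[OF t(1) _ tf de[of t0 v]] integrable_mult_right exp_halfline l) auto
    also have "\<dots> = A * (exp (- ?l * L t0) / ?l)"
      using exp_halfline(2)[OF l, of "L t0"] by simp
    also have "\<dots> = 2 * exp 1 * (2 * \<epsilon> * \<rho> + 8 * n * \<rho> ^ 2) * (exp (?l * L t0) * exp (- ?l * L t0)) * (2 * \<rho>)"
      by (simp add: A_def mult_ac)
    also have "exp (?l * L t0) * exp (- ?l * L t0) = 1" unfolding exp_add[symmetric] by simp
    finally show ?thesis by (simp add: power2_eq_square power3_eq_cube algebra_simps)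
  qed
  ultimately show ?thesis by (simp add: defect_def)
qed

text \<open>By continuity a wave that is at least 2 at the boundary point stays above 1 around it.
  It thus dominates a short step ending close to the boundary, and that step has the same defect as
  the fixed one at \<open>M + 1\<close> as long as the graph remains to the left.\<close>

lemma defect_compare:
  assumes s: "0 < t0" "t0 \<le> s" and \<rho>: "\<rho> > 0" and P: "wave \<rho> t0 y0 s (L s) \<ge> 2" and M: "L s \<le> M"
  shows "\<exists>d>0. \<forall>u v. t0 \<le> u \<longrightarrow> u \<le> s \<longrightarrow> s \<le> v \<longrightarrow> v - u < d \<longrightarrow>
     defect (step (M + 1) 1) (step_q (M + 1) 1) u v \<le>
     defect (wave \<rho> t0 y0) (\<lambda>\<tau> x. - (1 / (2 * \<rho> ^ 2)) * wave \<rho> t0 y0 \<tau> x) u v"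
proof -
  let ?p = "wave \<rho> t0 y0"
  let ?q = "\<lambda>\<tau> x. - (1 / (2 * \<rho> ^ 2)) * ?p \<tau> x"
  have "isCont (\<lambda>z. ?p (fst z) (snd z)) (s, L s)"
    using test_fun_cont(1)[OF wave_test[OF \<rho>], of UNIV] by (simp add: continuous_on_eq_continuous_at)
  then have "\<exists>d>0. \<forall>z. dist z (s, L s) < d \<longrightarrow> dist (?p (fst z) (snd z)) (?p s (L s)) < 1"
    unfolding continuous_at_eps_delta fst_conv snd_conv by (rule allE[of _ 1]) simp
  then obtain e where e0: "e > 0" "\<forall>z. dist z (s, L s) < e \<longrightarrow> dist (?p (fst z) (snd z)) (?p s (L s)) < 1"
    by blast
  have e: "e > 0" "\<And>\<tau> x. dist (\<tau>, x) (s, L s) < e \<Longrightarrow> \<bar>?p \<tau> x - ?p s (L s)\<bar> < 1"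
  proof -
    fix \<tau> x assume "dist (\<tau>, x) (s, L s) < e"
    from e0(2)[rule_format, OF this] show "\<bar>?p \<tau> x - ?p s (L s)\<bar> < 1" by (simp add: dist_real_def)
  qed (rule e0)
  \<comment> \<open>Half of \<open>e\<close> is left for the displacement in time. The bound by 1
    keeps \<open>c\<close> below \<open>M + 1\<close>, so that both steps equal 1 left of
    \<open>c\<close>.\<close>
  define \<delta> where "\<delta> = min (e / 2) 1"
  have \<delta>: "\<delta> > 0" "\<delta> \<le> 1" "\<delta> \<le> e / 2" using e by (auto simp: \<delta>_def)
  define c where "c = L s + \<delta> / 2"
  have w: "\<delta> / 2 > 0" using \<delta> by simp
  have "isCont L s"
    using cont_L s by (simp add: continuous_on_eq_continuous_at)
  then obtain d' where d': "d' > 0" "\<And>\<tau>. dist \<tau> s < d' \<Longrightarrow> dist (L \<tau>) (L s) < \<delta> / 2"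
    using w unfolding continuous_at_eps_delta by blast
  define d where "d = min d' \<delta>"
  have d: "d > 0" "d \<le> d'" "d \<le> \<delta>" using d' \<delta> by (auto simp: d_def)
  have main: "defect (step (M + 1) 1) (step_q (M + 1) 1) u v \<le> defect ?p ?q u v"
    if uv: "t0 \<le> u" "u \<le> s" "s \<le> v" "v - u < d" for u v
  proof -
    have u: "0 < u" "u \<le> v" using uv s by auto
    have near: "\<bar>\<tau> - s\<bar> < d" if "\<tau> \<in> {u..v}" for \<tau> using that uv by auto
    have Lc: "L \<tau> < c" if "\<tau> \<in> {u..v}" for \<tau>
    proof -
      have "dist (L \<tau>) (L s) < \<delta> / 2" using near[OF that] d by (intro d') (simp add: dist_real_def)
      then have "\<bar>L \<tau> - L s\<bar> < \<delta> / 2" by (simp add: dist_real_def)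
      then show ?thesis unfolding c_def by linarith
    qed
    \<comment> \<open>Continuity is used only at the right end \<open>L s + \<delta>\<close>;
      monotonicity of the wave covers the whole half-line to the left.\<close>
    have p1: "1 \<le> ?p \<tau> x" if "\<tau> \<in> {u..v}" "x \<le> L s + \<delta>" for \<tau> x
    proof -
      have "dist (\<tau>, L s + \<delta>) (s, L s) \<le> \<bar>\<tau> - s\<bar> + \<bar>\<delta>\<bar>"
        unfolding dist_Pair_Pair dist_real_def by (rule order_trans[OF sqrt_sum_squares_le_sum_abs]) simp
      also have "\<dots> < e" using near[OF that(1)] d \<delta> by auto
      finally have "1 \<le> ?p \<tau> (L s + \<delta>)" using e(2)[of \<tau> "L s + \<delta>"] P by linarith
      also have "\<dots> \<le> ?p \<tau> x" by (rule wave_antimono[OF \<rho> that(2)])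
      finally show ?thesis .
    qed
    note tw = wave_test[OF \<rho>] wave_decaying[OF \<rho>]
    note ts = step_test[OF w] step_decaying[OF w]
    note t1 = step_test[OF zero_less_one] step_decaying[OF zero_less_one]
    have "0 \<le> defect (\<lambda>t x. ?p t x + -1 * step c (\<delta> / 2) t x) (\<lambda>t x. ?q t x + -1 * step_q c (\<delta> / 2) t x) u v"
    proof (rule defect_nonneg[OF u test_fun_add[OF tw(1) test_fun_scale[OF ts(1)]] decaying_add[OF tw(2) decaying_scale[OF ts(2)]]])
      fix \<tau> x assume \<tau>: "\<tau> \<in> {u..v}"
      show "0 \<le> ?p \<tau> x + -1 * step c (\<delta> / 2) \<tau> x"
      proof (cases "x \<le> L s + \<delta>")
        case True
        then show ?thesis using p1[OF \<tau> True] step_bounds(2)[of c "\<delta> / 2" \<tau> x] by linarith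
      next
        case False
        then have "step c (\<delta> / 2) \<tau> x = 0" by (intro step_right[OF w]) (simp add: c_def)
        then show ?thesis using wave_pos[of \<rho> t0 y0 \<tau> x] by linarith
      qed
    qed
    also have "\<dots> = defect ?p ?q u v + -1 * defect (step c (\<delta> / 2)) (step_q c (\<delta> / 2)) u v"
      by (subst defect_add[OF u tw test_fun_scale[OF ts(1)] decaying_scale[OF ts(2)]], subst defect_scale, rule refl)
    finally have 1: "defect (step c (\<delta> / 2)) (step_q c (\<delta> / 2)) u v \<le> defect ?p ?q u v" by simp
    have "0 = defect (\<lambda>t x. step (M + 1) 1 t x + -1 * step c (\<delta> / 2) t x) (\<lambda>t x. step_q (M + 1) 1 t x + -1 * step_q c (\<delta> / 2) t x) u v"
    proof (rule sym, rule defect_local[OF u test_fun_add[OF t1(1) test_fun_scale[OF ts(1)]] decaying_add[OF t1(2) decaying_scale[OF ts(2)]]])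
      fix \<tau> x assume "x < c"
      then show "step (M + 1) 1 \<tau> x + -1 * step c (\<delta> / 2) \<tau> x = 0"
        using step_left[OF w, of x c \<tau>] step_left[OF zero_less_one, of x "M + 1" \<tau>] M \<delta> by (simp add: c_def)
    qed (rule Lc)
    also have "\<dots> = defect (step (M + 1) 1) (step_q (M + 1) 1) u v + -1 * defect (step c (\<delta> / 2)) (step_q c (\<delta> / 2)) u v"
      by (subst defect_add[OF u t1 test_fun_scale[OF ts(1)] decaying_scale[OF ts(2)]], subst defect_scale, rule refl)
    finally show ?thesis using 1 by simp
  qed
  then show ?thesis using d(1) by blast
qed

section \<open>The lost mass as a measure in time\<close>

context
  fixes a b M :: real
  assumes ab: "0 < a" "a \<le> b" and LM: "\<And>\<tau>. \<tau> \<in> {a..b} \<Longrightarrow> L \<tau> \<le> M"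
begin

text \<open>The mass lost at the free boundary between two times, as a measure on the time axis.\<close>

definition loss :: "real measure" where
  "loss = interval_measure (\<lambda>t. defect (step (M + 1) 1) (step_q (M + 1) 1) a (max a (min b t)))"

lemma step_nonneg:
  assumes "a \<le> u" "u \<le> v"
  shows "defect (step (M + 1) 1) (step_q (M + 1) 1) u v \<ge> 0"
  by (rule defect_nonneg[OF _ _ step_test step_decaying]) (use assms ab step_bounds in auto)

text \<open>Clamping the time to \<open>{a..b}\<close> makes the distribution function monotone and
  continuous on the whole line; continuity excludes an atom at \<open>u\<close>, so the closed
  interval has the mass of the increment.\<close>

lemma loss_Icc:
  assumes uv: "a \<le> u" "u \<le> v" "v \<le> b"
  shows "emeasure loss {u..v} = ennreal (defect (step (M + 1) 1) (step_q (M + 1) 1) u v)"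
proof -
  let ?N = "defect (step (M + 1) 1) (step_q (M + 1) 1)"
  let ?F = "\<lambda>t. ?N a (max a (min b t))"
  have split: "?N a y = ?N a x + ?N x y" if "a \<le> x" "x \<le> y" for x y
    by (rule defect_split[OF ab(1) that step_test step_decaying]) auto
  have mono: "?F x \<le> ?F y" if "x \<le> y" for x y
    using split[of "max a (min b x)" "max a (min b y)"] step_nonneg[of "max a (min b x)" "max a (min b y)"] that
    by auto
  have "continuous_on UNIV (\<lambda>t. max a (min b t))" by (intro continuous_intros)
  then have "continuous_on UNIV ?F"
    by (rule continuous_on_compose2[OF defect_continuous[OF ab step_test[OF zero_less_one] step_decaying[OF zero_less_one]]])
      (use ab in auto)
  from emeasure_interval_measure_Icc[of u v ?F, OF uv(2) mono this]
  have "emeasure loss {u..v} = ennreal (?F v - ?F u)" unfolding loss_def by simp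
  also have "?F v - ?F u = ?N u v" using split[of u v] uv by simp
  finally show ?thesis .
qed

lemma sets_loss [simp]: "sets loss = sets borel"
  by (simp add: loss_def)

text \<open>Local to global by bisection: \<open>?P\<close> passes from two adjacent intervals to
  their union, by subadditivity on the left and \<open>defect_split\<close> on the right. On short
  intervals it holds by \<open>defect_compare\<close> around points of \<open>K\<close>, and
  trivially around other points because \<open>K\<close> is closed.\<close>

lemma loss_wave:
  assumes t0: "a \<le> t0" "t0 \<le> b" and \<rho>: "\<rho> > 0" and K: "closed K"
    and P: "\<And>s. s \<in> K \<Longrightarrow> wave \<rho> t0 y0 s (L s) \<ge> 2"
  shows "emeasure loss (K \<inter> {t0..b}) \<le> ennreal (defect (wave \<rho> t0 y0) (\<lambda>\<tau> x. - (1 / (2 * \<rho> ^ 2)) * wave \<rho> t0 y0 \<tau> x) t0 b)"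
proof -
  let ?N = "defect (wave \<rho> t0 y0) (\<lambda>\<tau> x. - (1 / (2 * \<rho> ^ 2)) * wave \<rho> t0 y0 \<tau> x)"
  let ?P = "\<lambda>u v. t0 \<le> u \<longrightarrow> u \<le> v \<longrightarrow> v \<le> b \<longrightarrow> emeasure loss (K \<inter> {u..v}) \<le> ennreal (?N u v)"
  note tw = wave_test[OF \<rho>] wave_decaying[OF \<rho>]
  have nn: "?N u v \<ge> 0" if "t0 \<le> u" "u \<le> v" for u v
    by (rule defect_nonneg[OF _ _ tw]) (use that t0 ab wave_pos[THEN less_imp_le] in auto)
  have Km: "K \<inter> {u..v} \<in> sets loss" for u v
    using K by (simp add: borel_closed closed_Int)
  have "?P t0 b"
  proof (rule Bolzano[OF t0(2), of ?P])
    fix u v w assume IH: "?P u v" "?P v w" "u \<le> v" "v \<le> w"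
    show "?P u w"
    proof (intro impI)
      assume uw: "t0 \<le> u" "u \<le> w" "w \<le> b"
      have "emeasure loss (K \<inter> {u..w}) \<le> emeasure loss ((K \<inter> {u..v}) \<union> (K \<inter> {v..w}))"
        using Km by (intro emeasure_mono sets.Un) auto
      also have "\<dots> \<le> emeasure loss (K \<inter> {u..v}) + emeasure loss (K \<inter> {v..w})"
        by (intro emeasure_subadditive Km)
      also have "\<dots> \<le> ennreal (?N u v) + ennreal (?N v w)"
        using IH uw by (intro add_mono) auto
      also have "\<dots> = ennreal (?N u v + ?N v w)"
        using nn[of u v] nn[of v w] IH uw by simp
      also have "?N u v + ?N v w = ?N u w"
        by (rule defect_split[symmetric, OF _ IH(3,4) tw]) (use uw t0 ab in auto)
      finally show "emeasure loss (K \<inter> {u..w}) \<le> ennreal (?N u w)" .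
    qed
  next
    fix s assume s: "t0 \<le> s" "s \<le> b"
    show "\<exists>d>0. \<forall>u v. u \<le> s \<and> s \<le> v \<and> v - u < d \<longrightarrow> ?P u v"
    proof (cases "s \<in> K")
      case True
      have "0 < t0" "L s \<le> M" using LM[of s] s t0 ab by auto
      from defect_compare[OF this(1) s(1) \<rho> P[OF True] this(2)]
      obtain d where d: "d > 0" "\<And>u v. t0 \<le> u \<Longrightarrow> u \<le> s \<Longrightarrow> s \<le> v \<Longrightarrow> v - u < d \<Longrightarrow>
        defect (step (M + 1) 1) (step_q (M + 1) 1) u v \<le> ?N u v" by blast
      have "?P u v" if uv: "u \<le> s" "s \<le> v" "v - u < d" for u v
      proof (intro impI)
        assume *: "t0 \<le> u" "u \<le> v" "v \<le> b"
        have "emeasure loss (K \<inter> {u..v}) \<le> emeasure loss {u..v}"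
          by (intro emeasure_mono) auto
        also have "\<dots> = ennreal (defect (step (M + 1) 1) (step_q (M + 1) 1) u v)"
          using * t0 by (intro loss_Icc) auto
        also have "\<dots> \<le> ennreal (?N u v)" using d(2)[OF *(1) uv] by (rule ennreal_leI)
        finally show "emeasure loss (K \<inter> {u..v}) \<le> ennreal (?N u v)" .
      qed
      then show ?thesis using d(1) by blast
    next
      case False
      have "open (- K)" using K by auto
      then obtain d where d: "d > 0" "ball s d \<subseteq> - K" using False by (meson ComplI open_contains_ball)
      have "K \<inter> {u..v} = {}" if uv: "u \<le> s" "s \<le> v" "v - u < d" for u v
      proof -
        have "{u..v} \<subseteq> ball s d" using uv by (auto simp: dist_real_def)
        then show ?thesis using d(2) by auto
      qed
      then show ?thesis using d(1) by (intro exI[of _ d]) simp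
    qed
  qed
  then show ?thesis using t0 by simp
qed

text \<open>The quadratic term takes care of \<open>h\<close> away from 0, where only
  \<open>W \<le> 1\<close> is known. Asking the inequality for all \<open>h\<close> with one
  \<open>n\<close> gives an intersection of closed conditions.\<close>

definition flat_set :: "real \<Rightarrow> nat \<Rightarrow> real set" where
  "flat_set \<epsilon> n = {t \<in> {a..b}. \<forall>h\<ge>0. W t (L t + h) \<le> \<epsilon> * h + real n * h ^ 2}"

lemma closed_flat_set: "closed (flat_set \<epsilon> n)"
proof -
  have "closed {t \<in> {a..b}. W t (L t + h) \<le> \<epsilon> * h + real n * h ^ 2}" for h
  proof (rule continuous_on_closed_Collect_le)
    have "continuous_on {a..b} (\<lambda>t. (t, L t + h))"
      by (intro continuous_on_Pair continuous_on_id continuous_on_add continuous_on_const continuous_on_subset[OF cont_L])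
        (use ab in auto)
    from continuous_on_compose2[OF cont_W this] show "continuous_on {a..b} (\<lambda>t. W t (L t + h))"
      using ab by (simp add: image_subset_iff)
  qed auto
  then have "closed ({a..b} \<inter> (\<Inter>h\<in>{0..}. {t \<in> {a..b}. W t (L t + h) \<le> \<epsilon> * h + real n * h ^ 2}))"
    by (intro closed_Int closed_INT) auto
  moreover have "flat_set \<epsilon> n = {a..b} \<inter> (\<Inter>h\<in>{0..}. {t \<in> {a..b}. W t (L t + h) \<le> \<epsilon> * h + real n * h ^ 2})"
    by (auto simp: flat_set_def)
  ultimately show ?thesis by simp
qed

text \<open>Cover the graph of \<open>L\<close> over \<open>flat_set \<epsilon> n\<close> by the strips \<open>j \<rho> \<le> x + t / \<rho> \<le> (j + 1) \<rho>\<close>;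
  the wave started at the first time the graph visits a strip controls the loss in that strip.\<close>

lemma loss_flat_set_scale:
  assumes \<epsilon>: "\<epsilon> > 0" and \<rho>: "\<rho> > 0" and m: "\<And>\<tau>. \<tau> \<in> {a..b} \<Longrightarrow> m \<le> L \<tau>"
  shows "emeasure loss (flat_set \<epsilon> n) \<le>
    ennreal (2 * exp 1 * (4 * \<epsilon> + 16 * real n * \<rho>) * ((M - m) * \<rho> + (b - a) + \<rho> ^ 2))"
proof -
  \<comment> \<open>Divided by \<open>\<rho>\<close>, the increments of \<open>f\<close> are those
    of the negated exponent of the wave along the graph; strips in space-time thus become level
    intervals of \<open>f\<close>, with lower ends \<open>c j\<close>.\<close>
  define f where "f s = L s + s / \<rho>" for s
  define c where "c j = m + a / \<rho> + real j * \<rho>" for j :: nat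
  define Z where "Z = flat_set \<epsilon> n"
  define K where "K j = {s \<in> Z. c j \<le> f s \<and> f s \<le> c j + \<rho>}" for j
  define B where "B = 2 * exp 1 * (4 * \<epsilon> * \<rho> ^ 2 + 16 * real n * \<rho> ^ 3)"
  \<comment> \<open>\<open>J\<close> is the last index, so there are \<open>J + 1\<close> strips;
    the extra one is the origin of the summand \<open>\<rho> ^ 2\<close> in the final bound.\<close>
  define J where "J = nat \<lfloor>((M - m) + (b - a) / \<rho>) / \<rho>\<rfloor>"
  have B0: "B \<ge> 0" using \<epsilon> \<rho> by (simp add: B_def)
  have Zab: "Z \<subseteq> {a..b}" by (auto simp: Z_def flat_set_def)
  have Zc: "closed Z" by (simp add: Z_def closed_flat_set)
  have cf: "continuous_on Z f" unfolding f_def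
    by (intro continuous_intros continuous_on_subset[OF cont_L]) (use Zab ab \<rho> in auto)
  have Kc: "closed (K j)" for j
  proof -
    have "closed {s \<in> Z. c j \<le> f s}" "closed {s \<in> Z. f s \<le> c j + \<rho>}"
      by (intro continuous_on_closed_Collect_le cf Zc continuous_on_const)+
    moreover have "K j = {s \<in> Z. c j \<le> f s} \<inter> {s \<in> Z. f s \<le> c j + \<rho>}" by (auto simp: K_def)
    ultimately show ?thesis by (simp add: closed_Int)
  qed
  have KB: "emeasure loss (K j) \<le> ennreal B" for j
  proof (cases "K j = {}")
    case False
    have "compact (K j)"
    proof -
      have "K j \<subseteq> {a..b}" using Zab by (auto simp: K_def)
      then show ?thesis
        using Kc compact_Icc[of a b] by (metis compact_Int_closed inf.absorb2 inf.commute)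
    qed
    from compact_attains_inf[OF this False]
    obtain t0 where t0: "t0 \<in> K j" "\<And>s. s \<in> K j \<Longrightarrow> t0 \<le> s" by blast
    have t0': "a \<le> t0" "t0 \<le> b" "0 < t0" using t0(1) Zab ab by (auto simp: K_def)
    \<comment> \<open>Two points of one strip differ in \<open>f\<close> by at most
      \<open>\<rho>\<close>, so the summand 1 keeps the exponent nonnegative.\<close>
    have "wave \<rho> t0 (L t0) s (L s) \<ge> 2" if "s \<in> K j" for s
    proof -
      have "f s - f t0 \<le> \<rho>" using that t0(1) by (auto simp: K_def)
      then have "(f s - f t0) / \<rho> \<le> 1" using \<rho> by simp
      moreover have "(f s - f t0) / \<rho> = (L s - L t0) / \<rho> + (s - t0) / \<rho> ^ 2"
        using \<rho> by (simp add: f_def power2_eq_square field_simps)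
      ultimately have "0 \<le> 1 - (L s - L t0) / \<rho> - (s - t0) / \<rho> ^ 2" by linarith
      then show ?thesis by (simp add: wave_def)
    qed
    from loss_wave[OF t0'(1,2) \<rho> Kc[of j] this]
    have "emeasure loss (K j \<inter> {t0..b}) \<le> ennreal (defect (wave \<rho> t0 (L t0)) (\<lambda>\<tau> x. - (1 / (2 * \<rho> ^ 2)) * wave \<rho> t0 (L t0) \<tau> x) t0 b)" .
    also have "\<dots> \<le> ennreal B" unfolding B_def
      by (intro ennreal_leI wave_defect[OF t0'(3,2) \<rho>]) (use t0(1) \<epsilon> in \<open>auto simp: K_def Z_def flat_set_def\<close>)
    also have "K j \<inter> {t0..b} = K j" using t0(2) Zab by (auto simp: K_def)
    finally show ?thesis .
  qed simp
  have cover: "Z \<subseteq> (\<Union>j\<le>J. K j)"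
  proof
    fix s assume s: "s \<in> Z"
    then have sab: "s \<in> {a..b}" using Zab by auto
    define y where "y = (f s - c 0) / \<rho>"
    have y: "0 \<le> y" "y \<le> ((M - m) + (b - a) / \<rho>) / \<rho>"
    proof -
      have "a / \<rho> \<le> s / \<rho>" "s / \<rho> \<le> b / \<rho>" using sab \<rho> by (auto intro: divide_right_mono)
      then have "0 \<le> f s - c 0" "f s - c 0 \<le> (M - m) + (b - a) / \<rho>"
        using m[OF sab] LM[OF sab] by (auto simp: f_def c_def diff_divide_distrib)
      then show "0 \<le> y" "y \<le> ((M - m) + (b - a) / \<rho>) / \<rho>"
        using \<rho> by (auto simp: y_def intro: divide_right_mono)
    qed
    define j where "j = nat \<lfloor>y\<rfloor>"
    have j: "real j \<le> y" "y \<le> real j + 1" using y(1) unfolding j_def by linarith+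
    have "j \<le> J" unfolding j_def J_def using y(2) by (intro nat_mono floor_mono)
    moreover have "f s = c 0 + y * \<rho>" using \<rho> by (simp add: y_def)
    then have "c j \<le> f s" "f s \<le> c j + \<rho>"
      using mult_right_mono[OF j(1), of \<rho>] mult_right_mono[OF j(2), of \<rho>] \<rho> by (auto simp: c_def distrib_right)
    ultimately show "s \<in> (\<Union>j\<le>J. K j)" using s by (auto simp: K_def)
  qed
  have Ks: "K j \<in> sets loss" for j using Kc by (simp add: borel_closed)
  have "emeasure loss Z \<le> emeasure loss (\<Union>j\<le>J. K j)"
    using cover Ks by (intro emeasure_mono sets.finite_UN) auto
  also have "\<dots> \<le> (\<Sum>j\<le>J. emeasure loss (K j))"
    using Ks by (intro emeasure_subadditive_finite) auto
  also have "\<dots> \<le> (\<Sum>j\<le>J. ennreal B)" by (intro sum_mono KB)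
  also have "\<dots> = ennreal (real (J + 1) * B)" using B0 by (simp add: ennreal_mult ennreal_of_nat_eq_real_of_nat)
  also have "\<dots> \<le> ennreal (2 * exp 1 * (4 * \<epsilon> + 16 * real n * \<rho>) * ((M - m) * \<rho> + (b - a) + \<rho> ^ 2))"
  proof (rule ennreal_leI)
    have mM: "m \<le> M" using m[of a] LM[of a] ab by simp
    have "0 \<le> ((M - m) + (b - a) / \<rho>) / \<rho>" using mM ab \<rho> by simp
    then have "real (J + 1) \<le> ((M - m) + (b - a) / \<rho>) / \<rho> + 1" unfolding J_def by linarith
    then have "real (J + 1) * B \<le> (((M - m) + (b - a) / \<rho>) / \<rho> + 1) * B" using B0 by (rule mult_right_mono)
    also have "\<dots> = 2 * exp 1 * (4 * \<epsilon> + 16 * real n * \<rho>) * ((((M - m) + (b - a) / \<rho>) / \<rho> + 1) * \<rho> ^ 2)"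
    proof -
      have "B = 2 * exp 1 * (4 * \<epsilon> + 16 * real n * \<rho>) * \<rho> ^ 2"
        by (simp add: B_def power2_eq_square power3_eq_cube algebra_simps)
      then show ?thesis by (simp only: mult_ac)
    qed
    also have "(((M - m) + (b - a) / \<rho>) / \<rho> + 1) * \<rho> ^ 2 = (M - m) * \<rho> + (b - a) + \<rho> ^ 2"
      using \<rho> by (simp add: power2_eq_square field_simps)
    finally show "real (J + 1) * B \<le> 2 * exp 1 * (4 * \<epsilon> + 16 * real n * \<rho>) * ((M - m) * \<rho> + (b - a) + \<rho> ^ 2)" .
  qed
  finally show ?thesis by (simp add: Z_def)
qed

text \<open>The bound does not depend on \<open>n\<close>: the quadratic part of the flatness
  condition contributes an additional factor \<open>\<rho>\<close>. This uniformity permits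
  \<open>n\<close> to tend to infinity at fixed \<open>\<epsilon>\<close>.\<close>

lemma loss_flat_set:
  assumes \<epsilon>: "\<epsilon> > 0"
  shows "emeasure loss (flat_set \<epsilon> n) \<le> ennreal (8 * exp 1 * \<epsilon> * (b - a))"
proof -
  obtain m M' where m: "\<And>\<tau>. \<tau> \<in> {a..b} \<Longrightarrow> m \<le> L \<tau> \<and> L \<tau> \<le> M'" using L_range[OF ab(1)] by blast
  define r where "r k = 1 / real (Suc k)" for k
  have r: "r \<longlonglongrightarrow> 0" "\<And>k. r k > 0"
    unfolding r_def using LIMSEQ_inverse_real_of_nat by (auto simp: inverse_eq_divide)
  have "(\<lambda>k. 2 * exp 1 * (4 * \<epsilon> + 16 * real n * r k) * ((M - m) * r k + (b - a) + r k ^ 2))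
     \<longlonglongrightarrow> 2 * exp 1 * (4 * \<epsilon> + 16 * real n * 0) * ((M - m) * 0 + (b - a) + 0 ^ 2)"
    by (intro tendsto_intros r(1))
  then have "(\<lambda>k. ennreal (2 * exp 1 * (4 * \<epsilon> + 16 * real n * r k) * ((M - m) * r k + (b - a) + r k ^ 2)))
     \<longlonglongrightarrow> ennreal (2 * exp 1 * (4 * \<epsilon> + 16 * real n * 0) * ((M - m) * 0 + (b - a) + 0 ^ 2))"
    by (rule tendsto_ennrealI)
  then have "emeasure loss (flat_set \<epsilon> n) \<le> ennreal (2 * exp 1 * (4 * \<epsilon> + 16 * real n * 0) * ((M - m) * 0 + (b - a) + 0 ^ 2))"
    by (rule LIMSEQ_le_const) (use loss_flat_set_scale[OF \<epsilon> r(2)] m in blast)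
  then show ?thesis by (simp add: mult_ac)
qed

lemma flat_set_Union:
  assumes \<epsilon>: "\<epsilon> > 0"
  shows "(\<Union>n. flat_set \<epsilon> n) = {a..b}"
proof (intro equalityI subsetI)
  fix t assume t: "t \<in> {a..b}"
  then have t0: "t > 0" using ab by auto
  have "((\<lambda>h. (W t (L t + h) - W t (L t)) / h) \<longlongrightarrow> 0) (at 0)"
    using flat[OF t0] unfolding DERIV_def .
  then have "((\<lambda>h. W t (L t + h) / h) \<longlongrightarrow> 0) (at 0)" using W_left[OF t0, of "L t"] by simp
  from LIM_D[OF this \<epsilon>] obtain d where d0: "d > 0"
    "\<forall>h. h \<noteq> 0 \<and> norm (h - 0) < d \<longrightarrow> norm (W t (L t + h) / h - 0) < \<epsilon>" by blast
  have d: "d > 0" "\<And>h. h \<noteq> 0 \<Longrightarrow> \<bar>h\<bar> < d \<Longrightarrow> \<bar>W t (L t + h) / h\<bar> < \<epsilon>"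
    using d0 by (simp_all only: diff_zero real_norm_def) blast
  \<comment> \<open>For \<open>h \<ge> d\<close> this gives
    \<open>real n * h ^ 2 \<ge> 1 \<ge> W\<close>; below \<open>d\<close> the vanishing derivative
    at the boundary gives \<open>\<epsilon> * h\<close>.\<close>
  obtain n :: nat where n: "1 / d ^ 2 \<le> real n" using real_arch_simple by blast
  have "W t (L t + h) \<le> \<epsilon> * h + real n * h ^ 2" if h: "h \<ge> 0" for h
  proof -
    consider "h = 0" | "0 < h" "h < d" | "h \<ge> d" using h by linarith
    then show ?thesis
    proof cases
      case 1
      then show ?thesis using W_left[OF t0, of "L t"] by simp
    next
      case 2
      then have "\<bar>W t (L t + h) / h\<bar> < \<epsilon>" by (intro d(2)) auto
      then have "W t (L t + h) / h < \<epsilon>" by linarith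
      then have "W t (L t + h) < \<epsilon> * h" using 2 by (simp add: divide_less_eq)
      moreover have "0 \<le> real n * h ^ 2" by simp
      ultimately show ?thesis by linarith
    next
      case 3
      have "1 = 1 / d ^ 2 * d ^ 2" using d(1) by simp
      also have "\<dots> \<le> real n * h ^ 2" using 3 d(1) n by (intro mult_mono power_mono) auto
      finally have "W t (L t + h) \<le> real n * h ^ 2" using W_bounds(2)[OF t0, of "L t + h"] by simp
      moreover have "0 \<le> \<epsilon> * h" using \<epsilon> h by simp
      ultimately show ?thesis by linarith
    qed
  qed
  then show "t \<in> (\<Union>n. flat_set \<epsilon> n)" using t by (auto simp: flat_set_def)
qed (auto simp: flat_set_def)

lemma step_defect_zero: "defect (step (M + 1) 1) (step_q (M + 1) 1) a b = 0"
proof -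
  have le: "emeasure loss {a..b} \<le> ennreal (8 * exp 1 * \<epsilon> * (b - a))" if \<epsilon>: "\<epsilon> > 0" for \<epsilon>
  proof -
    have "flat_set \<epsilon> n \<subseteq> flat_set \<epsilon> n'" if "n \<le> n'" for n n'
    proof -
      have "real n * h ^ 2 \<le> real n' * h ^ 2" for h :: real using that by (intro mult_right_mono) auto
      then show ?thesis unfolding flat_set_def by (smt (verit, best) Collect_mono)
    qed
    then have "incseq (flat_set \<epsilon>)" by (rule monoI)
    moreover have "range (flat_set \<epsilon>) \<subseteq> sets loss" using closed_flat_set by (auto intro: borel_closed)
    ultimately have "emeasure loss (\<Union>n. flat_set \<epsilon> n) = (SUP n. emeasure loss (flat_set \<epsilon> n))"
      by (intro SUP_emeasure_incseq[symmetric])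
    also have "\<dots> \<le> ennreal (8 * exp 1 * \<epsilon> * (b - a))"
      by (intro SUP_least loss_flat_set \<epsilon>)
    finally show ?thesis by (simp add: flat_set_Union[OF \<epsilon>])
  qed
  have nn: "0 \<le> defect (step (M + 1) 1) (step_q (M + 1) 1) a b" using ab by (intro step_nonneg) auto
  define c where "c = 8 * exp 1 * (b - a)"
  have c: "c \<ge> 0" using ab by (simp add: c_def)
  have *: "defect (step (M + 1) 1) (step_q (M + 1) 1) a b \<le> c * \<epsilon>" if "\<epsilon> > 0" for \<epsilon>
    using le[OF that] loss_Icc[of a b] ab that nn by (simp add: ennreal_le_iff c_def mult_ac)
  have "defect (step (M + 1) 1) (step_q (M + 1) 1) a b \<le> 0 + e" if "e > 0" for e
  proof -
    \<comment> \<open>The summand 1 avoids division by zero when \<open>a = b\<close>.\<close>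
    have "c * (e / (c + 1)) \<le> e" using c that by (simp add: field_simps)
    then show ?thesis using *[of "e / (c + 1)"] c that by simp
  qed
  then have "defect (step (M + 1) 1) (step_q (M + 1) 1) a b \<le> 0" by (rule field_le_epsilon)
  then show ?thesis using nn by simp
qed

end

text \<open>The localized function \<open>p'\<close> lies between plus and minus \<open>B\<close>
  times the step, whose defect is zero, so positivity forces its defect to be zero. The rest
  \<open>p - p'\<close> vanishes left of \<open>M + 1\<close>, hence around the graph, and has no
  defect by locality.\<close>

theorem defect_zero:
  assumes s: "0 < s" "s \<le> t" and p: "test_fun p px q" and d: "decaying s t p px q"
  shows "defect p q s t = 0"
proof -
  obtain m M where mM: "\<And>\<tau>. \<tau> \<in> {s..t} \<Longrightarrow> m \<le> L \<tau> \<and> L \<tau> \<le> M" using L_range[OF s(1)] by blast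
  note t1 = step_test[OF zero_less_one] step_decaying[OF zero_less_one]
  have z: "defect (step (M + 1) 1) (step_q (M + 1) 1) s t = 0"
    by (rule step_defect_zero[OF s]) (use mM in auto)
  let ?c = "step (M + 1) 1 0"
  define p' where "p' = (\<lambda>t x. p t x * ?c x)"
  define px' where "px' = (\<lambda>t x. px t x * ?c x + p t x * (cutoff1 ((x - (M + 1)) / 1) / 1))"
  define q' where "q' = (\<lambda>t x. q t x * ?c x + px t x * (cutoff1 ((x - (M + 1)) / 1) / 1) + 1/2 * (p t x * (cutoff2 ((x - (M + 1)) / 1) / 1 ^ 2)))"
  have t': "test_fun p' px' q'"
    unfolding p'_def px'_def q'_def step_def by (rule test_fun_mult[OF p scaled_cutoff[OF zero_less_one]])
  have d': "decaying s t p' px' q'"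
    by (rule decaying_support[OF t', of "M + 2"]) (simp add: p'_def px'_def q'_def step_def cutoff_right)
  obtain B where "\<forall>\<tau>\<in>{s..t}. \<forall>x\<in>{m..M+2}. \<bar>p \<tau> x\<bar> \<le> B"
    using bounded_on_box[OF test_fun_cont(1)[OF p], of s t m "M + 2"] by auto
  note B = this[rule_format]
  have pos: "0 \<le> B * step (M + 1) 1 \<tau> x + e * p' \<tau> x" if "\<tau> \<in> {s..t}" "x > L \<tau>" "\<bar>e\<bar> = 1" for \<tau> x e
  proof (cases "x \<le> M + 2")
    case True
    then have "\<bar>p \<tau> x\<bar> \<le> B" using B[of \<tau> x] mM[of \<tau>] that by auto
    moreover have "\<bar>e * p \<tau> x\<bar> = \<bar>p \<tau> x\<bar>" using that(3) by (simp add: abs_mult)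
    ultimately have "0 \<le> B + e * p \<tau> x" by linarith
    then have "0 \<le> (B + e * p \<tau> x) * ?c x" using step_bounds by simp
    then show ?thesis by (simp add: p'_def step_def algebra_simps)
  next
    case False
    then show ?thesis by (simp add: p'_def step_def cutoff_right)
  qed
  have e: "0 \<le> e * defect p' q' s t" if "\<bar>e\<bar> = 1" for e
  proof -
    have "0 \<le> defect (\<lambda>t x. B * step (M + 1) 1 t x + e * p' t x) (\<lambda>t x. B * step_q (M + 1) 1 t x + e * q' t x) s t"
      by (rule defect_nonneg[OF s test_fun_add[OF test_fun_scale[OF t1(1)] test_fun_scale[OF t']]
            decaying_add[OF decaying_scale[OF t1(2)] decaying_scale[OF d']]]) (rule pos[OF _ _ that])
    also have "\<dots> = B * defect (step (M + 1) 1) (step_q (M + 1) 1) s t + e * defect p' q' s t"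
      by (subst defect_add[OF s test_fun_scale[OF t1(1)] decaying_scale[OF t1(2)] test_fun_scale[OF t'] decaying_scale[OF d']],
          subst defect_scale, subst defect_scale, rule refl)
    finally show ?thesis using z by simp
  qed
  have p'0: "defect p' q' s t = 0" using e[of 1] e[of "-1"] by simp
  have "0 = defect (\<lambda>t x. p t x + -1 * p' t x) (\<lambda>t x. q t x + -1 * q' t x) s t"
    by (rule sym, rule defect_local[OF s test_fun_add[OF p test_fun_scale[OF t']] decaying_add[OF d decaying_scale[OF d']], of "M + 1"])
      (use mM in \<open>auto simp: p'_def step_left\<close>, fastforce)
  also have "\<dots> = defect p q s t + -1 * defect p' q' s t"
    by (subst defect_add[OF s p d test_fun_scale[OF t'] decaying_scale[OF d']], subst defect_scale, rule refl)
  finally show ?thesis using p'0 by simp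
qed

end

section \<open>Identities on a time strip\<close>

lemma exp_abs_integrable:
  assumes "l > (0::real)"
  shows "integrable lborel (\<lambda>x :: real. exp (- l * \<bar>x\<bar>))"
proof -
  have 1: "integrable lborel (\<lambda>x. indicator {0..} x * exp (- l * x))"
    by (rule exp_halfline(1)[OF assms])
  have 2: "integrable lborel (\<lambda>x. indicator {0..} (0 + (-1) * x) * exp (- l * (0 + (-1) * x)))"
    using lborel_integrable_real_affine[OF 1, of "-1" 0] by simp
  show ?thesis
  proof (rule Bochner_Integration.integrable_bound[OF Bochner_Integration.integrable_add[OF 1 2]])
    show "AE x in lborel. norm (exp (- l * \<bar>x\<bar>)) \<le> norm (indicator {0..} x * exp (- l * x) +
        indicator {0..} (0 + (-1) * x) * exp (- l * (0 + (-1) * x)))"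
      by (intro AE_I2) (auto simp: indicator_def abs_if)
  qed simp
qed

lemma exp_abs_strip:
  fixes s t :: real
  assumes "l > (0::real)"
  shows "integrable lborel (\<lambda>(\<tau>, x). indicator {s..t} \<tau> * exp (- l * \<bar>x\<bar>) :: real)"
proof -
  have 0: "integrable lborel (\<lambda>\<tau>. indicator {s..t} \<tau> :: real)"
    using emeasure_lborel_Icc_eq[of s t] by (intro integrable_real_indicator) (auto split: if_splits)
  show ?thesis
    unfolding lborel_prod[symmetric]
    by (rule lborel_pair.Fubini_integrable)
      (use 0 exp_abs_integrable[OF assms] in \<open>auto simp: abs_mult\<close>)
qed

text \<open>Testing \<open>1 - W\<close>, which equals 1 left of the boundary, needs decay at minus
  infinity as well.\<close>

definition two_sided :: "real \<Rightarrow> real \<Rightarrow> (real \<Rightarrow> real \<Rightarrow> real) \<Rightarrow> (real \<Rightarrow> real \<Rightarrow> real) \<Rightarrow> (real \<Rightarrow> real \<Rightarrow> real) \<Rightarrow> bool" where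
  "two_sided s t p px q \<longleftrightarrow> (\<exists>C l. l > 0 \<and> (\<forall>\<tau>\<in>{s..t}. \<forall>x.
     \<bar>p \<tau> x\<bar> \<le> C * exp (- l * \<bar>x\<bar>) \<and> \<bar>px \<tau> x\<bar> \<le> C * exp (- l * \<bar>x\<bar>) \<and> \<bar>q \<tau> x\<bar> \<le> C * exp (- l * \<bar>x\<bar>)))"

lemma two_sided_decaying:
  assumes "two_sided s t p px q"
  shows "decaying s t p px q"
proof -
  obtain C l where l: "l > 0" and C: "\<And>\<tau> x. \<tau> \<in> {s..t} \<Longrightarrow>
     \<bar>p \<tau> x\<bar> \<le> C * exp (- l * \<bar>x\<bar>) \<and> \<bar>px \<tau> x\<bar> \<le> C * exp (- l * \<bar>x\<bar>) \<and> \<bar>q \<tau> x\<bar> \<le> C * exp (- l * \<bar>x\<bar>)"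
    using assms unfolding two_sided_def by blast
  show ?thesis unfolding decaying_def
  proof (rule exI[of _ C], rule exI[of _ l], intro conjI[OF l] ballI allI impI)
    fix \<tau> x :: real assume "\<tau> \<in> {s..t}" "x \<ge> 0"
    then show "\<bar>p \<tau> x\<bar> \<le> C * exp (- l * x) \<and> \<bar>px \<tau> x\<bar> \<le> C * exp (- l * x) \<and> \<bar>q \<tau> x\<bar> \<le> C * exp (- l * x)"
      using C[of \<tau> x] by simp
  qed
qed

lemma test_fun_slice_cont: "test_fun p px q \<Longrightarrow> continuous_on A (p t)" "test_fun p px q \<Longrightarrow> continuous_on A (px t)"
  unfolding test_fun_def by (meson DERIV_isCont continuous_at_imp_continuous_on)+

lemma test_fun_slice_integrable:
  assumes p: "test_fun p px q" and b: "two_sided s t p px q" and \<tau>: "\<tau> \<in> {s..t}"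
  shows "integrable lborel (p \<tau>)"
proof -
  obtain C l where l: "l > 0" and C: "\<And>\<tau> x. \<tau> \<in> {s..t} \<Longrightarrow> \<bar>p \<tau> x\<bar> \<le> C * exp (- l * \<bar>x\<bar>)"
    using b unfolding two_sided_def by blast
  have i: "integrable lborel (\<lambda>x. C * exp (- l * \<bar>x\<bar>))" by (intro integrable_mult_right exp_abs_integrable l)
  show ?thesis
  proof (rule Bochner_Integration.integrable_bound[OF i])
    show "p \<tau> \<in> borel_measurable lborel"
      using borel_measurable_continuous_onI[OF test_fun_slice_cont(1)[OF p]] by simp
    show "AE x in lborel. norm (p \<tau> x) \<le> norm (C * exp (- l * \<bar>x\<bar>))"
      unfolding real_norm_def by (intro AE_I2 order_trans[OF C[OF \<tau>] abs_ge_self])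
  qed
qed

lemma strip_integrable_bounded:
  fixes f :: "real \<times> real \<Rightarrow> real"
  assumes m: "(\<lambda>z. indicator (strip s t) z *\<^sub>R f z) \<in> borel_measurable borel"
    and l: "l > 0" and b: "\<And>\<tau> x. \<tau> \<in> {s..t} \<Longrightarrow> \<bar>f (\<tau>, x)\<bar> \<le> C * exp (- l * \<bar>x\<bar>)"
  shows "set_integrable lborel (strip s t) f"
  unfolding set_integrable_def
proof (rule Bochner_Integration.integrable_bound)
  show "integrable lborel (\<lambda>z. C * (\<lambda>(\<tau>, x). indicator {s..t} \<tau> * exp (- l * \<bar>x\<bar>)) z)"
    by (intro integrable_mult_right exp_abs_strip l)
  show "(\<lambda>z. indicator (strip s t) z *\<^sub>R f z) \<in> borel_measurable lborel" using m by simp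
  show "AE z in lborel. norm (indicator (strip s t) z *\<^sub>R f z) \<le>
      norm (C * (\<lambda>(\<tau>, x). indicator {s..t} \<tau> * exp (- l * \<bar>x\<bar>)) z)"
  proof (intro AE_I2)
    fix z :: "real \<times> real"
    show "norm (indicator (strip s t) z *\<^sub>R f z) \<le>
      norm (C * (\<lambda>(\<tau>, x). indicator {s..t} \<tau> * exp (- l * \<bar>x\<bar>)) z)"
    proof (cases "fst z \<in> {s..t}")
      case True
      then have "\<bar>f z\<bar> \<le> C * exp (- l * \<bar>snd z\<bar>)" using b[of "fst z" "snd z"] by simp
      then have "\<bar>f z\<bar> \<le> \<bar>C * exp (- l * \<bar>snd z\<bar>)\<bar>" by linarith
      then show ?thesis using True by (cases z) simp
    qed (cases z, simp)
  qed
qed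

lemma test_fun_strip_integrable:
  assumes p: "test_fun p px q" and b: "two_sided s t p px q"
  shows "set_integrable lborel (strip s t) (\<lambda>z. p (fst z) (snd z))"
    "set_integrable lborel (strip s t) (\<lambda>z. q (fst z) (snd z))"
proof -
  obtain C l where l: "l > 0" and C: "\<And>\<tau> x. \<tau> \<in> {s..t} \<Longrightarrow> \<bar>p \<tau> x\<bar> \<le> C * exp (- l * \<bar>x\<bar>)"
     "\<And>\<tau> x. \<tau> \<in> {s..t} \<Longrightarrow> \<bar>q \<tau> x\<bar> \<le> C * exp (- l * \<bar>x\<bar>)"
    using b unfolding two_sided_def by blast
  have S: "strip s t \<in> sets borel" by (intro borel_closed closed_Times) auto
  show "set_integrable lborel (strip s t) (\<lambda>z. p (fst z) (snd z))"
    by (rule strip_integrable_bounded[where C=C, OF borel_measurable_continuous_on_indicator[OF S test_fun_cont(1)[OF p]] l])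
      (use C in auto)
  show "set_integrable lborel (strip s t) (\<lambda>z. q (fst z) (snd z))"
    by (rule strip_integrable_bounded[where C=C, OF borel_measurable_continuous_on_indicator[OF S test_fun_cont(3)[OF p]] l])
      (use C in auto)
qed

lemma lim_indicator_strip:
  fixes f :: "'a :: euclidean_space \<Rightarrow> real"
  assumes f: "set_integrable lborel A f" and B: "\<And>n. B n \<in> sets borel" "\<And>n. B n \<subseteq> A"
    and ev: "\<And>z. z \<in> A \<Longrightarrow> \<forall>\<^sub>F n in sequentially. z \<in> B n"
  shows "(\<lambda>n. LINT z:B n|lborel. f z) \<longlonglongrightarrow> (LINT z:A|lborel. f z)"
  unfolding set_lebesgue_integral_def
proof (rule integral_dominated_convergence)
  have i: "integrable lborel (\<lambda>z. indicator A z *\<^sub>R f z)" using f by (simp add: set_integrable_def)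
  then show "(\<lambda>z. indicator A z *\<^sub>R f z) \<in> borel_measurable lborel"
    "integrable lborel (\<lambda>z. \<bar>indicator A z *\<^sub>R f z\<bar>)" by auto
  have eq: "indicator (B n) z *\<^sub>R f z = indicator (B n) z *\<^sub>R (indicator A z *\<^sub>R f z)" for n z
    using B(2)[of n] by (auto simp: indicator_def)
  show "(\<lambda>z. indicator (B n) z *\<^sub>R f z) \<in> borel_measurable lborel" for n
    unfolding eq using B(1)[of n] by (intro borel_measurable_scaleR borel_measurable_indicator borel_measurable_integrable[OF i]) simp
  show "AE z in lborel. norm (indicator (B n) z *\<^sub>R f z) \<le> \<bar>indicator A z *\<^sub>R f z\<bar>" for n
    using B(2)[of n] by (intro AE_I2) (auto simp: indicator_def)
  show "AE z in lborel. (\<lambda>n. indicator (B n) z *\<^sub>R f z) \<longlonglongrightarrow> indicator A z *\<^sub>R f z"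
  proof (intro AE_I2)
    fix z
    have "\<forall>\<^sub>F n in sequentially. indicator (B n) z *\<^sub>R f z = indicator A z *\<^sub>R f z"
    proof (cases "z \<in> A")
      case True
      show ?thesis using ev[OF True] by eventually_elim (simp add: True)
    next
      case False
      then show ?thesis using B(2) by (intro always_eventually) (auto simp: indicator_def)
    qed
    then show "(\<lambda>n. indicator (B n) z *\<^sub>R f z) \<longlonglongrightarrow> indicator A z *\<^sub>R f z" by (rule tendsto_eventually)
  qed
qed

text \<open>The fluxes \<open>px\<close> through the lines at distance \<open>n\<close> vanish
  exponentially as \<open>n\<close> grows. The purpose is to convert identities for \<open>W\<close>
  into identities for \<open>1 - W\<close>.\<close>

lemma total_mass:
  assumes st: "s \<le> t" and p: "test_fun p px q" and b: "two_sided s t p px q"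
  shows "(LINT z:(strip s t)|lborel. q (fst z) (snd z)) = (LINT x|lborel. p t x) - (LINT x|lborel. p s x)"
proof -
  obtain pt pxx where
    pt: "\<And>t x. ((\<lambda>s. p s x) has_real_derivative pt t x) (at t)" and
    px: "\<And>t x. (p t has_real_derivative px t x) (at x)" and
    pxx: "\<And>t x. (px t has_real_derivative pxx t x) (at x)" and
    k: "continuous_on UNIV (\<lambda>z. p (fst z) (snd z))"
    "continuous_on UNIV (\<lambda>z. px (fst z) (snd z))"
    "continuous_on UNIV (\<lambda>z. pt (fst z) (snd z))"
    "continuous_on UNIV (\<lambda>z. pxx (fst z) (snd z))" and
    q: "\<And>t x. q t x = pt t x + 1/2 * pxx t x"
    by (rule test_funE[OF p]) (rule that; assumption)
  obtain C l where l: "l > 0" and C: "\<And>\<tau> x. \<tau> \<in> {s..t} \<Longrightarrow> \<bar>px \<tau> x\<bar> \<le> C * exp (- l * \<bar>x\<bar>)"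
    using b unfolding two_sided_def by blast
  let ?B = "\<lambda>n. {s..t} \<times> {- real n..real n}"
  have Bm: "?B n \<in> sets borel" for n by (intro borel_closed closed_Times) auto
  have ev: "\<forall>\<^sub>F n in sequentially. \<bar>x\<bar> \<le> real n" for x
    using filterlim_real_sequentially by (auto simp: filterlim_at_top)
  define bd where "bd n = integral {s..t} (\<lambda>\<tau>. px \<tau> (real n) - px \<tau> (- real n))" for n
  have 1: "(LINT z:?B n|lborel. q (fst z) (snd z)) = (LINT x:{- real n..real n}|lborel. p t x - p s x) + 1/2 * bd n" for n
  proof -
    have i: "set_integrable lborel (?B n) (\<lambda>z. q (fst z) (snd z))"
      by (rule set_integrable_subset[OF test_fun_strip_integrable(2)[OF p b]]) (use Bm in auto)
    have j: "set_integrable lborel {- real n..real n} (\<lambda>x. p t x - p s x)"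
      by (intro borel_integrable_atLeastAtMost' continuous_on_diff test_fun_slice_cont(1)[OF p])
    have "(LINT z:?B n|lborel. q (fst z) (snd z)) = integral (?B n) (\<lambda>z. q (fst z) (snd z))"
      by (rule set_borel_integral_eq_integral[OF i])
    \<comment> \<open>The rectangle identity carries a minus sign in front of the space derivative;
      it is used with \<open>- px\<close> as the flux.\<close>
    also have "\<dots> = integral (?B n) (\<lambda>(\<tau>, x). pt \<tau> x - 1/2 * (- pxx \<tau> x))"
      by (simp add: q case_prod_unfold)
    also have "\<dots> = integral {- real n..real n} (\<lambda>x. p t x - p s x) - 1/2 * integral {s..t} (\<lambda>\<tau>. - px \<tau> (real n) - - px \<tau> (- real n))"
    proof (rule box_identity[OF st])
      show "continuous_on (?B n) (\<lambda>(\<tau>, x). pt \<tau> x)" "continuous_on (?B n) (\<lambda>(\<tau>, x). - pxx \<tau> x)"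
        using k(3,4) by (auto simp: case_prod_unfold intro: continuous_on_subset continuous_on_minus)
      show "((\<lambda>x. - px \<tau> x) has_real_derivative - pxx \<tau> x) (at x)" for \<tau> x
        by (intro DERIV_minus pxx)
    qed (auto intro: pt)
    also have "integral {s..t} (\<lambda>\<tau>. - px \<tau> (real n) - - px \<tau> (- real n)) = - bd n"
      unfolding bd_def by (subst Henstock_Kurzweil_Integration.integral_neg[symmetric]) simp
    also have "integral {- real n..real n} (\<lambda>x. p t x - p s x) = (LINT x:{- real n..real n}|lborel. p t x - p s x)"
      by (rule set_borel_integral_eq_integral(2)[OF j, symmetric])
    finally show ?thesis by simp
  qed
  have bd: "bd \<longlonglongrightarrow> 0"
  proof (rule Lim_null_comparison)
    show "\<forall>\<^sub>F n in sequentially. norm (bd n) \<le> 2 * C * exp (- l * real n) * (t - s)"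
    proof (intro always_eventually allI)
      fix n
      have c: "continuous_on {s..t} (\<lambda>\<tau>. px \<tau> x)" for x
      proof -
        have "continuous_on {s..t} (\<lambda>\<tau>. (\<tau>, x))" by (intro continuous_on_Pair continuous_on_id continuous_on_const)
        from continuous_on_compose2[OF k(2) this] show ?thesis by simp
      qed
      show "norm (bd n) \<le> 2 * C * exp (- l * real n) * (t - s)" unfolding bd_def
      proof (rule integral_bound[OF st])
        show "continuous_on {s..t} (\<lambda>\<tau>. px \<tau> (real n) - px \<tau> (- real n))" by (intro continuous_on_diff c)
        fix \<tau> assume \<tau>: "\<tau> \<in> {s..t}"
        have "norm (px \<tau> (real n) - px \<tau> (- real n)) \<le> \<bar>px \<tau> (real n)\<bar> + \<bar>px \<tau> (- real n)\<bar>"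
          unfolding real_norm_def by (rule abs_triangle_ineq4)
        also have "\<dots> \<le> 2 * C * exp (- l * real n)"
          using C[OF \<tau>, of "real n"] C[OF \<tau>, of "- real n"] by simp
        finally show "norm (px \<tau> (real n) - px \<tau> (- real n)) \<le> 2 * C * exp (- l * real n)" .
      qed
    qed
    have "(\<lambda>n. exp (- l * real n)) \<longlonglongrightarrow> 0"
    proof -
      have "filterlim (\<lambda>n. l * real n) at_top sequentially"
        by (rule filterlim_tendsto_pos_mult_at_top[OF tendsto_const l filterlim_real_sequentially])
      then have "filterlim (\<lambda>n. - (l * real n)) at_bot sequentially"
        by (simp add: filterlim_uminus_at_top)
      from filterlim_compose[OF exp_at_bot this] show ?thesis by simp
    qed
    from tendsto_mult_right[OF tendsto_mult_left[OF this, of "2 * C"], of "t - s"]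
    show "(\<lambda>n. 2 * C * exp (- l * real n) * (t - s)) \<longlonglongrightarrow> 0" by simp
  qed
  have "(\<lambda>n. LINT z:?B n|lborel. q (fst z) (snd z)) \<longlonglongrightarrow> (LINT z:(strip s t)|lborel. q (fst z) (snd z))"
  proof (rule lim_indicator_strip[OF test_fun_strip_integrable(2)[OF p b] Bm])
    show "\<forall>\<^sub>F n in sequentially. z \<in> ?B n" if "z \<in> strip s t" for z
      using ev[of "snd z"] by eventually_elim (use that in \<open>auto simp: mem_Times_iff abs_le_iff\<close>)
  qed auto
  moreover have "(\<lambda>n. (LINT x:{- real n..real n}|lborel. p t x - p s x) + 1/2 * bd n) \<longlonglongrightarrow>
     (LINT x:UNIV|lborel. p t x - p s x) + 1/2 * 0"
  proof (intro tendsto_intros bd lim_indicator_strip)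
    show "set_integrable lborel UNIV (\<lambda>x. p t x - p s x)"
      unfolding set_integrable_def using test_fun_slice_integrable[OF p b] st by simp
    show "\<forall>\<^sub>F n in sequentially. x \<in> {- real n..real n}" for x
      using ev[of x] by eventually_elim auto
  qed auto
  ultimately have "(LINT z:(strip s t)|lborel. q (fst z) (snd z)) = (LINT x:UNIV|lborel. p t x - p s x) + 1/2 * 0"
    unfolding 1 by (rule LIMSEQ_unique)
  also have "\<dots> = (LINT x|lborel. p t x) - (LINT x|lborel. p s x)"
    unfolding set_lebesgue_integral_def using test_fun_slice_integrable[OF p b] st by simp
  finally show ?thesis .
qed

section \<open>Weak identities for W and its complement\<close>

context contact_problem
begin

lemma right_part_integrable:
  assumes s: "0 < s" "s \<le> t" and p: "test_fun p px q" and d: "decaying s t p px q"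
  shows "set_integrable lborel (strip s t) (\<lambda>z. if snd z > L (fst z) then p (fst z) (snd z) else 0)"
proof -
  obtain G where G: "integrable lborel G" "\<And>z. G z \<ge> 0"
    "\<And>\<tau> x. \<tau> \<in> {s..t} \<Longrightarrow> x > L \<tau> \<Longrightarrow> \<bar>p \<tau> x\<bar> \<le> G (\<tau>, x)"
    by (rule dominator[OF s p d]) blast
  show ?thesis unfolding set_integrable_def
  proof (rule Bochner_Integration.integrable_bound[OF G(1)])
    show "(\<lambda>z. indicator (strip s t) z *\<^sub>R (if snd z > L (fst z) then p (fst z) (snd z) else 0)) \<in> borel_measurable lborel"
      using strip_meas[OF s(1) test_fun_cont(1)[OF p]] by simp
    show "AE z in lborel. norm (indicator (strip s t) z *\<^sub>R (if snd z > L (fst z) then p (fst z) (snd z) else 0)) \<le> norm (G z)"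
    proof (intro AE_I2)
      fix z
      show "norm (indicator (strip s t) z *\<^sub>R (if snd z > L (fst z) then p (fst z) (snd z) else 0)) \<le> norm (G z)"
        using G(2)[of z] G(3)[of "fst z" "snd z"] by (cases "fst z \<in> {s..t}"; cases z) auto
    qed
  qed
qed

text \<open>The source right of \<open>L\<close> is separated from the rest, so that
  \<open>W\<close> multiplies \<open>q + p\<close> on the whole strip. That factor is the backward
  operator of the full equation: zero for solutions, of one sign for super- and
  subsolutions.\<close>

lemma weak_identity:
  assumes s: "0 < s" "s \<le> t" and p: "test_fun p px q" and d: "decaying s t p px q"
  shows "(LINT x|lborel. W s x * p s x) = (LINT x|lborel. W t x * p t x)
     - (LINT z:(strip s t)|lborel. W (fst z) (snd z) * (q (fst z) (snd z) + p (fst z) (snd z)))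
     + (LINT z:(strip s t)|lborel. if snd z > L (fst z) then p (fst z) (snd z) else 0)"
    and "set_integrable lborel (strip s t) (\<lambda>z. W (fst z) (snd z) * (q (fst z) (snd z) + p (fst z) (snd z)))"
proof -
  let ?S = "strip s t"
  let ?R = "\<lambda>z. if snd z > L (fst z) then p (fst z) (snd z) else 0"
  let ?Q = "\<lambda>z. W (fst z) (snd z) * (q (fst z) (snd z) + p (fst z) (snd z))"
  have eq: "indicator ?S z *\<^sub>R ?Q z = indicator ?S z *\<^sub>R integrand p q z + indicator ?S z *\<^sub>R ?R z" for z
  proof (cases "z \<in> ?S")
    case True
    then have "fst z > 0" using s by auto
    then show ?thesis using W_left[of "fst z" "snd z"] by (simp add: integrand_def algebra_simps)
  qed simp
  have i: "integrable lborel (\<lambda>z. indicator ?S z *\<^sub>R integrand p q z)" "integrable lborel (\<lambda>z. indicator ?S z *\<^sub>R ?R z)"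
    using integrand_integrable(1)[OF s p d] right_part_integrable[OF s p d] by (auto simp: set_integrable_def)
  show "set_integrable lborel ?S ?Q"
    unfolding set_integrable_def eq by (intro Bochner_Integration.integrable_add i)
  have "(LINT z:?S|lborel. ?Q z) = (LINT z:?S|lborel. integrand p q z) + (LINT z:?S|lborel. ?R z)"
    unfolding set_lebesgue_integral_def eq by (intro Bochner_Integration.integral_add i)
  then show "(LINT x|lborel. W s x * p s x) = (LINT x|lborel. W t x * p t x)
     - (LINT z:?S|lborel. ?Q z) + (LINT z:?S|lborel. ?R z)"
    using defect_zero[OF s p d] by (simp add: defect_def)
qed

lemma supersolution:
  assumes s: "0 < s" "s \<le> t" and p: "test_fun p px q" and d: "decaying s t p px q"
    and nn: "\<And>\<tau> x. p \<tau> x \<ge> 0" and le: "\<And>\<tau> x. q \<tau> x + p \<tau> x \<le> 0"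
  shows "(LINT z:(strip s t)|lborel. if snd z > L (fst z) then p (fst z) (snd z) else 0) \<le> (LINT x|lborel. W s x * p s x)"
proof -
  have "0 \<le> (LINT x|lborel. W t x * p t x)"
    using s nn by (intro integral_nonneg_AE AE_I2 mult_nonneg_nonneg W_bounds) auto
  moreover have "(LINT z:(strip s t)|lborel. W (fst z) (snd z) * (q (fst z) (snd z) + p (fst z) (snd z))) \<le> (LINT z:(strip s t)|lborel. 0 :: real)"
  proof (rule set_integral_mono[OF weak_identity(2)[OF s p d]])
    show "W (fst z) (snd z) * (q (fst z) (snd z) + p (fst z) (snd z)) \<le> 0" if "z \<in> strip s t" for z
      using that s by (intro mult_nonneg_nonpos le W_bounds) auto
  qed (simp add: set_integrable_def)
  ultimately show ?thesis using weak_identity(1)[OF s p d] by simp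
qed

lemma complement_slice_integrable:
  assumes s: "0 < s" and \<tau>: "\<tau> \<in> {s..t}" and p: "test_fun p px q" and b: "two_sided s t p px q"
  shows "integrable lborel (\<lambda>x. (1 - W \<tau> x) * p \<tau> x)"
  unfolding left_diff_distrib mult_1_left
  by (intro Bochner_Integration.integrable_diff test_fun_slice_integrable[OF p b \<tau>] slice_integrable[OF s \<tau> p two_sided_decaying[OF b]])

text \<open>Difference of \<open>total_mass\<close> and \<open>weak_identity\<close>. The bulk term
  uses up the full integral of \<open>p\<close>, from which the part right of \<open>L\<close> is
  subtracted, leaving the part on the left.\<close>

lemma complement_identity:
  assumes s: "0 < s" "s \<le> t" and p: "test_fun p px q" and b: "two_sided s t p px q"
  shows "(LINT x|lborel. (1 - W s x) * p s x) = (LINT x|lborel. (1 - W t x) * p t x)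
     - (LINT z:(strip s t)|lborel. (1 - W (fst z) (snd z)) * (q (fst z) (snd z) + p (fst z) (snd z)))
     + (LINT z:(strip s t)|lborel. if snd z \<le> L (fst z) then p (fst z) (snd z) else 0)"
    and "set_integrable lborel (strip s t) (\<lambda>z. (1 - W (fst z) (snd z)) * (q (fst z) (snd z) + p (fst z) (snd z)))"
    and "set_integrable lborel (strip s t) (\<lambda>z. if snd z \<le> L (fst z) then p (fst z) (snd z) else 0)"
proof -
  let ?S = "strip s t"
  let ?R = "\<lambda>z. if snd z > L (fst z) then p (fst z) (snd z) else 0"
  let ?R' = "\<lambda>z. if snd z \<le> L (fst z) then p (fst z) (snd z) else 0"
  let ?Q = "\<lambda>z. W (fst z) (snd z) * (q (fst z) (snd z) + p (fst z) (snd z))"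
  let ?Q' = "\<lambda>z. (1 - W (fst z) (snd z)) * (q (fst z) (snd z) + p (fst z) (snd z))"
  let ?p = "\<lambda>z. p (fst z) (snd z)" and ?q = "\<lambda>z. q (fst z) (snd z)"
  note d = two_sided_decaying[OF b]
  have i: "integrable lborel (\<lambda>z. indicator ?S z *\<^sub>R ?R z)" "integrable lborel (\<lambda>z. indicator ?S z *\<^sub>R ?Q z)"
    "integrable lborel (\<lambda>z. indicator ?S z *\<^sub>R ?p z)" "integrable lborel (\<lambda>z. indicator ?S z *\<^sub>R ?q z)"
    using right_part_integrable[OF s p d] weak_identity(2)[OF s p d] test_fun_strip_integrable[OF p b]
    by (auto simp: set_integrable_def)
  have eR: "indicator ?S z *\<^sub>R ?R' z = indicator ?S z *\<^sub>R ?p z - indicator ?S z *\<^sub>R ?R z" for z by simp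
  have eQ: "indicator ?S z *\<^sub>R ?Q' z = indicator ?S z *\<^sub>R ?q z + indicator ?S z *\<^sub>R ?p z - indicator ?S z *\<^sub>R ?Q z" for z
    by (simp add: algebra_simps)
  show "set_integrable lborel ?S ?Q'"
    unfolding set_integrable_def eQ by (intro Bochner_Integration.integrable_add Bochner_Integration.integrable_diff i)
  show "set_integrable lborel ?S ?R'"
    unfolding set_integrable_def eR by (intro Bochner_Integration.integrable_diff i)
  have 1: "(LINT z:?S|lborel. ?R' z) = (LINT z:?S|lborel. ?p z) - (LINT z:?S|lborel. ?R z)"
    unfolding set_lebesgue_integral_def eR by (intro Bochner_Integration.integral_diff i)
  have 2: "(LINT z:?S|lborel. ?Q' z) = (LINT z:?S|lborel. ?q z) + (LINT z:?S|lborel. ?p z) - (LINT z:?S|lborel. ?Q z)"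
    unfolding set_lebesgue_integral_def eQ
    by (rule trans[OF Bochner_Integration.integral_diff[OF Bochner_Integration.integrable_add[OF i(4,3)] i(2)]],
        rule arg_cong2[where f = "(-)", OF Bochner_Integration.integral_add[OF i(4,3)] refl])
  have 3: "(LINT x|lborel. (1 - W \<tau> x) * p \<tau> x) = (LINT x|lborel. p \<tau> x) - (LINT x|lborel. W \<tau> x * p \<tau> x)" if "\<tau> \<in> {s..t}" for \<tau>
    unfolding left_diff_distrib mult_1_left
    by (intro Bochner_Integration.integral_diff test_fun_slice_integrable[OF p b that] slice_integrable[OF s(1) that p d])
  show "(LINT x|lborel. (1 - W s x) * p s x) = (LINT x|lborel. (1 - W t x) * p t x) - (LINT z:?S|lborel. ?Q' z) + (LINT z:?S|lborel. ?R' z)"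
    using weak_identity(1)[OF s p d] total_mass[OF s(2) p b] 1 2 3[of s] 3[of t] s by simp
qed

lemma complement_supersolution:
  assumes s: "0 < s" "s \<le> t" and p: "test_fun p px q" and b: "two_sided s t p px q"
    and nn: "\<And>\<tau> x. p \<tau> x \<ge> 0" and le: "\<And>\<tau> x. q \<tau> x + p \<tau> x \<le> 0"
  shows "(LINT z:(strip s t)|lborel. if snd z \<le> L (fst z) then p (fst z) (snd z) else 0) \<le> (LINT x|lborel. (1 - W s x) * p s x)"
proof -
  have "0 \<le> (LINT x|lborel. (1 - W t x) * p t x)"
    using s nn W_bounds(2)[of t] by (intro integral_nonneg_AE AE_I2 mult_nonneg_nonneg) auto
  moreover have "(LINT z:(strip s t)|lborel. (1 - W (fst z) (snd z)) * (q (fst z) (snd z) + p (fst z) (snd z))) \<le> (LINT z:(strip s t)|lborel. 0 :: real)"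
  proof (rule set_integral_mono[OF complement_identity(2)[OF s p b]])
    show "(1 - W (fst z) (snd z)) * (q (fst z) (snd z) + p (fst z) (snd z)) \<le> 0" if "z \<in> strip s t" for z
      using that s W_bounds(2)[of "fst z" "snd z"] by (intro mult_nonneg_nonpos le) auto
  qed (simp add: set_integrable_def)
  ultimately show ?thesis using complement_identity(1)[OF s p b] by simp
qed

text \<open>In this direction the terminal term cannot be dropped; it has to be made small by the
  choice of the subsolution.\<close>

lemma complement_subsolution:
  assumes s: "0 < s" "s \<le> t" and p: "test_fun p px q" and b: "two_sided s t p px q"
    and ge: "\<And>\<tau> x. q \<tau> x + p \<tau> x \<ge> 0"
  shows "(LINT x|lborel. (1 - W s x) * p s x) \<le> (LINT x|lborel. (1 - W t x) * p t x) +
    (LINT z:(strip s t)|lborel. if snd z \<le> L (fst z) then p (fst z) (snd z) else 0)"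
proof -
  have "(LINT z:(strip s t)|lborel. 0 :: real) \<le> (LINT z:(strip s t)|lborel. (1 - W (fst z) (snd z)) * (q (fst z) (snd z) + p (fst z) (snd z)))"
  proof (rule set_integral_mono[OF _ complement_identity(2)[OF s p b]])
    show "0 \<le> (1 - W (fst z) (snd z)) * (q (fst z) (snd z) + p (fst z) (snd z))" if "z \<in> strip s t" for z
      using that s W_bounds(2)[of "fst z" "snd z"] by (intro mult_nonneg_nonneg ge) auto
  qed (simp add: set_integrable_def)
  then show ?thesis using complement_identity(1)[OF s p b] by simp
qed

end

section \<open>Test functions and the limit at time zero\<close>

lemma test_fun_exp_time: "test_fun (\<lambda>\<tau> x. exp (- c * \<tau>)) (\<lambda>_ _. 0) (\<lambda>\<tau> x. - c * exp (- c * \<tau>))"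
proof -
  have 1: "((\<lambda>s. exp (- c * s)) has_real_derivative - c * exp (- c * t)) (at t)" for t
    by (auto intro!: derivative_eq_intros)
  have 2: "continuous_on UNIV (\<lambda>z :: real \<times> real. exp (- c * fst z))"
    by (intro continuous_intros)
  show ?thesis unfolding test_fun_def
    by (rule exI[of _ "\<lambda>t x. - c * exp (- c * t)"], rule exI[of _ "\<lambda>_ _. 0"])
      (intro conjI allI 1 2 continuous_on_mult continuous_on_const DERIV_const; simp)
qed

text \<open>A \<open>sech\<close> profile \<open>1 / g\<close> with \<open>g'' = r ^ 2 * g\<close>.
  It increases to \<open>exp (r * x)\<close> as \<open>k\<close> decreases to 0, and for
  \<open>r \<noteq> 0\<close> of either sign it decays at both ends.\<close>

definition damped :: "real \<Rightarrow> real \<Rightarrow> real \<Rightarrow> real" where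
  "damped k r x = 1 / (exp (- r * x) + k * exp (r * x))"
definition damped1 :: "real \<Rightarrow> real \<Rightarrow> real \<Rightarrow> real" where
  "damped1 k r x = - (k * r * exp (r * x) - r * exp (- r * x)) / (exp (- r * x) + k * exp (r * x)) ^ 2"
definition damped2 :: "real \<Rightarrow> real \<Rightarrow> real \<Rightarrow> real" where
  "damped2 k r x = - (r ^ 2) / (exp (- r * x) + k * exp (r * x)) +
     2 * (k * r * exp (r * x) - r * exp (- r * x)) ^ 2 / (exp (- r * x) + k * exp (r * x)) ^ 3"

context
  fixes k r :: real
  assumes k: "k > 0"
begin

lemma damped_denom_pos: "exp (- r * x) + k * exp (r * x) > 0"
  using k by (intro add_pos_pos mult_pos_pos) auto

lemma damped_deriv: "(damped k r has_real_derivative damped1 k r x) (at x)"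
proof -
  have "((\<lambda>x. exp (- r * x) + k * exp (r * x)) has_real_derivative (k * r * exp (r * x) - r * exp (- r * x))) (at x)"
    by (auto intro!: derivative_eq_intros)
  from DERIV_inverse_fun[OF this] damped_denom_pos[of x]
  have "((\<lambda>x. inverse (exp (- r * x) + k * exp (r * x))) has_real_derivative
     - (inverse (exp (- r * x) + k * exp (r * x)) * (k * r * exp (r * x) - r * exp (- r * x)) * inverse (exp (- r * x) + k * exp (r * x)))) (at x)"
    by (simp add: mult_ac)
  moreover have "- (inverse a * n * inverse a) = - n / a ^ 2" for a n :: real
    by (simp add: divide_inverse power2_eq_square)
  ultimately show ?thesis
    unfolding damped_def[abs_def] damped1_def by (simp only: inverse_eq_divide)
qed

lemma damped1_deriv: "(damped1 k r has_real_derivative damped2 k r x) (at x)"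
proof -
  define g where "g x = exp (- r * x) + k * exp (r * x)" for x
  define g' where "g' x = k * r * exp (r * x) - r * exp (- r * x)" for x
  have g: "(g has_real_derivative g' x) (at x)" unfolding g_def g'_def
    by (auto intro!: derivative_eq_intros)
  have g': "(g' has_real_derivative r ^ 2 * g x) (at x)" unfolding g_def g'_def
    by (auto intro!: derivative_eq_intros simp: power2_eq_square algebra_simps)
  have gx: "g x \<noteq> 0" using damped_denom_pos[of x] by (simp add: g_def)
  have "((\<lambda>x. - g' x / g x ^ 2) has_real_derivative (- (r ^ 2 * g x) * g x ^ 2 - - g' x * (2 * g x * g' x)) / (g x ^ 2 * g x ^ 2)) (at x)"
    by (rule DERIV_divide[OF DERIV_minus[OF g'] _]) (use gx g in \<open>auto intro!: derivative_eq_intros\<close>)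
  also have "(- (r ^ 2 * g x) * g x ^ 2 - - g' x * (2 * g x * g' x)) / (g x ^ 2 * g x ^ 2) = - (r ^ 2) / g x + 2 * g' x ^ 2 / g x ^ 3"
    using gx by (simp add: field_simps power2_eq_square power3_eq_cube)
  finally show ?thesis
    unfolding damped1_def[abs_def] damped2_def g_def g'_def by simp
qed

lemma isCont_damped2: "isCont (damped2 k r) x"
  unfolding damped2_def[abs_def] using damped_denom_pos[of x]
  by (intro continuous_intros) auto

lemma damped_pos: "damped k r x > 0"
  using damped_denom_pos[of x] by (simp add: damped_def)

lemma damped_le_exp: "damped k r x \<le> exp (r * x)"
proof -
  have "damped k r x \<le> 1 / exp (- r * x)"
    unfolding damped_def using k by (intro divide_left_mono mult_pos_pos damped_denom_pos) auto
  then show ?thesis by (simp add: exp_minus inverse_eq_divide)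
qed

lemma damped_bound: "damped k r x \<le> (1 + 1 / k) * exp (- \<bar>r\<bar> * \<bar>x\<bar>)"
proof (cases "r * x \<ge> 0")
  case True
  have "damped k r x \<le> 1 / (k * exp (r * x))"
    unfolding damped_def using k by (intro divide_left_mono mult_pos_pos damped_denom_pos) auto
  also have "\<dots> = 1 / k * exp (- \<bar>r\<bar> * \<bar>x\<bar>)"
    using True by (simp add: abs_mult[symmetric] exp_minus inverse_eq_divide)
  also have "\<dots> \<le> (1 + 1 / k) * exp (- \<bar>r\<bar> * \<bar>x\<bar>)" by (intro mult_right_mono) auto
  finally show ?thesis .
next
  case False
  have "damped k r x \<le> exp (r * x)" by (rule damped_le_exp)
  also have "\<dots> = 1 * exp (- \<bar>r\<bar> * \<bar>x\<bar>)" using False by (simp add: abs_mult[symmetric])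
  also have "\<dots> \<le> (1 + 1 / k) * exp (- \<bar>r\<bar> * \<bar>x\<bar>)" using k by (intro mult_right_mono) auto
  finally show ?thesis .
qed

lemma damped_numerator: "\<bar>k * r * exp (r * x) - r * exp (- r * x)\<bar> \<le> \<bar>r\<bar> * (exp (- r * x) + k * exp (r * x))"
proof -
  have "\<bar>k * exp (r * x) - exp (- r * x)\<bar> \<le> exp (- r * x) + k * exp (r * x)"
    using k by (simp add: abs_le_iff)
  from mult_left_mono[OF this, of "\<bar>r\<bar>"] show ?thesis
    by (simp add: abs_mult[symmetric] algebra_simps)
qed

text \<open>For the denominator \<open>g\<close> one has
  \<open>(1 / g)'' = - r ^ 2 / g + 2 * g' ^ 2 / g ^ 3\<close> and
  \<open>\<bar>g'\<bar> \<le> \<bar>r\<bar> * g\<close>. The one-sided bound with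
  \<open>r ^ 2\<close> gives the supersolution; the constant 3 serves only the decay
  estimate.\<close>

lemma damped_derivs_bound:
  "\<bar>damped1 k r x\<bar> \<le> \<bar>r\<bar> * damped k r x" "damped2 k r x \<le> r ^ 2 * damped k r x" "\<bar>damped2 k r x\<bar> \<le> 3 * r ^ 2 * damped k r x"
proof -
  define g where "g = exp (- r * x) + k * exp (r * x)"
  define n where "n = k * r * exp (r * x) - r * exp (- r * x)"
  have g: "g > 0" using damped_denom_pos by (simp add: g_def)
  have n: "\<bar>n\<bar> \<le> \<bar>r\<bar> * g" using damped_numerator by (simp add: g_def n_def)
  have d: "damped k r x = 1 / g" "damped1 k r x = - n / g ^ 2" "damped2 k r x = - (r ^ 2) / g + 2 * n ^ 2 / g ^ 3"
    by (simp_all add: damped_def damped1_def damped2_def g_def n_def)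
  have "\<bar>damped1 k r x\<bar> = \<bar>n\<bar> / g ^ 2" using g by (simp add: d)
  also have "\<dots> \<le> \<bar>r\<bar> * g / g ^ 2" using n g by (intro divide_right_mono) auto
  also have "\<dots> = \<bar>r\<bar> * damped k r x" using g by (simp add: d power2_eq_square)
  finally show "\<bar>damped1 k r x\<bar> \<le> \<bar>r\<bar> * damped k r x" .
  have "n ^ 2 \<le> (\<bar>r\<bar> * g) ^ 2" using n by (metis abs_ge_zero power2_abs power_mono)
  then have "n ^ 2 \<le> r ^ 2 * g ^ 2" by (simp add: power_mult_distrib)
  then have "2 * n ^ 2 / g ^ 3 \<le> 2 * (r ^ 2 * g ^ 2) / g ^ 3" using g by (intro divide_right_mono) auto
  also have "\<dots> = 2 * r ^ 2 * (1 / g)" using g by (simp add: power2_eq_square power3_eq_cube)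
  finally have 1: "2 * n ^ 2 / g ^ 3 \<le> 2 * r ^ 2 * (1 / g)" .
  have 2: "0 \<le> 2 * n ^ 2 / g ^ 3" "0 \<le> r ^ 2 * (1 / g)" "- (r ^ 2) / g = - (r ^ 2 * (1 / g))" using g by auto
  show "damped2 k r x \<le> r ^ 2 * damped k r x" "\<bar>damped2 k r x\<bar> \<le> 3 * r ^ 2 * damped k r x"
    unfolding d 2(3) using 1 2(1,2) by (auto simp: abs_le_iff)
qed

lemma damped_test:
  "test_fun (\<lambda>\<tau> x. exp (- c * \<tau>) * damped k r x) (\<lambda>\<tau> x. exp (- c * \<tau>) * damped1 k r x)
     (\<lambda>\<tau> x. exp (- c * \<tau>) * (1/2 * damped2 k r x - c * damped k r x))"
  using test_fun_mult[OF test_fun_exp_time[of c] damped_deriv damped1_deriv isCont_damped2]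
  by (simp add: algebra_simps)

lemma damped_two_sided:
  assumes r: "r \<noteq> 0" and c: "c > 0" and s: "s > 0"
  shows "two_sided s t (\<lambda>\<tau> x. exp (- c * \<tau>) * damped k r x) (\<lambda>\<tau> x. exp (- c * \<tau>) * damped1 k r x)
     (\<lambda>\<tau> x. exp (- c * \<tau>) * (1/2 * damped2 k r x - c * damped k r x))"
proof -
  define A where "A = 1 + \<bar>r\<bar> + 3 * r ^ 2 + c"
  have A: "1 \<le> A" "\<bar>r\<bar> \<le> A" "3/2 * r ^ 2 + c \<le> A" using c zero_le_power2[of r] abs_ge_zero[of r] unfolding A_def by linarith+
  have *: "\<bar>exp (- c * \<tau>) * y\<bar> \<le> (A * (1 + 1 / k)) * exp (- \<bar>r\<bar> * \<bar>x\<bar>)"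
    if "\<tau> \<in> {s..t}" "\<bar>y\<bar> \<le> A * damped k r x" for \<tau> x y
  proof -
    have "exp (- c * \<tau>) \<le> 1" using that(1) c s by (simp add: mult_nonneg_nonneg)
    then have "exp (- c * \<tau>) * \<bar>y\<bar> \<le> 1 * (A * damped k r x)"
      using that(2) by (intro mult_mono) auto
    also have "\<dots> \<le> A * ((1 + 1 / k) * exp (- \<bar>r\<bar> * \<bar>x\<bar>))"
      using damped_bound A(1) by simp
    finally show ?thesis by (simp add: abs_mult mult.assoc)
  qed
  show ?thesis unfolding two_sided_def
  proof (rule exI[of _ "A * (1 + 1 / k)"], rule exI[of _ "\<bar>r\<bar>"], intro conjI ballI allI)
    fix \<tau> x :: real assume t: "\<tau> \<in> {s..t}"
    note b = damped_derivs_bound[of x] damped_pos[of x]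
    have dA: "a * damped k r x \<le> A * damped k r x" if "a \<le> A" for a
      using that b(4) by (intro mult_right_mono) auto
    show "\<bar>exp (- c * \<tau>) * damped k r x\<bar> \<le> (A * (1 + 1 / k)) * exp (- \<bar>r\<bar> * \<bar>x\<bar>)"
      using dA[OF A(1)] b(4) by (intro * t) auto
    show "\<bar>exp (- c * \<tau>) * damped1 k r x\<bar> \<le> (A * (1 + 1 / k)) * exp (- \<bar>r\<bar> * \<bar>x\<bar>)"
      using dA[OF A(2)] b(1) by (intro * t) auto
    have "\<bar>1/2 * damped2 k r x - c * damped k r x\<bar> \<le> 1/2 * \<bar>damped2 k r x\<bar> + c * damped k r x"
      using b(4) c by (intro order_trans[OF abs_triangle_ineq4]) (simp add: abs_mult)
    also have "\<dots> \<le> (3/2 * r ^ 2 + c) * damped k r x" using b(3) by (simp add: algebra_simps)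
    also have "\<dots> \<le> A * damped k r x" by (rule dA[OF A(3)])
    finally show "\<bar>exp (- c * \<tau>) * (1/2 * damped2 k r x - c * damped k r x)\<bar> \<le> (A * (1 + 1 / k)) * exp (- \<bar>r\<bar> * \<bar>x\<bar>)"
      by (intro * t)
  qed (use r in auto)
qed

lemma damped_super:
  assumes c: "c = 1 + r ^ 2 / 2"
  shows "exp (- c * \<tau>) * (1/2 * damped2 k r x - c * damped k r x) + exp (- c * \<tau>) * damped k r x \<le> 0"
proof -
  have "1/2 * damped2 k r x - c * damped k r x + damped k r x \<le> 0"
    using damped_derivs_bound(2)[of x] by (simp add: c algebra_simps)
  then have "exp (- c * \<tau>) * (1/2 * damped2 k r x - c * damped k r x + damped k r x) \<le> 0"
    by (intro mult_nonneg_nonpos) auto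
  then show ?thesis by (simp add: algebra_simps)
qed

end

lemma damped_SUP:
  "incseq (\<lambda>n. damped (1 / real (Suc n)) r x)" "(\<lambda>n. damped (1 / real (Suc n)) r x) \<longlonglongrightarrow> exp (r * x)"
proof -
  show "incseq (\<lambda>n. damped (1 / real (Suc n)) r x)"
  proof (rule monoI)
    fix n m :: nat assume "n \<le> m"
    then show "damped (1 / real (Suc n)) r x \<le> damped (1 / real (Suc m)) r x"
      unfolding damped_def
      by (intro divide_left_mono add_left_mono mult_right_mono mult_pos_pos damped_denom_pos) (auto simp: field_simps)
  qed
  have "(\<lambda>n. 1 / real (Suc n)) \<longlonglongrightarrow> 0" using LIMSEQ_inverse_real_of_nat by (simp add: inverse_eq_divide)
  then have "(\<lambda>n. 1 / (exp (- r * x) + 1 / real (Suc n) * exp (r * x))) \<longlonglongrightarrow> 1 / (exp (- r * x) + 0 * exp (r * x))"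
    by (intro tendsto_intros) auto
  then show "(\<lambda>n. damped (1 / real (Suc n)) r x) \<longlonglongrightarrow> exp (r * x)"
    by (simp add: damped_def exp_minus inverse_eq_divide)
qed

text \<open>\<open>c\<close> is the rate for which \<open>q + p = 0\<close>, so that the bulk term
  of the weak identity drops out.\<close>

lemma exp_test:
  assumes c: "c = 1 + r ^ 2 / 2"
  shows "test_fun (\<lambda>\<tau> x. exp (- c * \<tau>) * exp (r * x)) (\<lambda>\<tau> x. r * (exp (- c * \<tau>) * exp (r * x)))
     (\<lambda>\<tau> x. - (exp (- c * \<tau>) * exp (r * x)))"
proof -
  have 1: "((\<lambda>x. exp (r * x)) has_real_derivative r * exp (r * x)) (at x)"
    "((\<lambda>x. r * exp (r * x)) has_real_derivative r ^ 2 * exp (r * x)) (at x)"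
    "isCont (\<lambda>x. r ^ 2 * exp (r * x)) x" for x
    by (auto intro!: derivative_eq_intros continuous_intros simp: power2_eq_square)
  have "- c * exp (- c * \<tau>) * exp (r * x) + 0 * (r * exp (r * x)) + 1/2 * (exp (- c * \<tau>) * (r ^ 2 * exp (r * x))) =
    - (exp (- c * \<tau>) * exp (r * x))" for \<tau> x
    by (simp add: c distrib_right mult.assoc[symmetric] add_divide_distrib) (simp add: algebra_simps)
  then show ?thesis
    using test_fun_mult[OF test_fun_exp_time[of c] 1] by (simp add: mult_ac)
qed

lemma exp_decaying:
  assumes r: "r < 0" and c: "c > 0" and s: "s > 0"
  shows "decaying s t (\<lambda>\<tau> x. exp (- c * \<tau>) * exp (r * x)) (\<lambda>\<tau> x. r * (exp (- c * \<tau>) * exp (r * x)))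
     (\<lambda>\<tau> x. - (exp (- c * \<tau>) * exp (r * x)))"
proof -
  have b: "exp (- c * \<tau>) * exp (r * x) \<le> 1 * exp (- (- r) * x)" if "\<tau> \<in> {s..t}" for \<tau> x
    using that c s by (intro mult_mono) (auto simp: mult_nonneg_nonneg)
  show ?thesis unfolding decaying_def
  proof (rule exI[of _ "1 + \<bar>r\<bar>"], rule exI[of _ "- r"], intro conjI ballI allI impI)
    fix \<tau> x :: real assume t: "\<tau> \<in> {s..t}" "x \<ge> 0"
    have *: "\<bar>a * (exp (- c * \<tau>) * exp (r * x))\<bar> \<le> (1 + \<bar>r\<bar>) * exp (- (- r) * x)" if "\<bar>a\<bar> \<le> 1 + \<bar>r\<bar>" for a
      unfolding abs_mult[of a] using mult_mono[OF that b[OF t(1), of x]] by simp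
    show "\<bar>exp (- c * \<tau>) * exp (r * x)\<bar> \<le> (1 + \<bar>r\<bar>) * exp (- (- r) * x)" using *[of 1] by simp
    show "\<bar>r * (exp (- c * \<tau>) * exp (r * x))\<bar> \<le> (1 + \<bar>r\<bar>) * exp (- (- r) * x)" using *[of r] by simp
    show "\<bar>- (exp (- c * \<tau>) * exp (r * x))\<bar> \<le> (1 + \<bar>r\<bar>) * exp (- (- r) * x)" using *[of "-1"] by simp
  qed (use r in simp)
qed

text \<open>On a large interval \<open>h\<close> is bounded by \<open>C\<close> and local
  convergence applies; outside, the two functions differ by at most 1 and the tail of the
  exponential majorant is below \<open>e / 2\<close>.\<close>

lemma L1_loc_limit:
  fixes V :: "real \<Rightarrow> real \<Rightarrow> real"
  assumes L1: "L1_loc_tendsto V V0 (at_right 0)"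
    and V: "\<And>t x. t > 0 \<Longrightarrow> 0 \<le> V t x \<and> V t x \<le> 1" "\<And>t. t > 0 \<Longrightarrow> V t \<in> borel_measurable borel"
    and V0: "\<And>x. 0 \<le> V0 x \<and> V0 x \<le> 1" "V0 \<in> borel_measurable borel"
    and h: "h \<in> borel_measurable borel" "l > 0" "\<And>x. \<bar>h x\<bar> \<le> C * exp (- l * \<bar>x\<bar>)"
  shows "((\<lambda>t. LINT x|lborel. V t x * h x) \<longlongrightarrow> (LINT x|lborel. V0 x * h x)) (at_right 0)"
proof (rule tendstoI)
  fix e :: real assume e: "e > 0"
  let ?e = "\<lambda>x. C * exp (- l * \<bar>x\<bar>)"
  let ?K = "\<lambda>n. {- real n..real n}"
  have C: "C \<ge> 0" using h(3)[of 0] by simp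
  have ie: "integrable lborel ?e" by (intro integrable_mult_right exp_abs_integrable h)
  have iV: "integrable lborel (\<lambda>x. v x * h x)" if "v \<in> borel_measurable borel" "\<And>x. \<bar>v x\<bar> \<le> 1" for v
  proof (rule Bochner_Integration.integrable_bound[OF ie])
    show "(\<lambda>x. v x * h x) \<in> borel_measurable lborel" using that(1) h(1) by simp
    have "\<bar>v x * h x\<bar> \<le> 1 * ?e x" for x
      unfolding abs_mult using that(2)[of x] h(3)[of x] by (intro mult_mono) auto
    then show "AE x in lborel. norm (v x * h x) \<le> norm (?e x)"
      using C by (intro AE_I2) (simp add: abs_mult)
  qed
  have "(\<lambda>n. LINT x:?K n|lborel. ?e x) \<longlonglongrightarrow> (LINT x:UNIV|lborel. ?e x)"
  proof (rule lim_indicator_strip)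
    show "set_integrable lborel UNIV ?e" using ie by (simp add: set_integrable_def)
    show "\<forall>\<^sub>F n in sequentially. x \<in> ?K n" for x
    proof -
      have "\<forall>\<^sub>F n in sequentially. \<bar>x\<bar> \<le> real n"
        using filterlim_real_sequentially by (auto simp: filterlim_at_top)
      then show ?thesis by eventually_elim auto
    qed
  qed auto
  then have "\<forall>\<^sub>F n in sequentially. dist (LINT x:?K n|lborel. ?e x) (LINT x:UNIV|lborel. ?e x) < e / 2"
    using e by (intro tendstoD) auto
  then obtain n where n: "\<bar>(LINT x:?K n|lborel. ?e x) - (LINT x:UNIV|lborel. ?e x)\<bar> < e / 2"
    by (auto simp: eventually_sequentially dist_real_def)
  define N where "N t = (LINT x:?K n|lborel. \<bar>V t x - V0 x\<bar>)" for t
  have "((\<lambda>t. \<integral>\<^sup>+ x \<in> ?K n. ennreal \<bar>V t x - V0 x\<bar> \<partial>lborel) \<longlongrightarrow> 0) (at_right 0)"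
    using L1 unfolding L1_loc_tendsto_def by blast
  then have "((\<lambda>t. enn2real (\<integral>\<^sup>+ x \<in> ?K n. ennreal \<bar>V t x - V0 x\<bar> \<partial>lborel)) \<longlongrightarrow> 0) (at_right 0)"
    by (intro tendsto_enn2real) auto
  moreover have pos: "\<forall>\<^sub>F t in at_right (0 :: real). t > 0" by (rule eventually_at_right_less)
  then have "\<forall>\<^sub>F t in at_right 0. enn2real (\<integral>\<^sup>+ x \<in> ?K n. ennreal \<bar>V t x - V0 x\<bar> \<partial>lborel) = N t"
  proof eventually_elim
    case (elim t)
    have "N t = enn2real (\<integral>\<^sup>+ x. ennreal (indicator (?K n) x * \<bar>V t x - V0 x\<bar>) \<partial>lborel)"
      unfolding N_def set_lebesgue_integral_def using V(2)[OF elim] V0(2)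
      by (subst integral_eq_nn_integral) auto
    then show ?case by (simp add: ennreal_mult' ennreal_indicator mult.commute)
  qed
  ultimately have "(N \<longlongrightarrow> 0) (at_right 0)" by (rule Lim_transform_eventually)
  then have "((\<lambda>t. C * N t) \<longlongrightarrow> C * 0) (at_right 0)" by (intro tendsto_intros)
  then have "\<forall>\<^sub>F t in at_right 0. C * N t < e / 2"
    using e by (intro order_tendstoD(2)) auto
  with pos show "\<forall>\<^sub>F t in at_right 0. dist (LINT x|lborel. V t x * h x) (LINT x|lborel. V0 x * h x) < e"
  proof eventually_elim
    case (elim t)
    let ?d = "\<lambda>x. V t x - V0 x"
    have d1: "\<bar>?d x\<bar> \<le> 1" for x using V(1)[OF elim(1), of x] V0(1)[of x] by auto
    have md: "?d \<in> borel_measurable borel" using V(2)[OF elim(1)] V0(2) by simp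
    have iK: "integrable lborel (\<lambda>x. indicator (?K n) x *\<^sub>R \<bar>?d x\<bar>)"
    proof (rule Bochner_Integration.integrable_bound[where f = "\<lambda>x. indicator (?K n) x :: real"])
      show "integrable lborel (\<lambda>x. indicator (?K n) x :: real)"
        using emeasure_lborel_Icc_eq[of "- real n" "real n"] by (intro integrable_real_indicator) (auto split: if_splits)
      show "AE x in lborel. norm (indicator (?K n) x *\<^sub>R \<bar>?d x\<bar>) \<le> norm (indicator (?K n) x :: real)"
        using d1 by (intro AE_I2) (auto simp: indicator_def)
    qed (use md in auto)
    have iR: "integrable lborel (\<lambda>x. indicator (?K n) x *\<^sub>R ?e x)"
      using ie by (intro integrable_scaleR_left integrable_mult_indicator) auto
    have "(LINT x|lborel. V t x * h x) - (LINT x|lborel. V0 x * h x) = (LINT x|lborel. ?d x * h x)"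
      using V(2)[OF elim(1)] V0(2) V(1)[OF elim(1)] V0(1)
      unfolding left_diff_distrib by (intro Bochner_Integration.integral_diff[symmetric] iV) auto
    then have "\<bar>(LINT x|lborel. V t x * h x) - (LINT x|lborel. V0 x * h x)\<bar> \<le> (LINT x|lborel. \<bar>?d x * h x\<bar>)"
      using integral_norm_bound[of lborel "\<lambda>x. ?d x * h x"] by simp
    also have "\<dots> \<le> (LINT x|lborel. C * (indicator (?K n) x *\<^sub>R \<bar>?d x\<bar>) + (?e x - indicator (?K n) x *\<^sub>R ?e x))"
    proof (intro integral_mono Bochner_Integration.integrable_add Bochner_Integration.integrable_diff ie iR integrable_mult_right iK)
      show "integrable lborel (\<lambda>x. \<bar>?d x * h x\<bar>)" using iV[OF md d1] by (rule integrable_abs)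
      fix x
      have "\<bar>?d x * h x\<bar> \<le> \<bar>?d x\<bar> * ?e x"
        unfolding abs_mult using h(3)[of x] by (intro mult_left_mono) auto
      moreover have "\<bar>?d x\<bar> * ?e x \<le> 1 * ?e x" using d1[of x] C by (intro mult_right_mono) auto
      moreover have "\<bar>?d x\<bar> * ?e x \<le> \<bar>?d x\<bar> * C"
        using C h(2) by (intro mult_left_mono mult_left_le) auto
      ultimately show "\<bar>?d x * h x\<bar> \<le> C * (indicator (?K n) x *\<^sub>R \<bar>?d x\<bar>) + (?e x - indicator (?K n) x *\<^sub>R ?e x)"
        by (cases "x \<in> ?K n") (auto simp: mult.commute)
    qed
    also have "\<dots> = C * N t + ((LINT x|lborel. ?e x) - (LINT x:?K n|lborel. ?e x))"
      unfolding N_def set_lebesgue_integral_def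
      by (subst Bochner_Integration.integral_add[OF integrable_mult_right[OF iK] Bochner_Integration.integrable_diff[OF ie iR]],
          subst Bochner_Integration.integral_diff[OF ie iR], subst integral_mult_right_zero, rule refl)
    also have "\<dots> < e / 2 + e / 2"
    proof (rule add_strict_mono[OF elim(2)])
      show "(LINT x|lborel. ?e x) - (LINT x:?K n|lborel. ?e x) < e / 2"
      proof -
        have "(LINT x:UNIV|lborel. ?e x) = (LINT x|lborel. ?e x)"
          unfolding set_lebesgue_integral_def by (simp only: indicator_UNIV scaleR_one)
        then show ?thesis using n by linarith
      qed
    qed
    finally show ?case by (simp add: dist_real_def)
  qed
qed

lemma nn_integral_exp_right:
  assumes "r < (0::real)"
  shows "(\<integral>\<^sup>+x. ennreal (exp (r * x)) * indicator {m<..} x \<partial>lborel) = ennreal (exp (r * m) / \<bar>r\<bar>)"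
proof -
  have "(\<integral>\<^sup>+x. ennreal (exp (r * x)) * indicator {m<..} x \<partial>lborel) = (\<integral>\<^sup>+x. ennreal (indicator {m..} x * exp (- (- r) * x)) \<partial>lborel)"
    by (intro nn_integral_cong_AE eventually_mono[OF AE_lborel_singleton[of m]]) (auto simp: indicator_def)
  also have "\<dots> = ennreal (exp (- (- r) * m) / (- r))"
    by (rule nn_integral_has_integral_lebesgue[OF _ has_integral_exp_minus_to_infinity]) (use assms in auto)
  finally show ?thesis using assms by simp
qed

lemma nn_integral_exp_left:
  assumes "r > (0::real)"
  shows "(\<integral>\<^sup>+x. ennreal (exp (r * x)) * indicator {..m} x \<partial>lborel) = ennreal (exp (r * m) / \<bar>r\<bar>)"
proof -
  have "(\<integral>\<^sup>+x. ennreal (exp (r * x)) * indicator {..m} x \<partial>lborel) =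
     (\<integral>\<^sup>+x. ennreal (exp (r * (0 + (-1) * x))) * indicator {..m} (0 + (-1) * x) \<partial>lborel)"
    by (subst nn_integral_real_affine[where c = "-1" and t = 0]) auto
  also have "\<dots> = (\<integral>\<^sup>+x. ennreal (indicator {- m..} x * exp (- r * x)) \<partial>lborel)"
    by (intro nn_integral_cong) (auto simp: indicator_def)
  also have "\<dots> = ennreal (exp (- r * (- m)) / r)"
    by (rule nn_integral_has_integral_lebesgue[OF _ has_integral_exp_minus_to_infinity]) (use assms in auto)
  finally show ?thesis using assms by simp
qed

section \<open>The front integral as an integral over one side of the graph\<close>

context contact_problem
begin

definition front_integral :: "real \<Rightarrow> ennreal" where
  "front_integral r = (\<integral>\<^sup>+t\<in>{0<..}. ennreal (exp (r * L t - (1 + r ^ 2 / 2) * t)) \<partial>lborel)"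

lemma front_meas: "(\<lambda>t. ennreal (exp (r * L t - c * t)) * indicator {0<..} t) \<in> borel_measurable borel"
proof -
  have "(\<lambda>t. indicator {0<..} t *\<^sub>R exp (r * L t - c * t)) \<in> borel_measurable borel"
    by (intro borel_measurable_continuous_on_indicator continuous_intros cont_L) auto
  then have "(\<lambda>t. ennreal (indicator {0<..} t *\<^sub>R exp (r * L t - c * t))) \<in> borel_measurable borel" by measurable
  moreover have "(\<lambda>t. ennreal (indicator {0<..} t *\<^sub>R exp (r * L t - c * t))) = (\<lambda>t. ennreal (exp (r * L t - c * t)) * indicator {0<..} t)"
    by (auto simp: fun_eq_iff indicator_def)
  ultimately show ?thesis by (simp only:)
qed

text \<open>Tonelli with the space integral inside. This is how the front integral arises from the
  weak identities: integrating \<open>exp (r * x)\<close> from the boundary outwards produces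
  \<open>exp (r * L \<tau>) / \<bar>r\<bar>\<close>.\<close>

lemma region_total:
  assumes A: "A \<in> sets borel" "\<And>z. z \<in> A \<Longrightarrow> fst z > 0"
    and inner: "\<And>\<tau>. \<tau> > 0 \<Longrightarrow> (\<integral>\<^sup>+x. ennreal (exp (r * x)) * indicator A (\<tau>, x) \<partial>lborel) = ennreal (exp (r * L \<tau>) / \<bar>r\<bar>)"
    and c: "c = 1 + r ^ 2 / 2"
  shows "(\<integral>\<^sup>+z. ennreal (exp (- c * fst z) * exp (r * snd z)) * indicator A z \<partial>lborel) = ennreal (1 / \<bar>r\<bar>) * front_integral r"
proof -
  let ?f = "\<lambda>z :: real \<times> real. ennreal (exp (- c * fst z) * exp (r * snd z)) * indicator A z"
  have "continuous_on UNIV (\<lambda>z :: real \<times> real. exp (- c * fst z) * exp (r * snd z))"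
    by (intro continuous_intros)
  then have "(\<lambda>z :: real \<times> real. exp (- c * fst z) * exp (r * snd z)) \<in> borel_measurable borel"
    by (rule borel_measurable_continuous_onI)
  then have f: "?f \<in> borel_measurable (lborel \<Otimes>\<^sub>M lborel)"
    using A(1) by (simp add: lborel_prod)
  have in1: "(\<integral>\<^sup>+x. ?f (\<tau>, x) \<partial>lborel) = ennreal (1 / \<bar>r\<bar>) * (ennreal (exp (r * L \<tau> - c * \<tau>)) * indicator {0<..} \<tau>)" for \<tau>
  proof (cases "\<tau> > 0")
    case True
    have m: "(\<lambda>x. ennreal (exp (r * x)) * indicator A (\<tau>, x)) \<in> borel_measurable lborel"
    proof -
      have "(\<lambda>x. (\<tau>, x)) \<in> borel \<rightarrow>\<^sub>M borel" 
        by (intro borel_measurable_continuous_onI continuous_intros)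
      then have "(\<lambda>x. indicator A (\<tau>, x) :: ennreal) \<in> borel_measurable borel"
        by (rule measurable_compose) (use A(1) in simp)
      then show ?thesis by measurable
    qed
    have "(\<integral>\<^sup>+x. ?f (\<tau>, x) \<partial>lborel) = (\<integral>\<^sup>+x. ennreal (exp (- c * \<tau>)) * (ennreal (exp (r * x)) * indicator A (\<tau>, x)) \<partial>lborel)"
      by (simp add: ennreal_mult mult.assoc)
    also have "\<dots> = ennreal (exp (- c * \<tau>)) * ennreal (exp (r * L \<tau>) / \<bar>r\<bar>)"
      by (subst nn_integral_cmult[OF m]) (simp add: inner[OF True])
    also have "\<dots> = ennreal (1 / \<bar>r\<bar>) * ennreal (exp (r * L \<tau> - c * \<tau>))"
      by (subst (1 2) ennreal_mult[symmetric]) (auto simp: exp_diff exp_minus field_simps)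
    finally show ?thesis using True by simp
  next
    case False
    then have "?f (\<tau>, x) = 0" for x using A(2)[of "(\<tau>, x)"] by (auto simp: indicator_def)
    then show ?thesis using False by simp
  qed
  have "(\<integral>\<^sup>+z. ?f z \<partial>lborel) = (\<integral>\<^sup>+\<tau>. \<integral>\<^sup>+x. ?f (\<tau>, x) \<partial>lborel \<partial>lborel)"
    using lborel.nn_integral_fst[OF f] by (simp add: lborel_prod)
  also have "\<dots> = ennreal (1 / \<bar>r\<bar>) * front_integral r"
    unfolding in1 front_integral_def c[symmetric] using front_meas by (intro nn_integral_cmult) simp
  finally show ?thesis .
qed

definition left_region :: "(real \<times> real) set" where "left_region = {z. fst z > 0 \<and> snd z \<le> L (fst z)}"

lemma borel_regions: "D \<in> sets borel" "left_region \<in> sets borel"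
proof -
  show D: "D \<in> sets borel" by (intro borel_open open_D)
  have "left_region = ({0<..} \<times> UNIV) - D" by (auto simp: left_region_def D_def)
  moreover have "{0<..} \<times> UNIV \<in> sets (borel :: (real \<times> real) measure)" by (intro borel_open open_Times) auto
  ultimately show "left_region \<in> sets borel" using D by simp
qed

lemma region_total_right:
  assumes "r < 0" "c = 1 + r ^ 2 / 2"
  shows "(\<integral>\<^sup>+z. ennreal (exp (- c * fst z) * exp (r * snd z)) * indicator D z \<partial>lborel) = ennreal (1 / \<bar>r\<bar>) * front_integral r"
proof (rule region_total[OF borel_regions(1) _ _ assms(2)])
  fix \<tau> :: real assume "\<tau> > 0"
  then have "indicator D (\<tau>, x) = (indicator {L \<tau><..} x :: ennreal)" for x by (auto simp: D_def indicator_def)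
  then show "(\<integral>\<^sup>+x. ennreal (exp (r * x)) * indicator D (\<tau>, x) \<partial>lborel) = ennreal (exp (r * L \<tau>) / \<bar>r\<bar>)"
    using nn_integral_exp_right[OF assms(1)] by simp
qed (simp add: D_def)

lemma region_total_left:
  assumes "r > 0" "c = 1 + r ^ 2 / 2"
  shows "(\<integral>\<^sup>+z. ennreal (exp (- c * fst z) * exp (r * snd z)) * indicator left_region z \<partial>lborel) = ennreal (1 / \<bar>r\<bar>) * front_integral r"
proof (rule region_total[OF borel_regions(2) _ _ assms(2)])
  fix \<tau> :: real assume "\<tau> > 0"
  then have "indicator left_region (\<tau>, x) = (indicator {..L \<tau>} x :: ennreal)" for x by (auto simp: left_region_def indicator_def)
  then show "(\<integral>\<^sup>+x. ennreal (exp (r * x)) * indicator left_region (\<tau>, x) \<partial>lborel) = ennreal (exp (r * L \<tau>) / \<bar>r\<bar>)"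
    using nn_integral_exp_left[OF assms(1)] by simp
qed (simp add: left_region_def)

lemma strip_le_region:
  assumes A: "A \<in> sets borel"
    and i: "set_integrable lborel (strip s t) (\<lambda>z. if z \<in> A then f z else 0)"
    and f: "\<And>z. 0 \<le> f z" "\<And>z. f z \<le> g z"
  shows "ennreal (LINT z:(strip s t)|lborel. if z \<in> A then f z else 0) \<le> (\<integral>\<^sup>+z. ennreal (g z) * indicator A z \<partial>lborel)"
proof -
  have "ennreal (LINT z:(strip s t)|lborel. if z \<in> A then f z else 0) =
    (\<integral>\<^sup>+z. ennreal (indicator (strip s t) z *\<^sub>R (if z \<in> A then f z else 0)) \<partial>lborel)"
    unfolding set_lebesgue_integral_def
    by (rule nn_integral_eq_integral[symmetric]) (use i f in \<open>auto simp: set_integrable_def\<close>)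
  also have "\<dots> \<le> (\<integral>\<^sup>+z. ennreal (g z) * indicator A z \<partial>lborel)"
    by (intro nn_integral_mono) (auto simp: indicator_def f intro!: ennreal_leI)
  finally show ?thesis .
qed

text \<open>Common to both signs of \<open>r\<close>: \<open>V\<close> stands for \<open>W\<close>
  with \<open>A\<close> right of the graph, or for \<open>1 - W\<close> with \<open>A\<close> left
  of it. First the initial time tends to 0 at fixed damping, then damping and strip are released
  together by monotone convergence.\<close>

lemma lower_half:
  fixes V :: "real \<Rightarrow> real \<Rightarrow> real"
  assumes c: "c > 0"
    and V: "\<And>t x. t > 0 \<Longrightarrow> V t x \<ge> 0" "\<And>x. V0 x \<ge> 0" "V0 \<in> borel_measurable borel"
    and lim: "\<And>k. k > 0 \<Longrightarrow> ((\<lambda>s. LINT x|lborel. V s x * damped k r x) \<longlongrightarrow> (LINT x|lborel. V0 x * damped k r x)) (at_right 0)"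
    and int: "\<And>k. k > 0 \<Longrightarrow> integrable lborel (\<lambda>x. V0 x * damped k r x)"
    and A: "A \<in> sets borel" "\<And>z. z \<in> A \<Longrightarrow> fst z > 0"
    and si: "\<And>k s t. k > 0 \<Longrightarrow> 0 < s \<Longrightarrow> s \<le> t \<Longrightarrow>
      set_integrable lborel (strip s t) (\<lambda>z. if z \<in> A then exp (- c * fst z) * damped k r (snd z) else 0)"
    and sup: "\<And>k s t. k > 0 \<Longrightarrow> 0 < s \<Longrightarrow> s \<le> t \<Longrightarrow>
      (LINT z:(strip s t)|lborel. if z \<in> A then exp (- c * fst z) * damped k r (snd z) else 0) \<le>
      (LINT x|lborel. V s x * (exp (- c * s) * damped k r x))"
  shows "(\<integral>\<^sup>+z. ennreal (exp (- c * fst z) * exp (r * snd z)) * indicator A z \<partial>lborel) \<le> (\<integral>\<^sup>+x. ennreal (V0 x * exp (r * x)) \<partial>lborel)"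
proof -
  let ?p = "\<lambda>k z. exp (- c * fst z) * damped k r (snd z)"
  have step: "ennreal (LINT z:(strip s t)|lborel. if z \<in> A then ?p k z else 0) \<le> (\<integral>\<^sup>+x. ennreal (V0 x * exp (r * x)) \<partial>lborel)"
    if k: "k > 0" and st: "0 < s" "s \<le> t" for k s t
  proof -
    have "(LINT z:(strip s t)|lborel. if z \<in> A then ?p k z else 0) \<le> (LINT x|lborel. V0 x * damped k r x)"
    proof (rule tendsto_lowerbound[OF lim[OF k]])
      have "\<forall>\<^sub>F u in at_right 0. u \<in> {0<..<s}" using st(1) by (rule eventually_at_right_real)
      then show "\<forall>\<^sub>F u in at_right 0. (LINT z:(strip s t)|lborel. if z \<in> A then ?p k z else 0) \<le> (LINT x|lborel. V u x * damped k r x)"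
      proof eventually_elim
        case (elim u)
        then have u: "0 < u" "u \<le> s" "u \<le> t" using st by auto
        \<comment> \<open>The strip on the left stays fixed while the slice time \<open>u\<close>
          tends to 0; positivity allows the enlargement down to \<open>u\<close>.\<close>
        have "(LINT z:(strip s t)|lborel. if z \<in> A then ?p k z else 0) \<le> (LINT z:(strip u t)|lborel. if z \<in> A then ?p k z else 0)"
          unfolding set_lebesgue_integral_def
          using si[OF k st] si[OF k u(1,3)] u damped_pos[OF k, THEN less_imp_le]
          by (intro integral_mono) (auto simp: set_integrable_def indicator_def)
        also have "\<dots> \<le> (LINT x|lborel. V u x * (exp (- c * u) * damped k r x))" by (rule sup[OF k u(1,3)])
        also have "\<dots> = exp (- c * u) * (LINT x|lborel. V u x * damped k r x)"
          by (subst integral_mult_right_zero[symmetric]) (simp add: mult_ac)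
        also have "\<dots> \<le> 1 * (LINT x|lborel. V u x * damped k r x)"
          using c u V(1)[OF u(1)] damped_pos[OF k, THEN less_imp_le]
          by (intro mult_right_mono integral_nonneg_AE AE_I2 mult_nonneg_nonneg) auto
        finally show ?case by simp
      qed
    qed simp
    then have "ennreal (LINT z:(strip s t)|lborel. if z \<in> A then ?p k z else 0) \<le> ennreal (LINT x|lborel. V0 x * damped k r x)"
      by (rule ennreal_leI)
    also have "\<dots> = (\<integral>\<^sup>+x. ennreal (V0 x * damped k r x) \<partial>lborel)"
      using V(2) damped_pos[OF k, THEN less_imp_le] by (intro nn_integral_eq_integral[symmetric] int k) auto
    also have "\<dots> \<le> (\<integral>\<^sup>+x. ennreal (V0 x * exp (r * x)) \<partial>lborel)"
      by (intro nn_integral_mono ennreal_leI mult_left_mono damped_le_exp k V)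
    finally show ?thesis .
  qed
  \<comment> \<open>One index drives everything: \<open>a n\<close> is both the damping parameter
    and the initial time of the strip, \<open>b n\<close> its final time.\<close>
  define a b where "a n = 1 / real (Suc n)" and "b n = real (Suc n)" for n
  have ab: "a n > 0" "a n \<le> b n" for n
  proof -
    have "a n \<le> 1" "1 \<le> b n" by (auto simp: a_def b_def)
    then show "a n \<le> b n" by linarith
  qed (simp add: a_def)
  have amono: "a m \<le> a n" "b n \<le> b m" if "n \<le> m" for n m using that by (auto simp: a_def b_def field_simps)
  define f where "f n z = ennreal (indicator (strip (a n) (b n)) z *\<^sub>R (if z \<in> A then ?p (a n) z else 0))" for n z
  have f_int: "(\<integral>\<^sup>+z. f n z \<partial>lborel) = ennreal (LINT z:(strip (a n) (b n))|lborel. if z \<in> A then ?p (a n) z else 0)" for n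
    unfolding f_def set_lebesgue_integral_def
    by (rule nn_integral_eq_integral) (use si[OF ab(1) ab(1) ab(2)] damped_pos[OF ab(1), THEN less_imp_le] in \<open>auto simp: set_integrable_def\<close>)
  have "(\<lambda>n. \<integral>\<^sup>+z. f n z \<partial>lborel) \<longlonglongrightarrow> (\<integral>\<^sup>+z. ennreal (exp (- c * fst z) * exp (r * snd z)) * indicator A z \<partial>lborel)"
  proof (rule nn_integral_LIMSEQ)
    show "incseq f"
    proof (intro monoI le_funI)
      fix n m :: nat and z :: "real \<times> real" assume nm: "n \<le> m"
      have "damped (a n) r (snd z) \<le> damped (a m) r (snd z)"
        using damped_SUP(1)[of r "snd z"] nm unfolding a_def mono_def by blast
      then show "f n z \<le> f m z"
        unfolding f_def using amono[OF nm] damped_pos[OF ab(1), THEN less_imp_le]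
        by (intro ennreal_leI) (auto simp: indicator_def)
    qed
    show "f n \<in> borel_measurable lborel" for n
    proof -
      have "(\<lambda>z. indicator (strip (a n) (b n)) z *\<^sub>R (if z \<in> A then ?p (a n) z else 0)) \<in> borel_measurable lborel"
        using si[OF ab(1) ab(1) ab(2)] unfolding set_integrable_def by (rule borel_measurable_integrable)
      then show ?thesis unfolding f_def by measurable
    qed
    fix z :: "real \<times> real"
    show "(\<lambda>n. f n z) \<longlonglongrightarrow> ennreal (exp (- c * fst z) * exp (r * snd z)) * indicator A z"
    proof (cases "z \<in> A")
      case True
      have "a \<longlonglongrightarrow> 0" unfolding a_def using LIMSEQ_inverse_real_of_nat by (simp add: inverse_eq_divide)
      then have "\<forall>\<^sub>F n in sequentially. a n < fst z" using A(2)[OF True] by (rule order_tendstoD)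
      moreover have "\<forall>\<^sub>F n in sequentially. fst z \<le> real n"
        using filterlim_real_sequentially by (auto simp: filterlim_at_top)
      ultimately have ev: "\<forall>\<^sub>F n in sequentially. ennreal (?p (a n) z) = f n z"
        by eventually_elim (use True in \<open>cases z, auto simp: f_def b_def\<close>)
      have "(\<lambda>n. ennreal (?p (a n) z)) \<longlonglongrightarrow> ennreal (exp (- c * fst z) * exp (r * snd z))"
        unfolding a_def by (intro tendsto_ennrealI tendsto_intros damped_SUP(2))
      from Lim_transform_eventually[OF this ev] show ?thesis using True by simp
    next
      case False
      then have "f n z = 0" for n by (simp add: f_def)
      then show ?thesis using False by simp
    qed
  qed
  then show ?thesis
    by (rule LIMSEQ_le_const2) (use step[OF ab(1) ab(1) ab(2)] f_int in auto)
qed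

end

text \<open>\<open>exp (r x - c \<tau>) exp (- z)\<close> is a subsolution if \<open>exp (r x - c \<tau>) z\<close> is a solution, because
  \<open>exp (- z)\<close> is convex in \<open>z\<close>; here \<open>z = A exp (\<delta> x - \<gamma> \<tau>)\<close>.\<close>

definition gumbel :: "real \<Rightarrow> real \<Rightarrow> real \<Rightarrow> real \<Rightarrow> real \<Rightarrow> real \<Rightarrow> real \<Rightarrow> real" where
  "gumbel A r c \<delta> \<gamma> \<tau> x = exp (r * x - c * \<tau> - A * exp (\<delta> * x - \<gamma> * \<tau>))"

text \<open>\<open>\<gamma>\<close> is chosen such that
  \<open>c + \<gamma> = 1 + (r + \<delta>) ^ 2 / 2\<close>, which makes the exponential with rate
  \<open>r + \<delta>\<close> a solution too. With \<open>z\<close> the inner exponential term,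
  \<open>q + p\<close> is \<open>\<delta> ^ 2 * z ^ 2 / 2\<close> times the function, hence
  nonnegative.\<close>

lemma gumbel_test:
  assumes c: "c = 1 + r ^ 2 / 2" and \<gamma>: "\<gamma> = r * \<delta> + \<delta> ^ 2 / 2"
  shows "test_fun (gumbel A r c \<delta> \<gamma>) (\<lambda>\<tau> x. (r - \<delta> * (A * exp (\<delta> * x - \<gamma> * \<tau>))) * gumbel A r c \<delta> \<gamma> \<tau> x)
    (\<lambda>\<tau> x. (1/2 * \<delta> ^ 2 * (A * exp (\<delta> * x - \<gamma> * \<tau>)) ^ 2 - 1) * gumbel A r c \<delta> \<gamma> \<tau> x)"
proof -
  let ?z = "\<lambda>\<tau> x. A * exp (\<delta> * x - \<gamma> * \<tau>)"
  let ?p = "gumbel A r c \<delta> \<gamma>"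
  have t: "((\<lambda>s. ?p s x) has_real_derivative (- c + \<gamma> * ?z \<tau> x) * ?p \<tau> x) (at \<tau>)" for \<tau> x
    unfolding gumbel_def by (auto intro!: derivative_eq_intros simp: algebra_simps)
  have x: "(?p \<tau> has_real_derivative (r - \<delta> * ?z \<tau> x) * ?p \<tau> x) (at x)" for \<tau> x
    unfolding gumbel_def by (auto intro!: derivative_eq_intros simp: algebra_simps)
  have z: "((\<lambda>x. r - \<delta> * ?z \<tau> x) has_real_derivative - (\<delta> ^ 2 * ?z \<tau> x)) (at x)" for \<tau> x
    by (auto intro!: derivative_eq_intros simp: power2_eq_square)
  have xx: "((\<lambda>x. (r - \<delta> * ?z \<tau> x) * ?p \<tau> x) has_real_derivative ((r - \<delta> * ?z \<tau> x) ^ 2 - \<delta> ^ 2 * ?z \<tau> x) * ?p \<tau> x) (at x)" for \<tau> x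
    using DERIV_mult[OF z[of \<tau> x] x[of \<tau> x]] by (simp add: algebra_simps power2_eq_square)
  have cp: "continuous_on UNIV (\<lambda>z. ?p (fst z) (snd z))" unfolding gumbel_def by (intro continuous_intros)
  have q: "(1/2 * \<delta> ^ 2 * y ^ 2 - 1) * P = (- c + \<gamma> * y) * P + 1/2 * (((r - \<delta> * y) ^ 2 - \<delta> ^ 2 * y) * P)" for y P
  proof -
    have "1/2 * \<delta> ^ 2 * y ^ 2 - 1 = (- c + \<gamma> * y) + 1/2 * ((r - \<delta> * y) ^ 2 - \<delta> ^ 2 * y)"
      by (simp add: c \<gamma> power2_eq_square algebra_simps add_divide_distrib)
    then show ?thesis by (simp only: distrib_right mult.assoc)
  qed
  have ct: "continuous_on UNIV (\<lambda>z. (- c + \<gamma> * ?z (fst z) (snd z)) * ?p (fst z) (snd z))"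
    and cx: "continuous_on UNIV (\<lambda>z. (r - \<delta> * ?z (fst z) (snd z)) * ?p (fst z) (snd z))"
    and cxx: "continuous_on UNIV (\<lambda>z. ((r - \<delta> * ?z (fst z) (snd z)) ^ 2 - \<delta> ^ 2 * ?z (fst z) (snd z)) * ?p (fst z) (snd z))"
    by (intro continuous_intros cp)+
  show ?thesis unfolding test_fun_def
    by (rule exI[of _ "\<lambda>\<tau> x. (- c + \<gamma> * ?z \<tau> x) * ?p \<tau> x"], rule exI[of _ "\<lambda>\<tau> x. ((r - \<delta> * ?z \<tau> x) ^ 2 - \<delta> ^ 2 * ?z \<tau> x) * ?p \<tau> x"],
        intro conjI allI t x xx cp ct cx cxx)
      (rule q)
qed

text \<open>On the left \<open>exp (r * x)\<close> itself decays; on the right \<open>z\<close>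
  grows at least quadratically and completing the square suffices. Only half of \<open>z\<close> is
  spent, the other half being reserved for the polynomial prefactors of the derivatives.\<close>

lemma gumbel_tail:
  fixes r \<delta> a x z :: real
  assumes r: "r > 0" and \<delta>: "\<delta> > 0" and a: "a > 0" and z: "z \<ge> a * exp (\<delta> * x)"
  shows "exp (r * x - z / 2) \<le> exp ((r + 1) ^ 2 / (a * \<delta> ^ 2)) * exp (- min r 1 * \<bar>x\<bar>)"
proof -
  have "r * x - z / 2 \<le> (r + 1) ^ 2 / (a * \<delta> ^ 2) - min r 1 * \<bar>x\<bar>"
  proof (cases "x \<ge> 0")
    case True
    \<comment> \<open>Half of the quadratic lower bound for \<open>z\<close> is
      \<open>b * x ^ 2\<close>. Below, \<open>r + 1\<close> replaces \<open>r\<close> in order to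
      gain the decay \<open>exp (- x)\<close>.\<close>
    define b where "b = a * \<delta> ^ 2 / 4"
    have b: "b > 0" using a \<delta> by (simp add: b_def)
    have "(\<delta> * x) ^ 2 / 2 \<le> exp (\<delta> * x)"
      using exp_lower_Taylor_quadratic[of "\<delta> * x"] True \<delta> mult_nonneg_nonneg[of \<delta> x] by linarith
    then have "a * ((\<delta> * x) ^ 2 / 2) \<le> z" using z a by (meson mult_left_mono less_imp_le order_trans)
    then have 1: "r * x - z / 2 \<le> r * x - b * x ^ 2" by (simp add: b_def power_mult_distrib)
    have "0 \<le> (2 * b * x - (r + 1)) ^ 2" by simp
    then have "4 * b * ((r + 1) * x - b * x ^ 2) \<le> (r + 1) ^ 2" by (simp add: power2_eq_square algebra_simps)
    then have 2: "(r + 1) * x - b * x ^ 2 \<le> (r + 1) ^ 2 / (4 * b)" using b by (simp add: field_simps)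
    have 3: "min r 1 * \<bar>x\<bar> \<le> 1 * x" using True by (intro mult_mono) auto
    show ?thesis using 1 2 3 by (simp add: b_def algebra_simps)
  next
    case False
    have "0 \<le> a * exp (\<delta> * x)" using a by simp
    then have "z \<ge> 0" using z by linarith
    moreover have "min r 1 * \<bar>x\<bar> \<le> r * \<bar>x\<bar>" by (intro mult_right_mono) auto
    moreover have "0 \<le> (r + 1) ^ 2 / (a * \<delta> ^ 2)" using a by simp
    moreover have "r * \<bar>x\<bar> = - (r * x)" using False by simp
    ultimately show ?thesis by linarith
  qed
  then show ?thesis by (simp add: exp_add[symmetric])
qed

lemma gumbel_two_sided:
  assumes r: "r > 0" and \<delta>: "\<delta> > 0" and A: "A > 0" and c: "c > 0" and \<gamma>: "\<gamma> > 0" and s: "s \<ge> 0"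
  shows "two_sided s t (gumbel A r c \<delta> \<gamma>) (\<lambda>\<tau> x. (r - \<delta> * (A * exp (\<delta> * x - \<gamma> * \<tau>))) * gumbel A r c \<delta> \<gamma> \<tau> x)
    (\<lambda>\<tau> x. (1/2 * \<delta> ^ 2 * (A * exp (\<delta> * x - \<gamma> * \<tau>)) ^ 2 - 1) * gumbel A r c \<delta> \<gamma> \<tau> x)"
proof -
  \<comment> \<open>The smallest coefficient of \<open>exp (\<delta> * x)\<close> over the time
    interval, so that the tail estimate is uniform in time.\<close>
  define a where "a = A * exp (- \<gamma> * t)"
  have a: "a > 0" using A by (simp add: a_def)
  define K where "K = 1 + r + \<delta> + \<delta> ^ 2"
  define E where "E = exp ((r + 1) ^ 2 / (a * \<delta> ^ 2))"
  have *: "\<bar>k * gumbel A r c \<delta> \<gamma> \<tau> x\<bar> \<le> (8 * K * E) * exp (- min r 1 * \<bar>x\<bar>)"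
    if \<tau>: "\<tau> \<in> {s..t}" and k: "\<bar>k\<bar> \<le> K * (1 + A * exp (\<delta> * x - \<gamma> * \<tau>)) ^ 2" for k \<tau> x
  proof -
    define z where "z = A * exp (\<delta> * x - \<gamma> * \<tau>)"
    have z0: "z \<ge> 0" using A by (simp add: z_def)
    have "a * exp (\<delta> * x) = A * exp (\<delta> * x - \<gamma> * t)" by (simp add: a_def exp_diff exp_minus field_simps)
    also have "\<dots> \<le> z" unfolding z_def using A \<gamma> \<tau> by (intro mult_left_mono) auto
    finally have z: "z \<ge> a * exp (\<delta> * x)" .
    \<comment> \<open>All prefactors are at most quadratic in \<open>z\<close>. The constant 8
      matches the coefficient of \<open>z ^ 2\<close> in the Taylor polynomial of
      \<open>exp (z / 2)\<close>.\<close>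
    have "(1 + z) ^ 2 \<le> 8 * (1 + z / 2 + (z / 2) ^ 2 / 2)" using z0 by (simp add: power2_eq_square algebra_simps)
    also have "\<dots> \<le> 8 * exp (z / 2)" using exp_lower_Taylor_quadratic[of "z / 2"] z0 by simp
    finally have "(1 + z) ^ 2 * exp (- z) \<le> 8 * exp (z / 2) * exp (- z)" by (intro mult_right_mono) auto
    also have "\<dots> = 8 * exp (- z / 2)" by (simp add: exp_add[symmetric])
    finally have poly: "(1 + z) ^ 2 * exp (- z) \<le> 8 * exp (- z / 2)" .
    have K0: "K \<ge> 0" using r \<delta> by (simp add: K_def)
    have "gumbel A r c \<delta> \<gamma> \<tau> x = exp (- c * \<tau>) * (exp (r * x) * exp (- z))"
      by (simp add: gumbel_def z_def exp_add[symmetric])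
    also have "\<dots> \<le> 1 * (exp (r * x) * exp (- z))"
      using c s \<tau> by (intro mult_right_mono) (auto simp: mult_nonneg_nonneg)
    finally have g: "gumbel A r c \<delta> \<gamma> \<tau> x \<le> exp (r * x) * exp (- z)" by simp
    have "\<bar>k * gumbel A r c \<delta> \<gamma> \<tau> x\<bar> = \<bar>k\<bar> * gumbel A r c \<delta> \<gamma> \<tau> x" by (simp add: abs_mult gumbel_def)
    also have "\<dots> \<le> (K * (1 + z) ^ 2) * (exp (r * x) * exp (- z))"
      using k g K0 by (intro mult_mono) (auto simp: z_def gumbel_def)
    also have "\<dots> = K * exp (r * x) * ((1 + z) ^ 2 * exp (- z))" by (simp add: mult_ac)
    also have "\<dots> \<le> K * exp (r * x) * (8 * exp (- z / 2))"
      using poly K0 by (intro mult_left_mono) auto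
    also have "K * exp (r * x) * (8 * exp (- z / 2)) = 8 * K * exp (r * x - z / 2)"
    proof -
      have "exp (r * x - z / 2) = exp (r * x) * exp (- z / 2)" by (simp add: exp_add[symmetric])
      then show ?thesis by simp
    qed
    also have "\<dots> \<le> 8 * K * (E * exp (- min r 1 * \<bar>x\<bar>))"
      unfolding E_def using K0 by (intro mult_left_mono gumbel_tail[OF r \<delta> a z]) auto
    finally show ?thesis by (simp add: mult_ac)
  qed
  show ?thesis unfolding two_sided_def
  proof (rule exI[of _ "8 * K * E"], rule exI[of _ "min r 1"], intro conjI ballI allI)
    fix \<tau> x :: real assume \<tau>: "\<tau> \<in> {s..t}"
    define z where "z = A * exp (\<delta> * x - \<gamma> * \<tau>)"
    have z0: "z \<ge> 0" using A by (simp add: z_def)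
    have z1: "1 \<le> (1 + z) ^ 2" "z \<le> (1 + z) ^ 2" "z ^ 2 \<le> (1 + z) ^ 2"
      using z0 by (auto simp: power2_eq_square algebra_simps)
    have K: "K * (1 + z) ^ 2 = (1 + z) ^ 2 + r * (1 + z) ^ 2 + \<delta> * (1 + z) ^ 2 + \<delta> ^ 2 * (1 + z) ^ 2"
      by (simp add: K_def distrib_right)
    have n: "0 \<le> r * (1 + z) ^ 2" "0 \<le> \<delta> * (1 + z) ^ 2" "0 \<le> \<delta> ^ 2 * (1 + z) ^ 2"
      "r * 1 \<le> r * (1 + z) ^ 2" "\<delta> * z \<le> \<delta> * (1 + z) ^ 2" "\<delta> ^ 2 * z ^ 2 \<le> \<delta> ^ 2 * (1 + z) ^ 2" "0 \<le> \<delta> * z" "0 \<le> \<delta> ^ 2 * z ^ 2"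
      using r \<delta> z0 z1 by (auto intro!: mult_left_mono simp del: mult_le_cancel_left_pos mult_le_cancel_left1)
    have "\<bar>1 :: real\<bar> \<le> K * (1 + z) ^ 2" unfolding K abs_one using n(1-3) z1(1) by linarith
    from *[OF \<tau> this[unfolded z_def]] show "\<bar>gumbel A r c \<delta> \<gamma> \<tau> x\<bar> \<le> (8 * K * E) * exp (- min r 1 * \<bar>x\<bar>)" by simp
    have "\<bar>r - \<delta> * z\<bar> \<le> K * (1 + z) ^ 2" unfolding K abs_le_iff using n z1 r by (intro conjI) linarith+
    from *[OF \<tau> this[unfolded z_def]] show "\<bar>(r - \<delta> * (A * exp (\<delta> * x - \<gamma> * \<tau>))) * gumbel A r c \<delta> \<gamma> \<tau> x\<bar> \<le> (8 * K * E) * exp (- min r 1 * \<bar>x\<bar>)" .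
    have "\<bar>1/2 * (\<delta> ^ 2 * z ^ 2) - 1\<bar> \<le> K * (1 + z) ^ 2" unfolding K abs_le_iff using n z1 by (intro conjI) linarith+
    then have "\<bar>1/2 * \<delta> ^ 2 * z ^ 2 - 1\<bar> \<le> K * (1 + z) ^ 2" by (simp add: mult.assoc)
    from *[OF \<tau> this[unfolded z_def]] show "\<bar>(1/2 * \<delta> ^ 2 * (A * exp (\<delta> * x - \<gamma> * \<tau>)) ^ 2 - 1) * gumbel A r c \<delta> \<gamma> \<tau> x\<bar> \<le> (8 * K * E) * exp (- min r 1 * \<bar>x\<bar>)" .
  qed (use r in simp)
qed

section \<open>Both inequalities for each sign of r\<close>

context contact_problem
begin

context
  fixes W0 :: "real \<Rightarrow> real"
  assumes init: "L1_loc_tendsto W W0 (at_right 0)"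
    and W0: "\<And>x. 0 \<le> W0 x" "\<And>x. W0 x \<le> 1" "W0 \<in> borel_measurable borel"
begin

lemma W_meas: "t > 0 \<Longrightarrow> W t \<in> borel_measurable borel"
  by (intro borel_measurable_continuous_onI cont_W_slice)

lemma bounded_integrable:
  fixes v h :: "real \<Rightarrow> real"
  assumes "v \<in> borel_measurable borel" "\<And>x. \<bar>v x\<bar> \<le> 1"
    and h: "h \<in> borel_measurable borel" "l > 0" "\<And>x. \<bar>h x\<bar> \<le> C * exp (- l * \<bar>x\<bar>)"
  shows "integrable lborel (\<lambda>x. v x * h x)"
proof (rule Bochner_Integration.integrable_bound)
  show "integrable lborel (\<lambda>x. C * exp (- l * \<bar>x\<bar>))" by (intro integrable_mult_right exp_abs_integrable h)
  show "(\<lambda>x. v x * h x) \<in> borel_measurable lborel" using assms(1) h(1) by simp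
  have "\<bar>v x * h x\<bar> \<le> 1 * (C * exp (- l * \<bar>x\<bar>))" for x
    unfolding abs_mult[of "v x"] using assms(2)[of x] h(3)[of x] by (intro mult_mono) auto
  then show "AE x in lborel. norm (v x * h x) \<le> norm (C * exp (- l * \<bar>x\<bar>))"
    by (intro AE_I2) (simp only: real_norm_def mult_1, rule order_trans[OF _ abs_ge_self], simp)
qed

lemma limit_W:
  assumes h: "h \<in> borel_measurable borel" "l > 0" "\<And>x. \<bar>h x\<bar> \<le> C * exp (- l * \<bar>x\<bar>)"
  shows "((\<lambda>t. LINT x|lborel. W t x * h x) \<longlongrightarrow> (LINT x|lborel. W0 x * h x)) (at_right 0)"
  by (rule L1_loc_limit[OF init _ W_meas _ W0(3) h]) (use W_bounds W0 in auto)

lemma limit_complement: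
  assumes h: "h \<in> borel_measurable borel" "l > 0" "\<And>x. \<bar>h x\<bar> \<le> C * exp (- l * \<bar>x\<bar>)"
  shows "((\<lambda>t. LINT x|lborel. (1 - W t x) * h x) \<longlongrightarrow> (LINT x|lborel. (1 - W0 x) * h x)) (at_right 0)"
proof (rule L1_loc_limit[OF _ _ _ _ _ h])
  have "\<bar>(1 - W t x) - (1 - W0 x)\<bar> = \<bar>W t x - W0 x\<bar>" for t x by simp
  then show "L1_loc_tendsto (\<lambda>t x. 1 - W t x) (\<lambda>x. 1 - W0 x) (at_right 0)"
    using init unfolding L1_loc_tendsto_def by simp
qed (use W_bounds W0 W_meas in auto)

lemma damped_meas: "k > 0 \<Longrightarrow> damped k r \<in> borel_measurable borel"
  by (intro borel_measurable_continuous_onI continuous_at_imp_continuous_on ballI DERIV_isCont[OF damped_deriv])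

lemma damped_abs_bound: "k > 0 \<Longrightarrow> \<bar>damped k r x\<bar> \<le> (1 + 1 / k) * exp (- \<bar>r\<bar> * \<bar>x\<bar>)"
  using damped_bound[of k r x] damped_pos[of k r x] by simp

lemma lower_right:
  assumes r: "r < 0"
  shows "ennreal (1 / \<bar>r\<bar>) * front_integral r \<le> (\<integral>\<^sup>+x. ennreal (W0 x * exp (r * x)) \<partial>lborel)"
proof -
  define c where "c = 1 + r ^ 2 / 2"
  have c: "c > 0" unfolding c_def using zero_le_power2[of r] by linarith
  have rn: "r \<noteq> 0" "\<bar>r\<bar> > 0" using r by auto
  have eq: "(LINT z:(strip s t)|lborel. if z \<in> D then g z else 0 :: real) = (LINT z:(strip s t)|lborel. if snd z > L (fst z) then g z else 0)"
    and eq': "set_integrable lborel (strip s t) (\<lambda>z. if z \<in> D then g z else 0 :: real) = set_integrable lborel (strip s t) (\<lambda>z. if snd z > L (fst z) then g z else 0)"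
    if "0 < s" for s t and g
    by (rule set_lebesgue_integral_cong, (use that in \<open>auto simp: D_def borel_strip\<close>)[2], rule set_integrable_cong)
      (use that in \<open>auto simp: D_def\<close>)
  have "(\<integral>\<^sup>+z. ennreal (exp (- c * fst z) * exp (r * snd z)) * indicator D z \<partial>lborel) \<le> (\<integral>\<^sup>+x. ennreal (W0 x * exp (r * x)) \<partial>lborel)"
  proof (rule lower_half[OF c W_bounds(1) W0(1,3) limit_W _ borel_regions(1)])
    fix k :: real assume k: "k > 0"
    show "damped k r \<in> borel_measurable borel" by (rule damped_meas[OF k])
    show "\<bar>damped k r x\<bar> \<le> (1 + 1 / k) * exp (- \<bar>r\<bar> * \<bar>x\<bar>)" for x by (rule damped_abs_bound[OF k])
    show "integrable lborel (\<lambda>x. W0 x * damped k r x)"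
      by (rule bounded_integrable[OF W0(3) _ damped_meas[OF k] rn(2) damped_abs_bound[OF k]]) (use W0 in auto)
    fix s t :: real assume s: "0 < s" "s \<le> t"
    note de = two_sided_decaying[OF damped_two_sided[OF k rn(1) c s(1)]]
    show "set_integrable lborel (strip s t) (\<lambda>z. if z \<in> D then exp (- c * fst z) * damped k r (snd z) else 0)"
      unfolding eq'[OF s(1)] by (rule right_part_integrable[OF s damped_test[OF k] de])
    show "(LINT z:(strip s t)|lborel. if z \<in> D then exp (- c * fst z) * damped k r (snd z) else 0) \<le>
      (LINT x|lborel. W s x * (exp (- c * s) * damped k r x))"
      unfolding eq[OF s(1)]
      by (rule supersolution[OF s damped_test[OF k] de _ damped_super[OF k c_def]]) (simp add: damped_pos[OF k, THEN less_imp_le])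
  qed (use rn in \<open>auto simp: D_def\<close>)
  then show ?thesis unfolding region_total_right[OF r c_def] .
qed

lemma lower_left:
  assumes r: "r > 0"
  shows "ennreal (1 / \<bar>r\<bar>) * front_integral r \<le> (\<integral>\<^sup>+x. ennreal ((1 - W0 x) * exp (r * x)) \<partial>lborel)"
proof -
  define c where "c = 1 + r ^ 2 / 2"
  have c: "c > 0" unfolding c_def using zero_le_power2[of r] by linarith
  have rn: "r \<noteq> 0" "\<bar>r\<bar> > 0" using r by auto
  have eq: "(LINT z:(strip s t)|lborel. if z \<in> left_region then g z else 0 :: real) = (LINT z:(strip s t)|lborel. if snd z \<le> L (fst z) then g z else 0)"
    and eq': "set_integrable lborel (strip s t) (\<lambda>z. if z \<in> left_region then g z else 0 :: real) = set_integrable lborel (strip s t) (\<lambda>z. if snd z \<le> L (fst z) then g z else 0)"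
    if "0 < s" for s t and g
    by (rule set_lebesgue_integral_cong, (use that in \<open>auto simp: left_region_def borel_strip\<close>)[2], rule set_integrable_cong)
      (use that in \<open>auto simp: left_region_def\<close>)
  have "(\<integral>\<^sup>+z. ennreal (exp (- c * fst z) * exp (r * snd z)) * indicator left_region z \<partial>lborel) \<le> (\<integral>\<^sup>+x. ennreal ((1 - W0 x) * exp (r * x)) \<partial>lborel)"
  proof (rule lower_half[OF c _ _ _ limit_complement _ borel_regions(2)])
    fix k :: real assume k: "k > 0"
    show "damped k r \<in> borel_measurable borel" by (rule damped_meas[OF k])
    show "\<bar>damped k r x\<bar> \<le> (1 + 1 / k) * exp (- \<bar>r\<bar> * \<bar>x\<bar>)" for x by (rule damped_abs_bound[OF k])
    show "integrable lborel (\<lambda>x. (1 - W0 x) * damped k r x)"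
      by (rule bounded_integrable[OF _ _ damped_meas[OF k] rn(2) damped_abs_bound[OF k]]) (use W0 in auto)
    fix s t :: real assume s: "0 < s" "s \<le> t"
    note de = damped_two_sided[OF k rn(1) c s(1)]
    show "set_integrable lborel (strip s t) (\<lambda>z. if z \<in> left_region then exp (- c * fst z) * damped k r (snd z) else 0)"
      unfolding eq'[OF s(1)] by (rule complement_identity(3)[OF s damped_test[OF k] de])
    show "(LINT z:(strip s t)|lborel. if z \<in> left_region then exp (- c * fst z) * damped k r (snd z) else 0) \<le>
      (LINT x|lborel. (1 - W s x) * (exp (- c * s) * damped k r x))"
      unfolding eq[OF s(1)]
      by (rule complement_supersolution[OF s damped_test[OF k] de _ damped_super[OF k c_def]]) (simp add: damped_pos[OF k, THEN less_imp_le])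
  qed (use rn W_bounds W0 in \<open>auto simp: left_region_def\<close>)
  then show ?thesis unfolding region_total_left[OF r c_def] .
qed

text \<open>Otherwise the integrand would stay above \<open>e\<close> on \<open>{N..}\<close> and
  the integral would be infinite. Some arbitrarily late time is all that the terminal term
  requires.\<close>

lemma front_small:
  assumes "front_integral r < \<infinity>" "e > 0" "N > 0"
  obtains T where "T \<ge> N" "exp (r * L T - (1 + r ^ 2 / 2) * T) < e"
proof -
  have "\<exists>T\<ge>N. exp (r * L T - (1 + r ^ 2 / 2) * T) < e"
  proof (rule ccontr)
    assume "\<not> ?thesis"
    then have *: "e \<le> exp (r * L T - (1 + r ^ 2 / 2) * T)" if "T \<ge> N" for T using that by auto
    have "(\<integral>\<^sup>+t. ennreal e * indicator {N..} t \<partial>lborel) \<le> front_integral r"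
      unfolding front_integral_def using * assms(3)
      by (intro nn_integral_mono) (auto simp: indicator_def intro!: ennreal_leI)
    moreover have "(\<integral>\<^sup>+t. ennreal e * indicator {N..} t \<partial>lborel) = \<infinity>"
    proof -
      have "emeasure lborel {N..} = (\<infinity> :: ennreal)"
      proof -
        have "of_nat n \<le> emeasure lborel {N..}" for n :: nat
        proof -
          have "of_nat n = emeasure lborel {N..N + real n}" by (simp add: ennreal_of_nat_eq_real_of_nat)
          also have "\<dots> \<le> emeasure lborel {N..}" by (intro emeasure_mono) auto
          finally show ?thesis .
        qed
        then show ?thesis using ennreal_Ex_less_of_nat[of "emeasure lborel {N..}"] by (metis infinity_ennreal_def less_top linorder_not_less)
      qed
      then show ?thesis using assms(2) by (simp add: nn_integral_cmult_indicator ennreal_mult_eq_top_iff ennreal_mult_top)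
    qed
    ultimately show False using assms(1) by simp
  qed
  then show ?thesis using that by blast
qed

lemma upper_right:
  assumes r: "r < 0"
  shows "(\<integral>\<^sup>+x. ennreal (W0 x * exp (r * x)) \<partial>lborel) \<le> ennreal (1 / \<bar>r\<bar>) * front_integral r"
proof (cases "front_integral r = \<infinity>")
  case True
  then show ?thesis using r by (simp add: ennreal_mult_top)
next
  case False
  then have fin: "front_integral r < \<infinity>" by (simp add: less_top)
  define c where "c = 1 + r ^ 2 / 2"
  have c: "c > 0" unfolding c_def using zero_le_power2[of r] by linarith
  let ?p = "\<lambda>\<tau> x. exp (- c * \<tau>) * exp (r * x)"
  define J where "J = enn2real (ennreal (1 / \<bar>r\<bar>) * front_integral r)"
  have J: "ennreal J = ennreal (1 / \<bar>r\<bar>) * front_integral r"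
    unfolding J_def using fin by (intro ennreal_enn2real) (simp add: ennreal_mult_less_top)
  have J0: "J \<ge> 0" by (simp add: J_def)
  have strip: "(LINT z:(strip s t)|lborel. if snd z > L (fst z) then ?p (fst z) (snd z) else 0) \<le> J" if s: "0 < s" "s \<le> t" for s t
  proof -
    have eq: "indicator (strip s t) z *\<^sub>R (if z \<in> D then ?p (fst z) (snd z) else 0) = indicator (strip s t) z *\<^sub>R (if snd z > L (fst z) then ?p (fst z) (snd z) else 0)" for z
      using s by (auto simp: D_def indicator_def)
    have i: "set_integrable lborel (strip s t) (\<lambda>z. if z \<in> D then ?p (fst z) (snd z) else 0)"
      using right_part_integrable[OF s exp_test[OF c_def] exp_decaying[OF r c s(1)]] unfolding set_integrable_def eq .
    have "ennreal (LINT z:(strip s t)|lborel. if z \<in> D then ?p (fst z) (snd z) else 0) \<le> ennreal J"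
      unfolding J region_total_right[OF r c_def, symmetric] by (rule strip_le_region[OF borel_regions(1) i]) auto
    then have "(LINT z:(strip s t)|lborel. if z \<in> D then ?p (fst z) (snd z) else 0) \<le> J" using J0 by (simp add: ennreal_le_iff)
    then show ?thesis unfolding set_lebesgue_integral_def eq .
  qed
  have id: "(LINT x|lborel. W s x * ?p s x) \<le> exp (r * L t - c * t) / \<bar>r\<bar> + J" if s: "0 < s" "s \<le> t" for s t
  proof -
    have t: "t > 0" using s by simp
    note test = exp_test[OF c_def] and dec = exp_decaying[OF r c s(1)]
    have "(LINT x|lborel. W s x * ?p s x) = (LINT x|lborel. W t x * ?p t x)
       + (LINT z:(strip s t)|lborel. if snd z > L (fst z) then ?p (fst z) (snd z) else 0)"
      using weak_identity(1)[OF s test dec] by (simp add: set_lebesgue_integral_def)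
    moreover have "(LINT x|lborel. W t x * ?p t x) \<le> (LINT x|lborel. exp (- c * t) * (indicator {L t..} x * exp (- (- r) * x)))"
    proof (rule integral_mono)
      show "integrable lborel (\<lambda>x. W t x * ?p t x)" by (rule slice_integrable[OF s(1) _ test dec[of t]]) (use s in auto)
      show "integrable lborel (\<lambda>x. exp (- c * t) * (indicator {L t..} x * exp (- (- r) * x)))"
        using r by (intro integrable_mult_right exp_halfline) auto
      fix x
      show "W t x * ?p t x \<le> exp (- c * t) * (indicator {L t..} x * exp (- (- r) * x))"
        using W_left[OF t, of x] W_bounds[OF t, of x] by (cases "x \<ge> L t") (auto intro: mult_left_le_one_le)
    qed
    moreover have "(LINT x|lborel. exp (- c * t) * (indicator {L t..} x * exp (- (- r) * x))) = exp (- c * t) * (exp (- (- r) * L t) / (- r))"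
      using exp_halfline(2)[of "- r" "L t"] r by (subst integral_mult_right_zero) simp
    moreover have "exp (- c * t) * (exp (- (- r) * L t) / (- r)) = exp (r * L t - c * t) / \<bar>r\<bar>"
      using r by (simp add: exp_diff exp_minus field_simps)
    ultimately show ?thesis using strip[OF s] by linarith
  qed
  \<comment> \<open>\<open>exp (r * x)\<close> cannot be carried to time 0: it explodes on the left,
    and convergence to the initial datum is only available against functions with two-sided decay.
    So \<open>damped k r\<close> takes its place before \<open>s\<close> tends to 0.\<close>
  have W_int: "(LINT x|lborel. W s x * damped k r x) \<le> exp (c * s) * (exp (r * L t - c * t) / \<bar>r\<bar> + J)"
    if k: "k > 0" and s: "0 < s" "s \<le> t" for k s t
  proof -
    note test = exp_test[OF c_def] and dec = exp_decaying[OF r c s(1)]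
    have "(LINT x|lborel. W s x * damped k r x) \<le> (LINT x|lborel. exp (c * s) * (W s x * ?p s x))"
    proof (rule integral_mono)
      show "integrable lborel (\<lambda>x. W s x * damped k r x)"
        by (rule bounded_integrable[OF W_meas[OF s(1)] _ damped_meas[OF k] _ damped_abs_bound[OF k]]) (use W_bounds[OF s(1)] r in auto)
      show "integrable lborel (\<lambda>x. exp (c * s) * (W s x * ?p s x))"
        by (intro integrable_mult_right slice_integrable[OF s(1) _ test dec[of t]]) (use s in auto)
      have "exp (c * s) * exp (- c * s) = 1" by (simp add: exp_add[symmetric])
      then have eq: "exp (c * s) * (W s x * ?p s x) = W s x * exp (r * x)" for x
        by (metis mult.assoc mult.commute mult_1)
      show "W s x * damped k r x \<le> exp (c * s) * (W s x * ?p s x)" for x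
        unfolding eq by (intro mult_left_mono damped_le_exp k W_bounds(1) s(1))
    qed
    also have "\<dots> = exp (c * s) * (LINT x|lborel. W s x * ?p s x)" by (rule integral_mult_right_zero)
    also have "\<dots> \<le> exp (c * s) * (exp (r * L t - c * t) / \<bar>r\<bar> + J)" by (intro mult_left_mono id s) auto
    finally show ?thesis .
  qed
  have bound: "(LINT x|lborel. W0 x * damped k r x) \<le> J" if k: "k > 0" for k
  proof (rule field_le_epsilon)
    fix e :: real assume e: "e > 0"
    \<comment> \<open>\<open>T\<close> is fixed before the limit, and \<open>T \<ge> 1\<close>
      ensures \<open>s \<le> T\<close> for all \<open>s < 1\<close>. The factor
      \<open>\<bar>r\<bar>\<close> offsets the division in the terminal bound.\<close>
    obtain T where T: "T \<ge> 1" "exp (r * L T - (1 + r ^ 2 / 2) * T) < e * \<bar>r\<bar>"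
      by (rule front_small[OF fin mult_pos_pos[OF e] zero_less_one, of "\<bar>r\<bar>"]) (use r in auto)
    have "(LINT x|lborel. W0 x * damped k r x) \<le> exp (c * 0) * (exp (r * L T - c * T) / \<bar>r\<bar> + J)"
    proof (rule tendsto_le[OF _ _ limit_W[OF damped_meas[OF k] _ damped_abs_bound[OF k]]])
      show "((\<lambda>s. exp (c * s) * (exp (r * L T - c * T) / \<bar>r\<bar> + J)) \<longlongrightarrow> exp (c * 0) * (exp (r * L T - c * T) / \<bar>r\<bar> + J)) (at_right 0)"
        by (intro tendsto_intros)
      have "\<forall>\<^sub>F s in at_right 0. s \<in> {0<..<1 :: real}" by (rule eventually_at_right_real) simp
      then show "\<forall>\<^sub>F s in at_right 0. (LINT x|lborel. W s x * damped k r x) \<le> exp (c * s) * (exp (r * L T - c * T) / \<bar>r\<bar> + J)"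
        by eventually_elim (use W_int[OF k] T in auto)
    qed (use r in auto)
    also have "\<dots> = exp (r * L T - c * T) / \<bar>r\<bar> + J" by simp
    also have "\<dots> \<le> J + e" using T(2) r by (simp add: c_def field_simps)
    finally show "(LINT x|lborel. W0 x * damped k r x) \<le> J + e" .
  qed
  define a where "a n = 1 / real (Suc n)" for n
  have a: "a n > 0" for n by (simp add: a_def)
  have "(\<lambda>n. \<integral>\<^sup>+x. ennreal (W0 x * damped (a n) r x) \<partial>lborel) \<longlonglongrightarrow> (\<integral>\<^sup>+x. ennreal (W0 x * exp (r * x)) \<partial>lborel)"
  proof (rule nn_integral_LIMSEQ)
    show "incseq (\<lambda>n x. ennreal (W0 x * damped (a n) r x))"
      using damped_SUP(1)[of r] W0(1) unfolding a_def mono_def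
      by (intro allI impI le_funI ennreal_leI mult_left_mono) auto
    show "(\<lambda>x. ennreal (W0 x * damped (a n) r x)) \<in> borel_measurable lborel" for n
      using W0(3) damped_meas[OF a] by measurable
    show "(\<lambda>n. ennreal (W0 x * damped (a n) r x)) \<longlonglongrightarrow> ennreal (W0 x * exp (r * x))" for x
      unfolding a_def by (intro tendsto_ennrealI tendsto_mult tendsto_const damped_SUP(2))
  qed
  moreover have "(\<integral>\<^sup>+x. ennreal (W0 x * damped (a n) r x) \<partial>lborel) \<le> ennreal J" for n
  proof -
    have "integrable lborel (\<lambda>x. W0 x * damped (a n) r x)"
      by (rule bounded_integrable[OF W0(3) _ damped_meas[OF a] _ damped_abs_bound[OF a]]) (use W0 r in auto)
    then have "(\<integral>\<^sup>+x. ennreal (W0 x * damped (a n) r x) \<partial>lborel) = ennreal (LINT x|lborel. W0 x * damped (a n) r x)"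
      using W0(1) damped_pos[OF a, THEN less_imp_le] by (intro nn_integral_eq_integral) auto
    then show ?thesis using bound[OF a] by (simp add: ennreal_leI)
  qed
  ultimately have "(\<integral>\<^sup>+x. ennreal (W0 x * exp (r * x)) \<partial>lborel) \<le> ennreal J"
    by (auto intro: LIMSEQ_le_const2)
  then show ?thesis by (simp add: J)
qed

lemma upper_left:
  assumes r: "0 < r" "r < sqrt 2"
  shows "(\<integral>\<^sup>+x. ennreal ((1 - W0 x) * exp (r * x)) \<partial>lborel) \<le> ennreal (1 / \<bar>r\<bar>) * front_integral r"
proof (cases "front_integral r = \<infinity>")
  case True
  then show ?thesis using r by (simp add: ennreal_mult_top)
next
  case False
  then have fin: "front_integral r < \<infinity>" by (simp add: less_top)
  define c where "c = 1 + r ^ 2 / 2"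
  have c: "c > 0" unfolding c_def using zero_le_power2[of r] by linarith
  have r2: "r ^ 2 < 2" using r by (metis less_imp_le real_sqrt_less_iff real_sqrt_unique)
  \<comment> \<open>The midpoint of \<open>r\<close> and \<open>c / r\<close>; the gap is open
    because \<open>r ^ 2 < 2\<close> means \<open>r ^ 2 < c\<close>.\<close>
  define v where "v = (r + c / r) / 2"
  \<comment> \<open>With this choice \<open>\<gamma> = \<delta> * (v - \<delta> / 2)\<close>, which
    is below \<open>\<delta> * v\<close>.\<close>
  define \<delta> where "\<delta> = v - r"
  define \<gamma> where "\<gamma> = r * \<delta> + \<delta> ^ 2 / 2"
  have v: "r < v" "r * v < c"
  proof -
    have "r * r < c" using r2 by (simp add: c_def power2_eq_square)
    then show "r < v" using r by (simp add: v_def field_simps)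
    have "r * v = (r * r + c) / 2" using r by (simp add: v_def field_simps)
    then show "r * v < c" using \<open>r * r < c\<close> by simp
  qed
  have \<delta>: "\<delta> > 0" using v by (simp add: \<delta>_def)
  have \<gamma>: "\<gamma> > 0" using r \<delta> by (simp add: \<gamma>_def add_pos_pos)
  have \<gamma>v: "\<gamma> < \<delta> * v"
  proof -
    have "\<gamma> = \<delta> * (v - \<delta> / 2)" by (simp add: \<gamma>_def \<delta>_def power2_eq_square field_simps)
    also have "\<dots> < \<delta> * v" using \<delta> by (intro mult_strict_left_mono) auto
    finally show ?thesis .
  qed
  \<comment> \<open>Normalized so that the inner term at time \<open>T\<close> is
    \<open>exp (\<delta> * (x - v * T))\<close>. As \<open>\<gamma> < \<delta> * v\<close>, the
    coefficient tends to 0 for large \<open>T\<close>, and at time 0 the cut-off recedes to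
    infinity.\<close>
  define A where "A T = exp ((\<gamma> - \<delta> * v) * T)" for T
  have A: "A T > 0" for T by (simp add: A_def)
  let ?g = "\<lambda>T. gumbel (A T) r c \<delta> \<gamma>"
  note test = gumbel_test[OF c_def \<gamma>_def] and two = gumbel_two_sided[OF r(1) \<delta> A c \<gamma>]
  have g_meas: "?g T \<tau> \<in> borel_measurable borel" for T \<tau>
    by (intro borel_measurable_continuous_onI test_fun_slice_cont(1)[OF test])
  define J where "J = enn2real (ennreal (1 / \<bar>r\<bar>) * front_integral r)"
  have J: "ennreal J = ennreal (1 / \<bar>r\<bar>) * front_integral r"
    unfolding J_def using fin by (intro ennreal_enn2real) (simp add: ennreal_mult_less_top)
  have J0: "J \<ge> 0" by (simp add: J_def)
  \<comment> \<open>The mass of the final profile in the coordinate \<open>x - v * T\<close>; the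
    translation contributes \<open>exp ((r * v - c) * T)\<close>, which tends to 0.\<close>
  define C where "C = (LINT y|lborel. exp (r * y - exp (\<delta> * y)))"
  have strip: "(LINT z:(strip s t)|lborel. if snd z \<le> L (fst z) then ?g T (fst z) (snd z) else 0) \<le> J" if s: "0 < s" "s \<le> t" for s t T
  proof -
    have eq: "indicator (strip s t) z *\<^sub>R (if z \<in> left_region then ?g T (fst z) (snd z) else 0) = indicator (strip s t) z *\<^sub>R (if snd z \<le> L (fst z) then ?g T (fst z) (snd z) else 0)" for z
      using s by (auto simp: left_region_def indicator_def)
    have i: "set_integrable lborel (strip s t) (\<lambda>z. if z \<in> left_region then ?g T (fst z) (snd z) else 0)"
      using complement_identity(3)[OF s test two] s unfolding set_integrable_def eq by simp
    have le: "?g T \<tau> x \<le> exp (- c * \<tau>) * exp (r * x)" for \<tau> x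
      using A[of T] by (simp add: gumbel_def exp_add[symmetric])
    have "ennreal (LINT z:(strip s t)|lborel. if z \<in> left_region then ?g T (fst z) (snd z) else 0) \<le> ennreal J"
      unfolding J region_total_left[OF r(1) c_def, symmetric] by (rule strip_le_region[OF borel_regions(2) i]) (simp add: gumbel_def, rule le)
    then have "(LINT z:(strip s t)|lborel. if z \<in> left_region then ?g T (fst z) (snd z) else 0) \<le> J" using J0 by (simp add: ennreal_le_iff)
    then show ?thesis unfolding set_lebesgue_integral_def eq .
  qed
  have top: "(LINT x|lborel. (1 - W T x) * ?g T T x) \<le> exp ((r * v - c) * T) * C" if T: "T > 0" for T
  proof -
    have gT: "?g T T x = exp ((r * v - c) * T) * exp (r * (- (v * T) + 1 * x) - exp (\<delta> * (- (v * T) + 1 * x)))" for x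
    proof -
      have "A T * exp (\<delta> * x - \<gamma> * T) = exp (\<delta> * (- (v * T) + 1 * x))"
        unfolding A_def exp_add[symmetric] by (simp add: algebra_simps)
      then show ?thesis unfolding gumbel_def exp_add[symmetric] by (simp add: algebra_simps)
    qed
    have "(LINT x|lborel. (1 - W T x) * ?g T T x) \<le> (LINT x|lborel. ?g T T x)"
    proof (rule integral_mono)
      show "integrable lborel (\<lambda>x. (1 - W T x) * ?g T T x)"
        by (rule complement_slice_integrable[OF T _ test two[of T T T]]) (use T in auto)
      show "integrable lborel (?g T T)" by (rule test_fun_slice_integrable[OF test two[of T T T]]) (use T in auto)
      show "(1 - W T x) * ?g T T x \<le> ?g T T x" for x
        using W_bounds[OF T, of x] by (intro mult_left_le_one_le) (auto simp: gumbel_def)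
    qed
    also have "\<dots> = exp ((r * v - c) * T) * C"
      unfolding gT C_def by (subst lborel_integral_real_affine[of 1 _ "- (v * T)"]) simp_all
    finally show ?thesis .
  qed
  have gB: "\<exists>B l. l > 0 \<and> (\<forall>x. \<bar>?g T 0 x\<bar> \<le> B * exp (- l * \<bar>x\<bar>))" if T: "T > 0" for T
  proof -
    obtain B l where l: "l > 0" and B: "\<And>\<tau> x. \<tau> \<in> {0..T} \<Longrightarrow> \<bar>?g T \<tau> x\<bar> \<le> B * exp (- l * \<bar>x\<bar>)"
      using two[of 0 T T, OF order_refl] unfolding two_sided_def by blast
    show ?thesis using l B[of 0] T by (intro exI[of _ B] exI[of _ l]) auto
  qed
  have key: "(LINT x|lborel. (1 - W0 x) * ?g T 0 x) \<le> exp ((r * v - c) * T) * C + J" if T: "T > 0" for T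
  proof -
    obtain B l where B: "l > 0" "\<And>x. \<bar>?g T 0 x\<bar> \<le> B * exp (- l * \<bar>x\<bar>)"
      using gB[OF T] by blast
    have "(LINT x|lborel. (1 - W0 x) * ?g T 0 x) \<le> exp (c * 0) * (exp ((r * v - c) * T) * C + J)"
    proof (rule tendsto_le[OF _ _ limit_complement[OF g_meas B]])
      show "((\<lambda>s. exp (c * s) * (exp ((r * v - c) * T) * C + J)) \<longlongrightarrow> exp (c * 0) * (exp ((r * v - c) * T) * C + J)) (at_right 0)"
        by (intro tendsto_intros)
      have "\<forall>\<^sub>F s in at_right 0. s \<in> {0<..<T}" using T by (rule eventually_at_right_real)
      then show "\<forall>\<^sub>F s in at_right 0. (LINT x|lborel. (1 - W s x) * ?g T 0 x) \<le> exp (c * s) * (exp ((r * v - c) * T) * C + J)"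
      proof eventually_elim
        case (elim s)
        then have s: "0 < s" "s \<le> T" by auto
        have "(LINT x|lborel. (1 - W s x) * ?g T 0 x) \<le> (LINT x|lborel. exp (c * s) * ((1 - W s x) * ?g T s x))"
        proof (rule integral_mono)
          show "integrable lborel (\<lambda>x. (1 - W s x) * ?g T 0 x)"
            by (rule bounded_integrable[OF _ _ g_meas B]) (use W_bounds[OF s(1)] W_meas[OF s(1)] in auto)
          show "integrable lborel (\<lambda>x. exp (c * s) * ((1 - W s x) * ?g T s x))"
            by (intro integrable_mult_right complement_slice_integrable[OF s(1) _ test two[of s T T]]) (use s in auto)
          fix x
          have "exp (\<delta> * x - \<gamma> * s) \<le> exp (\<delta> * x - \<gamma> * 0)" using \<gamma> s by simp
          then have "A T * exp (\<delta> * x - \<gamma> * s) \<le> A T * exp (\<delta> * x - \<gamma> * 0)"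
            using A[of T] by (intro mult_left_mono) auto
          \<comment> \<open>The inner term decreases in time, so the function at time
            \<open>s\<close> dominates the one at time 0 up to \<open>exp (c * s)\<close>. This
            replaces a test function depending on \<open>s\<close> by a fixed one before
            \<open>s\<close> tends to 0.\<close>
          then have "?g T 0 x \<le> exp (c * s) * ?g T s x"
            unfolding gumbel_def exp_add[symmetric] by simp
          then have "(1 - W s x) * ?g T 0 x \<le> (1 - W s x) * (exp (c * s) * ?g T s x)"
            using W_bounds(2)[OF s(1), of x] by (intro mult_left_mono) auto
          then show "(1 - W s x) * ?g T 0 x \<le> exp (c * s) * ((1 - W s x) * ?g T s x)" by (simp add: mult_ac)
        qed
        also have "\<dots> = exp (c * s) * (LINT x|lborel. (1 - W s x) * ?g T s x)" by (rule integral_mult_right_zero)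
        also have "(LINT x|lborel. (1 - W s x) * ?g T s x) \<le> (LINT x|lborel. (1 - W T x) * ?g T T x) +
            (LINT z:(strip s T)|lborel. if snd z \<le> L (fst z) then ?g T (fst z) (snd z) else 0)"
        proof (rule complement_subsolution[OF s test two])
          show "0 \<le> (1/2 * \<delta> ^ 2 * (A T * exp (\<delta> * x - \<gamma> * \<tau>)) ^ 2 - 1) * ?g T \<tau> x + ?g T \<tau> x" for \<tau> x
            by (simp add: left_diff_distrib gumbel_def)
        qed (use s in simp)
        also have "\<dots> \<le> exp ((r * v - c) * T) * C + J" by (intro add_mono top T strip s)
        finally show ?case by simp
      qed
    qed simp
    then show ?thesis by simp
  qed
  have int0: "integrable lborel (\<lambda>x. (1 - W0 x) * ?g T 0 x)" if T: "T > 0" for T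
  proof -
    obtain B l where B: "l > 0" "\<And>x. \<bar>?g T 0 x\<bar> \<le> B * exp (- l * \<bar>x\<bar>)"
      using gB[OF T] by blast
    show ?thesis by (rule bounded_integrable[OF _ _ g_meas B]) (use W0 in auto)
  qed
  have g0: "?g T 0 x = exp (r * x - A T * exp (\<delta> * x))" for T x by (simp add: gumbel_def)
  let ?T = "\<lambda>n. real (Suc n)"
  have Amono: "A (?T m) \<le> A (?T n)" if "n \<le> m" for n m
    unfolding A_def using \<gamma>v that by (auto intro!: mult_left_mono_neg)
  have "(\<lambda>n. \<integral>\<^sup>+x. ennreal ((1 - W0 x) * ?g (?T n) 0 x) \<partial>lborel) \<longlonglongrightarrow> (\<integral>\<^sup>+x. ennreal ((1 - W0 x) * exp (r * x)) \<partial>lborel)"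
  proof (rule nn_integral_LIMSEQ)
    show "incseq (\<lambda>n x. ennreal ((1 - W0 x) * ?g (?T n) 0 x))"
    proof (intro monoI le_funI ennreal_leI mult_left_mono)
      fix n m :: nat and x assume "n \<le> m"
      then show "?g (?T n) 0 x \<le> ?g (?T m) 0 x" unfolding g0 using Amono by simp
      show "0 \<le> 1 - W0 x" using W0(2) by simp
    qed
    show "(\<lambda>x. ennreal ((1 - W0 x) * ?g (?T n) 0 x)) \<in> borel_measurable lborel" for n
      using W0(3) g_meas by measurable
    have lim: "filterlim (\<lambda>n. ?T n) at_top sequentially"
      using filterlim_real_sequentially filterlim_sequentially_Suc by blast
    have "(\<lambda>n. A (?T n)) \<longlonglongrightarrow> 0"
    proof -
      have "filterlim (\<lambda>n. (\<gamma> - \<delta> * v) * ?T n) at_bot sequentially"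
        using \<gamma>v by (intro filterlim_tendsto_neg_mult_at_bot[OF tendsto_const _ lim]) simp
      from filterlim_compose[OF exp_at_bot this] show ?thesis unfolding A_def .
    qed
    then have "(\<lambda>n. ?g (?T n) 0 x) \<longlonglongrightarrow> exp (r * x - 0 * exp (\<delta> * x))" for x
      unfolding g0 by (intro tendsto_intros)
    then show "(\<lambda>n. ennreal ((1 - W0 x) * ?g (?T n) 0 x)) \<longlonglongrightarrow> ennreal ((1 - W0 x) * exp (r * x))" for x
      by (intro tendsto_ennrealI tendsto_mult tendsto_const) simp
  qed
  moreover have "(\<lambda>n. ennreal (exp ((r * v - c) * ?T n) * C + J)) \<longlonglongrightarrow> ennreal (0 * C + J)"
  proof (intro tendsto_ennrealI tendsto_add tendsto_mult tendsto_const)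
    have "filterlim (\<lambda>n. ?T n) at_top sequentially"
      using filterlim_real_sequentially filterlim_sequentially_Suc by blast
    then have "filterlim (\<lambda>n. (r * v - c) * ?T n) at_bot sequentially"
      using v(2) by (intro filterlim_tendsto_neg_mult_at_bot[OF tendsto_const]) simp_all
    from filterlim_compose[OF exp_at_bot this] show "(\<lambda>n. exp ((r * v - c) * ?T n)) \<longlonglongrightarrow> 0" .
  qed
  moreover have "(\<integral>\<^sup>+x. ennreal ((1 - W0 x) * ?g (?T n) 0 x) \<partial>lborel) \<le> ennreal (exp ((r * v - c) * ?T n) * C + J)" for n
  proof -
    have "(\<integral>\<^sup>+x. ennreal ((1 - W0 x) * ?g (?T n) 0 x) \<partial>lborel) = ennreal (LINT x|lborel. (1 - W0 x) * ?g (?T n) 0 x)"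
      using W0(2) by (intro nn_integral_eq_integral int0) (auto simp: gumbel_def)
    then show ?thesis using key[of "?T n"] by (simp add: ennreal_leI)
  qed
  ultimately have "(\<integral>\<^sup>+x. ennreal ((1 - W0 x) * exp (r * x)) \<partial>lborel) \<le> ennreal (0 * C + J)"
    by (intro LIMSEQ_le[of _ _ _ "ennreal (0 * C + J)"]) auto
  then show ?thesis by (simp add: J)
qed

end

end

section \<open>The integral formula\<close>

lemma classical_solution_contact_problem:
  assumes "classical_solution U0 U L"
  shows "contact_problem (\<lambda>t x. 1 - U t x) (\<lambda>t x. - deriv (\<lambda>s. U s x) t) (\<lambda>t x. - deriv (U t) x)
    (\<lambda>t x. - deriv (deriv (U t)) x) L"
proof -
  have L: "continuous_on {0<..} L"
    and b: "\<And>t x. t > 0 \<Longrightarrow> 0 \<le> U t x \<and> U t x \<le> 1"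
    and C: "C12_on {(t, x). t > 0 \<and> x > L t} U"
    and cU: "continuous_on ({0<..} \<times> UNIV) (\<lambda>(t, x). U t x)"
    and F: "FBP U0 U L"
    using assms unfolding classical_solution_def by auto
  let ?D = "{z. fst z > 0 \<and> snd z > L (fst z)}"
  have D: "{(t, x). t > 0 \<and> x > L t} = ?D" by auto
  have d: "(\<lambda>s. U s x) field_differentiable at t" "U t field_differentiable at x" "deriv (U t) field_differentiable at x"
    if "t > 0" "x > L t" for t x
    using C that unfolding C12_on_def by auto
  have c: "continuous_on ?D (\<lambda>z. deriv (\<lambda>s. U s (snd z)) (fst z))" "continuous_on ?D (\<lambda>z. deriv (U (fst z)) (snd z))"
    "continuous_on ?D (\<lambda>z. deriv (deriv (U (fst z))) (snd z))"
    using C unfolding C12_on_def D by (simp_all add: case_prod_unfold)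
  have e: "deriv (\<lambda>s. U s x) t = 1/2 * deriv (deriv (U t)) x + U t x" if "t > 0" "x > L t" for t x
    using F that unfolding FBP_def by auto
  have l: "U t x = 1" if "t > 0" "x \<le> L t" for t x using F that unfolding FBP_def by auto
  have f: "(U t has_real_derivative 0) (at (L t))" if "t > 0" for t using F that unfolding FBP_def by auto
  show ?thesis
  proof
    show "continuous_on ({0<..} \<times> UNIV) (\<lambda>z. 1 - U (fst z) (snd z))"
      using cU by (intro continuous_on_diff continuous_on_const) (simp add: case_prod_unfold)
    fix t x :: real assume t: "t > 0"
    show "0 \<le> 1 - U t x" "1 - U t x \<le> 1" using b[OF t, of x] by auto
    show "((\<lambda>x. 1 - U t x) has_real_derivative 0) (at (L t))" using DERIV_diff[OF DERIV_const f[OF t]] by simp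
    assume x: "x > L t"
    note dd = d[OF t x, THEN DERIV_deriv_iff_field_differentiable[THEN iffD2]]
    show "((\<lambda>s. 1 - U s x) has_real_derivative - deriv (\<lambda>s. U s x) t) (at t)" using DERIV_diff[OF DERIV_const dd(1)] by simp
    show "((\<lambda>x. 1 - U t x) has_real_derivative - deriv (U t) x) (at x)" using DERIV_diff[OF DERIV_const dd(2)] by simp
    show "((\<lambda>x. - deriv (U t) x) has_real_derivative - deriv (deriv (U t)) x) (at x)" using DERIV_minus[OF dd(3)] .
    show "- deriv (\<lambda>s. U s x) t = 1/2 * - deriv (deriv (U t)) x + (1 - U t x) - 1" using e[OF t x] by simp
  qed (use L l c in \<open>auto intro: continuous_on_minus\<close>)
qed

lemma emeasure_atMost_infinite: "emeasure lborel {..b :: real} = \<infinity>"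
proof (rule ccontr)
  assume "emeasure lborel {..b} \<noteq> \<infinity>"
  then obtain n :: nat where n: "emeasure lborel {..b} < of_nat n"
    using ennreal_Ex_less_of_nat[of "emeasure lborel {..b}"] by (auto simp: less_top)
  have "of_nat n = emeasure lborel {b - real n..b}" by (simp add: ennreal_of_nat_eq_real_of_nat)
  also have "\<dots> \<le> emeasure lborel {..b}" by (intro emeasure_mono) auto
  finally show False using n by simp
qed

text \<open>Only the moved summand has to be finite; \<open>a\<close> and \<open>c\<close> may be
  infinite.\<close>

lemma ereal_add_eq_move: "a + ereal b = c \<Longrightarrow> a = ereal (- b) + c"
  by (cases a; cases c) auto

theorem theorem1p9:
  fixes U0 :: "real \<Rightarrow> real" and U :: "real \<Rightarrow> real \<Rightarrow> real" and L :: "real \<Rightarrow> real"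
    and L0 :: ereal and r :: real
  assumes "admissible U0"
    and "classical_solution U0 U L"
    and "L0 = initial_boundary U0"
    and "r < sqrt 2" and "r \<noteq> 0"
  shows "enn2ereal (\<integral>\<^sup>+ x \<in> {x. L0 < ereal x}. ennreal (U0 x * exp (r * x)) \<partial>lborel) =
         - ereal (1 / r) * exp_ereal (ereal r * L0) +
         ereal (1 / r) *
           enn2ereal (\<integral>\<^sup>+ t \<in> {0<..}. ennreal (exp (r * L t - (1 + r\<^sup>2 / 2) * t)) \<partial>lborel)"
proof -
  have mono: "antimono U0" and U0: "\<And>x. 0 \<le> U0 x" "\<And>x. U0 x \<le> 1"
    and bot: "(U0 \<longlongrightarrow> 1) at_bot" and top: "(U0 \<longlongrightarrow> 0) at_top"
    using assms(1) unfolding admissible_def by (auto simp: image_subset_iff)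
  have "mono (\<lambda>x. 1 - U0 x)" using mono by (auto simp: mono_def antimono_def)
  then have W0m: "(\<lambda>x. 1 - U0 x) \<in> borel_measurable borel" by (rule borel_measurable_mono)
  then have "(\<lambda>x. 1 - (1 - U0 x)) \<in> borel_measurable borel" by measurable
  then have U0m: "U0 \<in> borel_measurable borel" by simp
  interpret contact_problem "\<lambda>t x. 1 - U t x" "\<lambda>t x. - deriv (\<lambda>s. U s x) t" "\<lambda>t x. - deriv (U t) x"
    "\<lambda>t x. - deriv (deriv (U t)) x" L
    by (rule classical_solution_contact_problem[OF assms(2)])
  have init: "L1_loc_tendsto (\<lambda>t x. 1 - U t x) (\<lambda>x. 1 - U0 x) (at_right 0)"
  proof -
    have "\<bar>(1 - U t x) - (1 - U0 x)\<bar> = \<bar>U t x - U0 x\<bar>" for t x by simp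
    then show ?thesis
      using assms(2) unfolding classical_solution_def FBP_def L1_loc_tendsto_def by simp
  qed
  have W0: "\<And>x. 0 \<le> 1 - U0 x" "\<And>x. 1 - U0 x \<le> 1" using U0 by auto
  define I where "I = front_integral r"
  have I: "(\<integral>\<^sup>+ t \<in> {0<..}. ennreal (exp (r * L t - (1 + r\<^sup>2 / 2) * t)) \<partial>lborel) = I"
    by (simp add: I_def front_integral_def)
  have L0: "L0 = Inf (ereal ` {x. U0 x < 1})" using assms(3) by (simp add: initial_boundary_def)
  have "\<forall>\<^sub>F x in at_top. U0 x < 1" using top by (rule order_tendstoD) simp
  then obtain x1 where "U0 x1 < 1" by (auto simp: eventually_at_top_linorder)
  then have "L0 \<le> ereal x1" unfolding L0 by (intro Inf_lower) auto
  then have L0_cases: "L0 = -\<infinity> \<or> (\<exists>l. L0 = ereal l)" by (cases L0) auto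
  have below: "U0 x = 1" if "ereal x < L0" for x
  proof (rule ccontr)
    assume "U0 x \<noteq> 1"
    then have "U0 x < 1" using U0(2)[of x] by simp
    then have "L0 \<le> ereal x" unfolding L0 by (intro Inf_lower) auto
    then show False using that by simp
  qed
  have m: "(\<lambda>x. ennreal (U0 x * exp (r * x))) \<in> borel_measurable lborel"
    "(\<lambda>x. ennreal ((1 - U0 x) * exp (r * x))) \<in> borel_measurable lborel"
    using U0m by measurable
  show ?thesis
  proof (cases "r > 0")
    case True
    \<comment> \<open>The initial datum of the contact problem is \<open>1 - U0\<close>, so the
      result for its complement speaks directly of \<open>U0\<close> on the whole line.\<close>
    have "(\<integral>\<^sup>+x. ennreal ((1 - (1 - U0 x)) * exp (r * x)) \<partial>lborel) = ennreal (1 / \<bar>r\<bar>) * I"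
      unfolding I_def by (rule antisym[OF upper_left[OF init W0 W0m True assms(4)] lower_left[OF init W0 W0m True]])
    then have X: "(\<integral>\<^sup>+x. ennreal (U0 x * exp (r * x)) \<partial>lborel) = ennreal (1 / r) * I" using True by simp
    have I_ereal: "enn2ereal (ennreal (1 / r) * I) = ereal (1 / r) * enn2ereal I"
      using True by (simp add: times_ennreal.rep_eq)
    from L0_cases show ?thesis
    proof (elim disjE exE)
      assume "L0 = -\<infinity>"
      then show ?thesis using X I_ereal True unfolding I by simp
    next
      fix l assume l: "L0 = ereal l"
      \<comment> \<open>Left of \<open>l\<close> the initial datum is 1, and this half-line
        contributes the finite amount \<open>exp (r * l) / r\<close>, to be moved to the other side
        even if the rest is infinite.\<close>
      have "(\<integral>\<^sup>+x. ennreal (U0 x * exp (r * x)) \<partial>lborel) =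
        (\<integral>\<^sup>+x. ennreal (U0 x * exp (r * x)) * indicator {l<..} x + ennreal (U0 x * exp (r * x)) * indicator {..l} x \<partial>lborel)"
        by (intro nn_integral_cong) (auto simp: indicator_def)
      also have "\<dots> = (\<integral>\<^sup>+x. ennreal (U0 x * exp (r * x)) * indicator {l<..} x \<partial>lborel) + (\<integral>\<^sup>+x. ennreal (U0 x * exp (r * x)) * indicator {..l} x \<partial>lborel)"
        using m(1) by (intro nn_integral_add) auto
      also have "(\<integral>\<^sup>+x. ennreal (U0 x * exp (r * x)) * indicator {..l} x \<partial>lborel) = (\<integral>\<^sup>+x. ennreal (exp (r * x)) * indicator {..l} x \<partial>lborel)"
        by (intro nn_integral_cong_AE eventually_mono[OF AE_lborel_singleton[of l]]) (auto simp: indicator_def below l)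
      also have "\<dots> = ennreal (exp (r * l) / r)" using nn_integral_exp_left[OF True, of l] True by simp
      finally have "(\<integral>\<^sup>+x. ennreal (U0 x * exp (r * x)) * indicator {l<..} x \<partial>lborel) + ennreal (exp (r * l) / r) = ennreal (1 / r) * I"
        using X by simp
      then have "enn2ereal (\<integral>\<^sup>+x. ennreal (U0 x * exp (r * x)) * indicator {l<..} x \<partial>lborel) + ereal (exp (r * l) / r) = ereal (1 / r) * enn2ereal I"
        unfolding I_ereal[symmetric] using True by (metis enn2ereal_ennreal plus_ennreal.rep_eq divide_nonneg_pos exp_ge_zero)
      from ereal_add_eq_move[OF this] show ?thesis
        unfolding I l by (simp add: greaterThan_def[symmetric])
    qed
  next
    case False
    then have r: "r < 0" using assms(5) by simp
    have Z: "(\<integral>\<^sup>+x. ennreal ((1 - U0 x) * exp (r * x)) \<partial>lborel) = ennreal (1 / \<bar>r\<bar>) * I"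
      unfolding I_def by (rule antisym[OF upper_right[OF init W0 W0m r] lower_right[OF init W0 W0m r]])
    from L0_cases show ?thesis
    proof (elim disjE exE)
      assume l: "L0 = -\<infinity>"
      \<comment> \<open>Near minus infinity the integrand is bounded below by a positive constant,
        so the left-hand side is infinite; the right-hand side is infinite by convention.\<close>
      have "\<forall>\<^sub>F x in at_bot. 1 / 2 < U0 x" using bot by (rule order_tendstoD) simp
      then obtain b where b: "\<And>x. x \<le> b \<Longrightarrow> 1 / 2 < U0 x" by (auto simp: eventually_at_bot_linorder)
      have "ennreal (1 / 2 * exp (r * b)) * indicator {..b} x \<le> ennreal (U0 x * exp (r * x))" for x
      proof (cases "x \<le> b")
        case True
        have "1 / 2 * exp (r * b) \<le> U0 x * exp (r * x)"
          using b[OF True] True r by (intro mult_mono) (auto simp: mult_left_mono_neg)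
        then show ?thesis using True by (simp add: ennreal_leI)
      qed simp
      then have "(\<integral>\<^sup>+x. ennreal (1 / 2 * exp (r * b)) * indicator {..b} x \<partial>lborel) \<le> (\<integral>\<^sup>+x. ennreal (U0 x * exp (r * x)) \<partial>lborel)"
        by (intro nn_integral_mono)
      moreover have "(\<integral>\<^sup>+x. ennreal (1 / 2 * exp (r * b)) * indicator {..b} x \<partial>lborel) = \<infinity>"
        by (simp add: nn_integral_cmult_indicator emeasure_atMost_infinite ennreal_mult_top)
      ultimately have "(\<integral>\<^sup>+x. ennreal (U0 x * exp (r * x)) \<partial>lborel) = \<infinity>" by (simp add: top_unique)
      then show ?thesis unfolding l rhs_at_minus_infinity[OF r] by simp
    next
      fix l assume l: "L0 = ereal l"
      let ?Y = "\<integral>\<^sup>+x. ennreal (U0 x * exp (r * x)) * indicator {l<..} x \<partial>lborel"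
      have Z': "(\<integral>\<^sup>+x. ennreal ((1 - U0 x) * exp (r * x)) \<partial>lborel) = (\<integral>\<^sup>+x. ennreal ((1 - U0 x) * exp (r * x)) * indicator {l<..} x \<partial>lborel)"
        by (intro nn_integral_cong_AE eventually_mono[OF AE_lborel_singleton[of l]]) (auto simp: indicator_def below l)
      \<comment> \<open>For \<open>r < 0\<close> only the integral of \<open>1 - U0\<close> is known
        so far. Adding that of \<open>U0\<close> gives the integral of \<open>exp (r * x)\<close>
        over the half-line, which is finite.\<close>
      have "?Y + ennreal (1 / \<bar>r\<bar>) * I = (\<integral>\<^sup>+x. ennreal (U0 x * exp (r * x)) * indicator {l<..} x + ennreal ((1 - U0 x) * exp (r * x)) * indicator {l<..} x \<partial>lborel)"
        unfolding Z[symmetric] Z' using m by (intro nn_integral_add[symmetric]) auto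
      also have "\<dots> = (\<integral>\<^sup>+x. ennreal (exp (r * x)) * indicator {l<..} x \<partial>lborel)"
        by (intro nn_integral_cong) (use U0 in \<open>auto simp: indicator_def ennreal_plus[symmetric] distrib_right[symmetric] simp del: ennreal_plus\<close>)
      also have "\<dots> = ennreal (exp (r * l) / \<bar>r\<bar>)" by (rule nn_integral_exp_right[OF r])
      finally have sum: "?Y + ennreal (1 / \<bar>r\<bar>) * I = ennreal (exp (r * l) / \<bar>r\<bar>)" .
      \<comment> \<open>The finite sum makes both summands finite, so what follows is arithmetic in
        the reals.\<close>
      then have fin: "?Y < top" "ennreal (1 / \<bar>r\<bar>) * I < top"
        by (metis ennreal_less_top ennreal_add_less_top)+
      then have "I < top" using r by (auto simp: ennreal_mult_less_top)
      then obtain i where i: "i \<ge> 0" "I = ennreal i" by (cases I) auto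
      obtain y where y: "y \<ge> 0" "?Y = ennreal y" using fin(1) by (cases ?Y) auto
      have w: "0 \<le> 1 / \<bar>r\<bar> * i" using i(1) by simp
      have "ennreal (y + 1 / \<bar>r\<bar> * i) = ennreal y + ennreal (1 / \<bar>r\<bar>) * ennreal i"
        unfolding ennreal_plus[OF y(1) w] by (subst ennreal_mult[OF _ i(1)]) simp_all
      also have "\<dots> = ennreal (exp (r * l) / \<bar>r\<bar>)"
        using sum unfolding y(2) i(2) .
      finally have sum': "y + 1 / \<bar>r\<bar> * i = exp (r * l) / \<bar>r\<bar>"
        using y(1) w by (subst (asm) ennreal_inj) auto
      have "1 / \<bar>r\<bar> = - (1 / r)" "exp (r * l) / \<bar>r\<bar> = - (1 / r) * exp (r * l)" using r by simp_all
      then have "y + - (1 / r) * i = - (1 / r) * exp (r * l)" using sum' by (simp only:)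
      then have "y = - (1 / r) * exp (r * l) + 1 / r * i" by linarith
      then have "enn2ereal ?Y = - ereal (1 / r) * ereal (exp (r * l)) + ereal (1 / r) * enn2ereal I"
        using y i by simp
      then show ?thesis unfolding I l by (simp add: greaterThan_def[symmetric])
    qed
  qed
qed

end
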